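(* Let $a(x)\in k(q,x)$, $a(x)\neq0$, and let $u\in\mathcal{M}er(C^* )$ be a nonzero meromorphic solution of $y(qx)=a(x)y(x)$. The following statements are equivalent: (1) $a(x)=\mu x^r\frac{g(qx)}{g(x)}$ for some $r\in\mathbb{Z}$, $g\in k(q,x)$ and $\mu\in k(q)$. (2) $u$ is a solution of a nontrivial algebraic $\delta_x$-relation with coefficients in $C_E(x,\ell_q)$ (and therefore in $C(x)$). (3) $u$ is a solution of a nontrivial algebraic $\partial_2$-relation with coefficients in $C_E(x,\ell_q)$.
   Context: Let $k$ be a field of characteristic zero, $k(q)$ the field of rational functions in $q$, $K$ a finite extension of $k(q)$, and $|\ |$ an extension to $K$ of the $q^{-1}$-adic absolute value on $k(q)$ (given on $k[q]$ by $|f|=d^{\deg_q f}$ for a fixed real $d>1$, so $|q|>1$). Let $C$ be the smallest valued extension of $(K,|\ |)$ that is complete and algebraically closed, $C^*=C\smallsetminus\{0\}$, and $\mathcal{M}er(C^* )$ the field of meromorphic functions on $C^*$ with respect to $|\ |$ (the field of fractions of the ring of analytic functions on $C^*$). Let $\sigma_q:f(x)\mapsto f(qx)$ and $C_E=\mathcal{M}er(C^* )^{\sigma_q}$ (elliptic functions). Let $\delta_x=x\frac{d}{dx}$ on $\mathcal{M}er(C^* )$, and let $\delta_q$ be the extension of $q\frac{d}{dq}$ on $k(q)$ to $C$ (by continuity) and then to $\mathcal{M}er(C^* )$ with $\delta_q(x)=0$. Let $\theta_q(x)=\sum_{n\in\mathbb{Z}}q^{-n(n-1)/2}x^n\in\mathcal{M}er(C^*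 )$ (so $\theta_q(qx)=qx\theta_q(x)$), $\ell_q=\frac{\delta_x(\theta_q)}{\theta_q}$ (so $\ell_q(qx)=\ell_q(x)+1$), and $\partial_2=\ell_q(x)\delta_x+\delta_q$, a derivation of $\mathcal{M}er(C^* )$ commuting with $\sigma_q$. The field $C_E(x,\ell_q)\subset\mathcal{M}er(C^* )$ is the subfield generated over $C_E$ by $x$ and $\ell_q$. A nontrivial algebraic $\delta_x$-relation (resp. $\partial_2$-relation) for $u$ is a nonzero polynomial $P$ with $P(u,\delta_xu,\dots,\delta_x^mu)=0$ (resp. $P(u,\partial_2u,\dots,\partial_2^mu)=0$) for some $m\ge0$. *)

theory Defs
  imports
    "HOL-Analysis.Infinite_Sum"
    "HOL-Computational_Algebra.Polynomial_Factorial"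
    "HOL-Library.Poly_Mapping"
begin

section \<open>Complete ultrametric fields\<close>

class complete_nonarch_field = field + complete_space +
  fixes absv :: "'a \<Rightarrow> real"
  assumes dist_absv: "dist x y = absv (x - y)"
    and absv_mult: "absv (x * y) = absv x * absv y"
    and absv_add: "absv (x + y) \<le> max (absv x) (absv y)"

lemma absv_eq_0 [simp]: "absv x = 0 \<longleftrightarrow> x = 0"
  using dist_eq_0_iff[of x 0] by (simp add: dist_absv)

lemma absv_ge_0 [simp]: "0 \<le> absv x"
  using zero_le_dist[of x 0] by (simp add: dist_absv)

lemma absv_0 [simp]: "absv 0 = 0"
  by simp

lemma absv_pos [simp]: "0 < absv x \<longleftrightarrow> x \<noteq> 0"
  using absv_ge_0[of x] absv_eq_0[of x] by linarith

lemma absv_minus [simp]: "absv (- x) = absv x"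
  using dist_commute[of 0 x] by (simp add: dist_absv)

lemma absv_1 [simp]: "absv (1::'a::complete_nonarch_field) = 1"
proof -
  have "absv (1::'a) * absv (1::'a) = absv (1 * 1 :: 'a)"
    by (rule absv_mult[symmetric])
  then have "absv (1::'a) * absv (1::'a) = absv (1::'a) * 1"
    by (simp only: mult_1_right)
  moreover have "absv (1::'a) \<noteq> 0"
    by simp
  ultimately show ?thesis
    by (rule mult_left_cancel[THEN iffD1, rotated])
qed

lemma absv_diff: "absv (x - y) \<le> max (absv x) (absv y)"
  using absv_add[of x "- y"] by simp

lemma absv_of_nat: "absv (of_nat n :: 'a::complete_nonarch_field) \<le> 1"
proof (induction n)
  case (Suc n)
  then have "max (absv (1::'a)) (absv (of_nat n :: 'a)) \<le> 1" by simp
  then show ?case using absv_add[of "1::'a" "of_nat n"] unfolding of_nat_Suc by (rule order_trans[rotated])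
qed simp

lemma absv_of_int: "absv (of_int n) \<le> 1"
  by (cases n rule: int_cases2) (auto simp: absv_of_nat)

lemma absv_inverse: "absv (inverse x) = inverse (absv x)"
proof (cases "x = 0")
  case False
  then have "absv x * absv (inverse x) = 1"
    by (simp flip: absv_mult)
  then show ?thesis
    by (rule inverse_unique[symmetric])
qed simp

lemma absv_divide: "absv (x / y) = absv x / absv y"
  by (simp add: divide_inverse absv_mult absv_inverse)

lemma absv_power: "absv (x ^ n) = absv x ^ n"
  by (induction n) (auto simp: absv_mult)

lemma absv_sum_less:
  assumes "finite A" "\<And>i. i \<in> A \<Longrightarrow> absv (f i) < B" "0 < B"
  shows "absv (sum f A) < B"
  using assms
proof (induction A rule: finite_induct)
  case (insert a A)
  then show ?case using absv_add[of "f a" "sum f A"] by fastforce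
qed simp

lemma absv_powi: "absv (x powi n) = absv x powi n"
  by (auto simp: power_int_def absv_power absv_inverse)

instance complete_nonarch_field \<subseteq> uniform_topological_group_add
proof
  fix a b :: 'a
  show "((\<lambda>x. fst x + snd x) \<longlongrightarrow> a + b) (nhds a \<times>\<^sub>F nhds b)"
  proof (rule tendstoI)
    fix e :: real assume e: "e > 0"
    have "eventually (\<lambda>x. dist x a < e) (nhds a)" "eventually (\<lambda>x. dist x b < e) (nhds b)"
      using e by (auto simp: eventually_nhds_metric)
    then have "eventually (\<lambda>x. dist (fst x) a < e \<and> dist (snd x) b < e) (nhds a \<times>\<^sub>F nhds b)"
      by (rule eventually_prodI[where P = "\<lambda>x. dist x a < e" and Q = "\<lambda>x. dist x b < e", simplified case_prod_unfold])
    then show "eventually (\<lambda>x. dist (fst x + snd x) (a + b) < e) (nhds a \<times>\<^sub>F nhds b)"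
    proof eventually_elim
      case (elim x)
      have "absv ((fst x - a) + (snd x - b)) \<le> max (absv (fst x - a)) (absv (snd x - b))"
        by (rule absv_add)
      then show ?case using elim by (auto simp: dist_absv algebra_simps)
    qed
  qed
  show "(uminus \<longlongrightarrow> - a) (nhds a)"
  proof (rule tendstoI)
    fix e :: real assume e: "e > 0"
    then have "eventually (\<lambda>x. dist x a < e) (nhds a)"
      by (auto simp: eventually_nhds_metric)
    then show "eventually (\<lambda>x. dist (- x) (- a) < e) (nhds a)"
    proof eventually_elim
      case (elim x)
      have "absv (- x - - a) = absv (- (x - a))" by simp
      then show ?case using elim unfolding dist_absv by (metis absv_minus)
    qed
  qed
  show "filterlim (\<lambda>((a::'a, b), (c, d)). (a + c, b + d)) uniformity (uniformity \<times>\<^sub>F uniformity)"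
    unfolding filterlim_def le_filter_def
  proof (intro allI impI)
    fix P :: "'a \<times> 'a \<Rightarrow> bool" assume "eventually P uniformity"
    then obtain e where e: "e > 0" "\<And>x y. dist x y < e \<Longrightarrow> P (x, y)"
      by (auto simp: eventually_uniformity_metric)
    let ?Q = "\<lambda>(x::'a, y). dist x y < e"
    have Q: "eventually ?Q uniformity"
      using e(1) by (auto simp: eventually_uniformity_metric)
    have "eventually (\<lambda>x. ?Q (fst x) \<and> ?Q (snd x)) (uniformity \<times>\<^sub>F uniformity)"
      using eventually_prodI[OF Q Q] by (simp add: case_prod_unfold)
    then have "eventually (\<lambda>x. P ((\<lambda>((a::'a, b), (c, d)). (a + c, b + d)) x)) (uniformity \<times>\<^sub>F uniformity)"
    proof eventually_elim
      case (elim x)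
      obtain a b c d where x: "x = ((a, b), (c, d))" by (metis surj_pair)
      have "absv ((a - b) + (c - d)) \<le> max (absv (a - b)) (absv (c - d))"
        by (rule absv_add)
      then show ?case using elim e(2)[of "a + c" "b + d"]
        by (auto simp: x dist_absv algebra_simps)
    qed
    then show "eventually P (filtermap (\<lambda>((a::'a, b), (c, d)). (a + c, b + d)) (uniformity \<times>\<^sub>F uniformity))"
      by (simp add: eventually_filtermap)
  qed
  show "filterlim (\<lambda>(a::'a, b). (- a, - b)) uniformity uniformity"
    unfolding filterlim_def le_filter_def
  proof (intro allI impI)
    fix P :: "'a \<times> 'a \<Rightarrow> bool" assume "eventually P uniformity"
    then obtain e where e: "e > 0" "\<And>x y. dist x y < e \<Longrightarrow> P (x, y)"
      by (auto simp: eventually_uniformity_metric)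
    have "dist (- x) (- y) = dist x y" for x y :: 'a
      by (metis dist_commute dist_absv minus_diff_minus absv_minus)
    then show "eventually P (filtermap (\<lambda>(a::'a, b). (- a, - b)) uniformity)"
      using e by (auto simp: eventually_filtermap eventually_uniformity_metric)
  qed
qed

instance complete_nonarch_field \<subseteq> topological_ab_group_add ..

instance complete_nonarch_field \<subseteq> topological_semigroup_mult
proof
  fix a b :: 'a
  show "((\<lambda>x. fst x * snd x) \<longlongrightarrow> a * b) (nhds a \<times>\<^sub>F nhds b)"
  proof (rule tendstoI)
    fix e :: real assume e: "e > 0"
    define M where "M = max 1 (max (absv a) (absv b))"
    define r where "r = min 1 (e / M)"
    have M: "M \<ge> 1" "absv a \<le> M" "absv b \<le> M" by (auto simp: M_def)
    have r: "r > 0" "r \<le> 1" "r * M \<le> e" using e M by (auto simp: r_def min_def field_simps)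
    have "eventually (\<lambda>x. dist x a < r) (nhds a)" "eventually (\<lambda>x. dist x b < r) (nhds b)"
      using r by (auto simp: eventually_nhds_metric)
    then have "eventually (\<lambda>x. dist (fst x) a < r \<and> dist (snd x) b < r) (nhds a \<times>\<^sub>F nhds b)"
      by (rule eventually_prodI[where P = "\<lambda>x. dist x a < r" and Q = "\<lambda>x. dist x b < r", simplified case_prod_unfold])
    then show "eventually (\<lambda>x. dist (fst x * snd x) (a * b) < e) (nhds a \<times>\<^sub>F nhds b)"
    proof eventually_elim
      case (elim x)
      define s t where "s = fst x - a" and "t = snd x - b"
      have st: "absv s < r" "absv t < r" using elim by (auto simp: s_def t_def dist_absv)
      have *: "absv (y * z) < e" if "absv y < r" "absv z \<le> M" for y z :: 'a
      proof -
        have "absv y * absv z \<le> absv y * M" by (rule mult_left_mono) (use that in auto)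
        also have "\<dots> < r * M" using that M by simp
        finally show ?thesis using r by (simp add: absv_mult)
      qed
      have "absv (s * t) < e" "absv (s * b) < e" "absv (t * a) < e"
        using st r M by (auto intro!: *)
      then have "absv (s * t + s * b + t * a) < e"
        using absv_add[of "s * t + s * b" "t * a"] absv_add[of "s * t" "s * b"]
        by linarith
      moreover have "s * t + s * b + t * a = fst x * snd x - a * b"
        by (simp add: s_def t_def algebra_simps)
      ultimately show ?case by (simp add: dist_absv)
    qed
  qed
qed

subsection \<open>Summable families are the null families\<close>

definition null_family :: "('i \<Rightarrow> 'a::complete_nonarch_field) \<Rightarrow> 'i set \<Rightarrow> bool" where
  "null_family f A \<longleftrightarrow> (\<forall>e>0. finite {i \<in> A. absv (f i) \<ge> e})"

lemma na_summable_iff: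
  fixes f :: "'i \<Rightarrow> 'a::complete_nonarch_field"
  shows "f summable_on A \<longleftrightarrow> null_family f A"
proof
  assume "f summable_on A"
  then obtain s where s: "(f has_sum s) A" by (auto simp: summable_on_def)
  show "null_family f A"
    unfolding null_family_def
  proof (intro allI impI)
    fix e :: real assume e: "e > 0"
    have "eventually (\<lambda>F. dist (sum f F) s < e) (finite_subsets_at_top A)"
      using s e unfolding has_sum_def by (rule tendstoD)
    then obtain X where X: "finite X" "X \<subseteq> A"
      "\<And>Y. finite Y \<Longrightarrow> X \<subseteq> Y \<Longrightarrow> Y \<subseteq> A \<Longrightarrow> dist (sum f Y) s < e"
      by (auto simp: eventually_finite_subsets_at_top)
    have "i \<in> X" if "i \<in> A" "absv (f i) \<ge> e" for i
    proof (rule ccontr)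
      assume "i \<notin> X"
      then have "f i = (sum f (insert i X) - s) - (sum f X - s)" using X by simp
      then have "absv (f i) \<le> max (absv (sum f (insert i X) - s)) (absv (sum f X - s))"
        using absv_diff by metis
      moreover have "absv (sum f (insert i X) - s) < e" "absv (sum f X - s) < e"
        using X(3)[of "insert i X", OF _ subset_insertI] X(3)[of X] X(1,2) that by (simp_all add: dist_absv)
      ultimately show False using that by linarith
    qed
    then show "finite {i \<in> A. absv (f i) \<ge> e}"
      using X(1) by (auto intro: finite_subset)
  qed
next
  assume null: "null_family f A"
  have "cauchy_filter (filtermap (sum f) (finite_subsets_at_top A))"
    unfolding cauchy_filter_metric_filtermap
  proof (intro allI impI)
    fix e :: real assume e: "e > 0"
    define X where "X = {i \<in> A. absv (f i) \<ge> e}"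
    have X: "finite X" "X \<subseteq> A" using null e by (auto simp: X_def null_family_def)
    have *: "absv (sum f Y - sum f X) < e" if "finite Y" "X \<subseteq> Y" "Y \<subseteq> A" for Y
    proof -
      have "sum f Y - sum f X = sum f (Y - X)" using that X by (simp add: sum_diff)
      moreover have "absv (sum f (Y - X)) < e"
        by (rule absv_sum_less) (use that e in \<open>auto simp: X_def not_le[symmetric]\<close>)
      ultimately show ?thesis by simp
    qed
    show "\<exists>P. eventually P (finite_subsets_at_top A) \<and>
           (\<forall>Y Z. P Y \<and> P Z \<longrightarrow> dist (sum f Y) (sum f Z) < e)"
    proof (intro exI conjI allI impI)
      show "eventually (\<lambda>Y. finite Y \<and> X \<subseteq> Y \<and> Y \<subseteq> A) (finite_subsets_at_top A)"
        using X by (auto simp: eventually_finite_subsets_at_top)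
      fix Y Z assume YZ: "(finite Y \<and> X \<subseteq> Y \<and> Y \<subseteq> A) \<and> (finite Z \<and> X \<subseteq> Z \<and> Z \<subseteq> A)"
      have "absv ((sum f Y - sum f X) - (sum f Z - sum f X)) < e"
        using absv_diff[of "sum f Y - sum f X" "sum f Z - sum f X"] *[of Y] *[of Z] YZ by auto
      then show "dist (sum f Y) (sum f Z) < e" by (simp add: dist_absv)
    qed
  qed
  moreover have "complete (UNIV :: 'a set)"
    by (meson Cauchy_convergent UNIV_I complete_def convergent_def)
  ultimately obtain L where "(sum f \<longlongrightarrow> L) (finite_subsets_at_top A)"
    using complete_uniform[where S = UNIV]
    by (force simp: filterlim_def filtermap_bot_iff finite_subsets_at_top_neq_bot)
  then show "f summable_on A"
    by (auto simp: summable_on_def has_sum_def)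
qed

lemma na_infsum_less:
  fixes f :: "'i \<Rightarrow> 'a::complete_nonarch_field"
  assumes "f summable_on A" "\<And>i. i \<in> A \<Longrightarrow> absv (f i) < B" "0 < B"
  shows "absv (infsum f A) < B"
proof -
  obtain F where F: "finite F" "F \<subseteq> A" "dist (sum f F) (infsum f A) \<le> B / 2"
    using infsum_finite_approximation[OF assms(1), of "B / 2"] assms(3) by auto
  have "absv (sum f F) < B"
    by (rule absv_sum_less) (use F assms in auto)
  moreover have "absv (sum f F - infsum f A) < B"
    using F(3) assms(3) by (simp add: dist_absv)
  moreover have "absv (infsum f A) \<le> max (absv (sum f F)) (absv (sum f F - infsum f A))"
    using absv_diff[of "sum f F" "sum f F - infsum f A"] by simp
  ultimately show ?thesis by linarith
qed

lemma null_family_bounded: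
  assumes "null_family f A"
  obtains M where "M \<ge> 1" "\<And>i. i \<in> A \<Longrightarrow> absv (f i) \<le> M"
proof -
  let ?X = "{i \<in> A. absv (f i) \<ge> 1}"
  have fin: "finite ?X" using assms by (auto simp: null_family_def)
  define M where "M = Max (insert 1 ((\<lambda>i. absv (f i)) ` ?X))"
  have "M \<ge> 1" using fin by (auto simp: M_def)
  moreover have "absv (f i) \<le> M" if "i \<in> A" for i
  proof (cases "absv (f i) \<ge> 1")
    case True
    then show ?thesis using fin that by (auto simp: M_def intro!: Max_ge)
  qed (use \<open>M \<ge> 1\<close> in auto)
  ultimately show ?thesis using that by blast
qed

lemma null_family_dominated:
  fixes f :: "'i \<Rightarrow> 'a::complete_nonarch_field" and g :: "'i \<Rightarrow> 'b::complete_nonarch_field"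
  assumes "null_family g A" "\<And>i. i \<in> A \<Longrightarrow> absv (f i) \<le> B * absv (g i)"
  shows "null_family f A"
  unfolding null_family_def
proof (intro allI impI)
  fix e :: real assume e: "e > 0"
  define C where "C = max 1 B"
  have C: "C \<ge> 1" "B \<le> C" by (auto simp: C_def)
  have "{i \<in> A. absv (f i) \<ge> e} \<subseteq> {i \<in> A. absv (g i) \<ge> e / C}"
  proof clarify
    fix i assume i: "i \<in> A" "absv (f i) \<ge> e"
    have "e \<le> B * absv (g i)" using assms(2)[OF i(1)] i(2) by linarith
    also have "\<dots> \<le> C * absv (g i)" by (rule mult_right_mono) (use C in auto)
    finally show "absv (g i) \<ge> e / C" using C by (simp add: field_simps)
  qed
  moreover have "finite {i \<in> A. absv (g i) \<ge> e / C}"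
    using assms(1) e C by (auto simp: null_family_def)
  ultimately show "finite {i \<in> A. absv (f i) \<ge> e}" by (rule finite_subset)
qed

lemma null_family_conv2:
  fixes f g :: "int \<Rightarrow> 'a::complete_nonarch_field"
  assumes "null_family f UNIV" "null_family g UNIV"
  shows "null_family (\<lambda>(n, i). f i * g (n - i)) UNIV"
  unfolding null_family_def
proof (intro allI impI)
  fix e :: real assume e: "e > 0"
  obtain M where M: "M \<ge> 1" "\<And>i. absv (f i) \<le> M" using null_family_bounded[OF assms(1)] by auto
  obtain N where N: "N \<ge> 1" "\<And>i. absv (g i) \<le> N" using null_family_bounded[OF assms(2)] by auto
  define X where "X = {i. absv (f i) \<ge> e / N}"
  define Y where "Y = {i. absv (g i) \<ge> e / M}"
  have fin: "finite X" "finite Y"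
    using assms e M(1) N(1) by (auto simp: X_def Y_def null_family_def)
  have "p \<in> (\<lambda>(i, j). (i + j, i)) ` (X \<times> Y)" if "absv (case p of (n, i) \<Rightarrow> f i * g (n - i)) \<ge> e" for p
  proof -
    obtain n i where p: "p = (n, i)" by force
    have le: "e \<le> absv (f i) * absv (g (n - i))" using that by (simp add: p absv_mult)
    have "e \<le> absv (f i) * N"
      using le mult_left_mono[OF N(2)[of "n - i"], of "absv (f i)"] by simp
    then have "i \<in> X" using N(1) by (simp add: X_def field_simps)
    moreover have "e \<le> M * absv (g (n - i))"
      using le mult_right_mono[OF M(2)[of i], of "absv (g (n - i))"] by simp
    then have "n - i \<in> Y" using M(1) by (simp add: Y_def field_simps)
    ultimately have "(i, n - i) \<in> X \<times> Y" by simp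
    then show ?thesis by (rule rev_image_eqI) (simp add: p)
  qed
  then show "finite {p \<in> UNIV. absv (case p of (n, i) \<Rightarrow> f i * g (n - i)) \<ge> e}"
    by (intro finite_subset[OF _ finite_imageI[OF finite_cartesian_product[OF fin]]] subsetI) simp
qed

lemma na_plus_cont: "uniformly_continuous_on UNIV (\<lambda>(x::'a::complete_nonarch_field, y). x + y)"
  by (rule uniformly_continuous_add)

lemma null_family_conv1:
  fixes f g :: "int \<Rightarrow> 'a::complete_nonarch_field"
  assumes "null_family f UNIV" "null_family g UNIV"
  shows "null_family (\<lambda>i. f i * g (n - i)) UNIV"
proof -
  obtain N where N: "\<And>i. absv (g i) \<le> N" using null_family_bounded[OF assms(2)] by auto
  show ?thesis
  proof (rule null_family_dominated[OF assms(1)])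
    fix i
    show "absv (f i * g (n - i)) \<le> N * absv (f i)"
      using mult_left_mono[OF N[of "n - i"], of "absv (f i)"] by (simp add: absv_mult mult.commute)
  qed
qed

lemma null_family_conv_infsum:
  fixes f g :: "int \<Rightarrow> 'a::complete_nonarch_field"
  assumes "null_family f UNIV" "null_family g UNIV"
  shows "null_family (\<lambda>n. \<Sum>\<^sub>\<infinity>i. f i * g (n - i)) UNIV"
proof -
  have 1: "(\<lambda>(n, i). f i * g (n - i)) summable_on (UNIV \<times> UNIV)"
    unfolding na_summable_iff UNIV_Times_UNIV by (rule null_family_conv2[OF assms])
  have 2: "(\<lambda>i. f i * g (n - i)) summable_on UNIV" for n
    unfolding na_summable_iff by (rule null_family_conv1[OF assms])
  have "(\<lambda>n. \<Sum>\<^sub>\<infinity>i. f i * g (n - i)) summable_on UNIV"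
    by (rule summable_on_Sigma[OF na_plus_cont 1 2])
  then show ?thesis by (simp only: na_summable_iff)
qed

section \<open>Analytic functions on the punctured line\<close>

text \<open>
  An analytic function on \<open>C \ {0}\<close> is given by the coefficients of its Laurent series
  \<open>\<Sum>n\<in>\<int>. a n x\<^sup>n\<close>, which has to converge at every nonzero point.  (Over a complete ultrametric
  field, convergence and unconditional convergence of a series are the same.)
\<close>

typedef (overloaded) 'a cstar_analytic =
  "{a :: int \<Rightarrow> 'a::complete_nonarch_field. \<forall>x. x \<noteq> 0 \<longrightarrow> (\<lambda>n. a n * x powi n) summable_on UNIV}"
  morphisms coeff_an Abs_an
  by (rule exI[of _ "\<lambda>_. 0"]) simp

setup_lifting type_definition_cstar_analytic

lemma coeff_an_null: "x \<noteq> 0 \<Longrightarrow> null_family (\<lambda>n. coeff_an f n * x powi n) UNIV"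
  using coeff_an[of f] by (auto simp: na_summable_iff)

lemma coeff_an_null1: "null_family (coeff_an f) UNIV"
  using coeff_an_null[of 1 f] by simp

lemma cstar_analytic_eqI: "(\<And>n. coeff_an f n = coeff_an g n) \<Longrightarrow> f = g"
  by (metis coeff_an_inject ext)

lemma coeff_Abs_an:
  assumes "\<And>x. x \<noteq> 0 \<Longrightarrow> (\<lambda>n. a n * x powi n) summable_on UNIV"
  shows "coeff_an (Abs_an a) = a"
  by (rule Abs_an_inverse) (use assms in auto)

lemma summable_on_finite_support:
  fixes f :: "'i \<Rightarrow> 'a::complete_nonarch_field"
  assumes "finite {i. f i \<noteq> 0}"
  shows "f summable_on UNIV"
  unfolding na_summable_iff null_family_def
proof (intro allI impI)
  fix e :: real assume "e > 0"
  then have "{i \<in> UNIV. e \<le> absv (f i)} \<subseteq> {i. f i \<noteq> 0}" by auto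
  then show "finite {i \<in> UNIV. e \<le> absv (f i)}" using assms finite_subset by blast
qed

text \<open>The monomial \<open>c x\<^sup>m\<close>.\<close>

lift_definition monom_an :: "'a::complete_nonarch_field \<Rightarrow> int \<Rightarrow> 'a cstar_analytic" is
  "\<lambda>c m n. if n = m then c else 0"
proof -
  fix c x :: 'a and m :: int
  have "finite {n. (if n = m then c else 0) * x powi n \<noteq> 0}"
    by (rule finite_subset[of _ "{m}"]) auto
  then show "(\<lambda>n. (if n = m then c else 0) * x powi n) summable_on UNIV"
    by (rule summable_on_finite_support)
qed

instantiation cstar_analytic :: (complete_nonarch_field) idom
begin

lift_definition zero_cstar_analytic :: "'a cstar_analytic" is "\<lambda>_. 0" by simp

definition one_cstar_analytic :: "'a cstar_analytic" where "1 = monom_an 1 0"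

lift_definition plus_cstar_analytic ::
  "'a cstar_analytic \<Rightarrow> 'a cstar_analytic \<Rightarrow> 'a cstar_analytic" is "\<lambda>a b n. a n + b n"
  by (auto simp: distrib_right intro!: summable_on_add)

lift_definition uminus_cstar_analytic :: "'a cstar_analytic \<Rightarrow> 'a cstar_analytic" is "\<lambda>a n. - a n"
  by (auto simp: na_summable_iff null_family_def)

definition minus_cstar_analytic ::
  "'a cstar_analytic \<Rightarrow> 'a cstar_analytic \<Rightarrow> 'a cstar_analytic"
  where "(f :: 'a cstar_analytic) - g = f + (- g)"

lift_definition times_cstar_analytic ::
  "'a cstar_analytic \<Rightarrow> 'a cstar_analytic \<Rightarrow> 'a cstar_analytic" is
  "\<lambda>a b n. \<Sum>\<^sub>\<infinity>i. a i * b (n - i)"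
proof -
  fix a b :: "int \<Rightarrow> 'a" and x :: 'a
  assume *: "\<And>x. x \<noteq> 0 \<Longrightarrow> (\<lambda>n. a n * x powi n) summable_on UNIV"
    "\<And>x. x \<noteq> 0 \<Longrightarrow> (\<lambda>n. b n * x powi n) summable_on UNIV" and x: "x \<noteq> 0"
  define A B where "A = (\<lambda>n. a n * x powi n)" and "B = (\<lambda>n. b n * x powi n)"
  have null: "null_family A UNIV" "null_family B UNIV"
    using * x by (auto simp: A_def B_def na_summable_iff)
  have "null_family a UNIV" "null_family b UNIV"
    using *[of 1] by (auto simp: na_summable_iff)
  then have ab: "(\<lambda>i. a i * b (n - i)) summable_on UNIV" for n
    using null_family_conv1 by (simp add: na_summable_iff)
  have "(\<Sum>\<^sub>\<infinity>i. A i * B (n - i)) = (\<Sum>\<^sub>\<infinity>i. a i * b (n - i)) * x powi n" for n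
  proof -
    have "A i * B (n - i) = a i * b (n - i) * x powi n" for i
      using power_int_add[of x i "n - i"] x by (simp add: A_def B_def)
    then show ?thesis using infsum_cmult_left[OF ab] by simp
  qed
  then show "(\<lambda>n. (\<Sum>\<^sub>\<infinity>i. a i * b (n - i)) * x powi n) summable_on UNIV"
    using null_family_conv_infsum[OF null] by (simp add: na_summable_iff)
qed

lemma conv_summable: "(\<lambda>i. coeff_an f i * coeff_an g (n - i)) summable_on UNIV"
  using null_family_conv1[OF coeff_an_null1 coeff_an_null1] by (simp add: na_summable_iff)

lemma times_an_assoc: "(f * g) * h = f * (g * h)" for f g h :: "'a cstar_analytic"
proof (rule cstar_analytic_eqI)
  fix n
  define a b c where abc: "a = coeff_an f" "b = coeff_an g" "c = coeff_an h"
  have ab: "(\<lambda>i. a i * b (m - i)) summable_on UNIV" for m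
    unfolding abc by (rule conv_summable)
  have bc: "(\<lambda>i. b i * c (m - i)) summable_on UNIV" for m
    unfolding abc by (rule conv_summable)
  define t where "t = (\<lambda>m i. a i * b (m - i) * c (n - m))"
  have bij: "bij_betw (\<lambda>m. m - i) UNIV UNIV" for i :: int
    by (rule bij_betwI[where g = "\<lambda>m. m + i"]) auto
  obtain M where M: "M \<ge> 1" "\<And>i. absv (c i) \<le> M"
    using null_family_bounded[OF coeff_an_null1[of h]] by (auto simp: abc)
  have t_sum: "(\<lambda>(m, i). t m i) summable_on UNIV \<times> UNIV"
    unfolding na_summable_iff
  proof (rule null_family_dominated)
    show "null_family (\<lambda>(m, i). a i * b (m - i)) (UNIV \<times> UNIV)"
      using null_family_conv2[OF coeff_an_null1[of f] coeff_an_null1[of g]] by (simp add: abc)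
    show "absv (case p of (m, i) \<Rightarrow> t m i) \<le> M * absv (case p of (m, i) \<Rightarrow> a i * b (m - i))" for p
      using mult_left_mono[OF M(2)[of "n - fst p"], of "absv (a (snd p) * b (fst p - snd p))"]
      by (cases p) (simp add: t_def absv_mult mult_ac)
  qed
  have t1: "(\<lambda>i. t m i) summable_on UNIV" for m
    using summable_on_cmult_left[OF ab] by (simp add: t_def)
  have t2: "(\<lambda>m. t m i) summable_on UNIV" for i
  proof -
    have "(\<lambda>m. b (m - i) * c (n - i - (m - i))) summable_on UNIV"
      using summable_on_reindex_bij_betw[OF bij, of "\<lambda>j. b j * c (n - i - j)"] bc by blast
    then have "(\<lambda>m. a i * (b (m - i) * c (n - i - (m - i)))) summable_on UNIV"
      by (rule summable_on_cmult_right)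
    then show ?thesis by (simp add: t_def mult_ac)
  qed
  have "coeff_an ((f * g) * h) n = (\<Sum>\<^sub>\<infinity>m. (\<Sum>\<^sub>\<infinity>i. a i * b (m - i)) * c (n - m))"
    by (simp add: times_cstar_analytic.rep_eq abc)
  also have "\<dots> = (\<Sum>\<^sub>\<infinity>m. \<Sum>\<^sub>\<infinity>i. t m i)"
    using infsum_cmult_left[OF ab] by (simp add: t_def)
  also have "\<dots> = (\<Sum>\<^sub>\<infinity>i. \<Sum>\<^sub>\<infinity>m. t m i)"
    by (rule infsum_swap[OF na_plus_cont t_sum]) (use t1 t2 in auto)
  also have "\<dots> = (\<Sum>\<^sub>\<infinity>i. a i * (\<Sum>\<^sub>\<infinity>j. b j * c (n - i - j)))"
  proof (rule infsum_cong)
    fix i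
    have "(\<Sum>\<^sub>\<infinity>m. t m i) = (\<Sum>\<^sub>\<infinity>m. a i * (b (m - i) * c (n - i - (m - i))))"
      by (simp add: t_def mult_ac)
    also have "\<dots> = (\<Sum>\<^sub>\<infinity>j. a i * (b j * c (n - i - j)))"
      by (rule infsum_reindex_bij_betw[OF bij])
    also have "\<dots> = a i * (\<Sum>\<^sub>\<infinity>j. b j * c (n - i - j))"
      by (rule infsum_cmult_right) (rule bc)
    finally show "(\<Sum>\<^sub>\<infinity>m. t m i) = a i * (\<Sum>\<^sub>\<infinity>j. b j * c (n - i - j))" .
  qed
  also have "\<dots> = coeff_an (f * (g * h)) n"
    by (simp add: times_cstar_analytic.rep_eq abc)
  finally show "coeff_an ((f * g) * h) n = coeff_an (f * (g * h)) n" .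
qed

lemma times_an_commute: "f * g = g * f" for f g :: "'a cstar_analytic"
proof (rule cstar_analytic_eqI)
  fix n
  have bij: "bij_betw (\<lambda>i. n - i) UNIV (UNIV :: int set)"
    by (rule bij_betwI[where g = "\<lambda>i. n - i"]) auto
  show "coeff_an (f * g) n = coeff_an (g * f) n"
    using infsum_reindex_bij_betw[OF bij, of "\<lambda>i. coeff_an f i * coeff_an g (n - i)"]
    by (simp add: times_cstar_analytic.rep_eq mult.commute)
qed

lemma times_an_distrib: "(f + g) * h = f * h + g * h" for f g h :: "'a cstar_analytic"
proof (rule cstar_analytic_eqI)
  fix n
  show "coeff_an ((f + g) * h) n = coeff_an (f * h + g * h) n"
    using infsum_add[OF conv_summable[of f h n] conv_summable[of g h n]]
    by (simp add: times_cstar_analytic.rep_eq plus_cstar_analytic.rep_eq distrib_right)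
qed

lemma coeff_monom_times: "coeff_an (monom_an c m * f) n = c * coeff_an f (n - m)"
proof -
  have "coeff_an (monom_an c m * f) n = (\<Sum>\<^sub>\<infinity>i\<in>{m}. c * coeff_an f (n - i))"
    unfolding times_cstar_analytic.rep_eq
    by (rule infsum_cong_neutral) (auto simp: monom_an.rep_eq)
  then show ?thesis by simp
qed

lemma null_family_last_max:
  fixes a :: "int \<Rightarrow> 'b::complete_nonarch_field"
  assumes "null_family a UNIV" "a k \<noteq> 0"
  obtains i where "a i \<noteq> 0" "\<And>j. absv (a j) \<le> absv (a i)" "\<And>j. j > i \<Longrightarrow> absv (a j) < absv (a i)"
proof -
  define X where "X = {j. absv (a j) \<ge> absv (a k)}"
  have X: "finite X" "k \<in> X" using assms by (auto simp: X_def null_family_def)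
  define M where "M = Max ((\<lambda>j. absv (a j)) ` X)"
  have Mk: "M \<ge> absv (a k)" using X by (auto simp: M_def)
  have le: "absv (a j) \<le> M" for j
  proof (cases "j \<in> X")
    case True then show ?thesis using X by (auto simp: M_def)
  next
    case False then show ?thesis using Mk by (auto simp: X_def)
  qed
  have "M \<in> (\<lambda>j. absv (a j)) ` X" unfolding M_def using X by (intro Max_in) auto
  then obtain i0 where i0: "absv (a i0) = M" "i0 \<in> X" by auto
  define Y where "Y = {j \<in> X. absv (a j) = M}"
  have Y: "finite Y" "i0 \<in> Y" using X i0 by (auto simp: Y_def)
  define i where "i = Max Y"
  have iY: "i \<in> Y" unfolding i_def using Y by (intro Max_in) auto
  have iM: "absv (a i) = M" using iY by (auto simp: Y_def)
  show thesis
  proof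
    show "a i \<noteq> 0" using iM Mk assms(2) absv_pos[of "a k"] by fastforce
    show "absv (a j) \<le> absv (a i)" for j using le iM by simp
    show "absv (a j) < absv (a i)" if "j > i" for j
    proof (rule ccontr)
      assume "\<not> ?thesis"
      then have "absv (a j) = M" using le[of j] iM by linarith
      then have "j \<in> Y" using Mk by (auto simp: Y_def X_def)
      then show False using Max_ge[OF Y(1), of j] that by (simp add: i_def)
    qed
  qed
qed

instance
proof
  fix f g h :: "'a cstar_analytic"
  show "f * g * h = f * (g * h)" by (rule times_an_assoc)
  show "f * g = g * f" by (rule times_an_commute)
  show "1 * f = f"
    by (rule cstar_analytic_eqI) (simp add: one_cstar_analytic_def coeff_monom_times)
  show "f + g + h = f + (g + h)" by transfer (simp add: add.assoc)
  show "f + g = g + f" by transfer (simp add: add.commute)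
  show "0 + f = f" by transfer simp
  show "- f + f = 0" by transfer simp
  show "f - g = f + - g" by (simp add: minus_cstar_analytic_def)
  show "(f + g) * h = f * h + g * h" by (rule times_an_distrib)
  show "h * (f + g) = h * f + h * g"
    by (simp only: times_an_commute[of h] times_an_distrib)
  show zero: "0 * f = 0"
    by (rule cstar_analytic_eqI) (simp add: times_cstar_analytic.rep_eq zero_cstar_analytic.rep_eq)
  show "f * 0 = 0"
    by (simp only: times_an_commute[of f] zero)
  have "coeff_an (0 :: 'a cstar_analytic) 0 \<noteq> coeff_an 1 0"
    by (simp add: one_cstar_analytic_def monom_an.rep_eq zero_cstar_analytic.rep_eq)
  then show "(0 :: 'a cstar_analytic) \<noteq> 1" by metis
  show "f * g \<noteq> 0" if nz: "f \<noteq> 0" "g \<noteq> 0"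
  proof -
    define a b where ab: "a = coeff_an f" "b = coeff_an g"
    have ex: "\<exists>k. coeff_an h k \<noteq> 0" if "h \<noteq> 0" for h :: "'a cstar_analytic"
      using that cstar_analytic_eqI[of h 0] by (auto simp: zero_cstar_analytic.rep_eq)
    obtain k l where kl: "a k \<noteq> 0" "b l \<noteq> 0"
      using ex[OF nz(1)] ex[OF nz(2)] by (auto simp: ab)
    have null: "null_family a UNIV" "null_family b UNIV"
      by (simp_all only: ab coeff_an_null1)
    obtain i where i: "a i \<noteq> 0" "\<And>j. absv (a j) \<le> absv (a i)"
      "\<And>j. j > i \<Longrightarrow> absv (a j) < absv (a i)"
      by (rule null_family_last_max[OF null(1) kl(1)]) blast
    obtain j where j: "b j \<noteq> 0" "\<And>k. absv (b k) \<le> absv (b j)"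
      "\<And>k. k > j \<Longrightarrow> absv (b k) < absv (b j)"
      by (rule null_family_last_max[OF null(2) kl(2)]) blast
    define n where "n = i + j"
    define s where "s = (\<lambda>m. a m * b (n - m))"
    have s_sum: "s summable_on UNIV" unfolding s_def ab by (rule conv_summable)
    have s_sum': "s summable_on (UNIV - {i})"
      using s_sum by (rule summable_on_cofin_subset) auto
    have small: "absv (infsum s (UNIV - {i})) < absv (s i)"
    proof (rule na_infsum_less[OF s_sum'])
      show "0 < absv (s i)" using i(1) j(1) by (simp add: s_def n_def)
      fix m assume m: "m \<in> UNIV - {i}"
      show "absv (s m) < absv (s i)"
      proof (cases "m > i")
        case True
        have "absv (a m) * absv (b (n - m)) \<le> absv (a m) * absv (b j)"
          by (intro mult_left_mono j(2)) auto
        also have "\<dots> < absv (a i) * absv (b j)"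
          using i(3)[OF True] j(1) by simp
        finally show ?thesis by (simp add: s_def n_def absv_mult)
      next
        case False
        then have "n - m > j" using m by (simp add: n_def)
        have "absv (a m) * absv (b (n - m)) \<le> absv (a i) * absv (b (n - m))"
          by (intro mult_right_mono i(2)) auto
        also have "\<dots> < absv (a i) * absv (b j)"
          using j(3)[OF \<open>n - m > j\<close>] i(1) by simp
        finally show ?thesis by (simp add: s_def n_def absv_mult)
      qed
    qed
    have "coeff_an (f * g) n = infsum s (insert i (UNIV - {i}))"
      by (simp add: times_cstar_analytic.rep_eq s_def ab insert_absorb)
    also have "\<dots> = s i + infsum s (UNIV - {i})"
      using s_sum' by (subst infsum_insert) auto
    finally have *: "coeff_an (f * g) n = s i + infsum s (UNIV - {i})" .
    have "coeff_an (f * g) n \<noteq> 0"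
    proof
      assume "coeff_an (f * g) n = 0"
      then have "infsum s (UNIV - {i}) = - s i" using * by (simp add: eq_neg_iff_add_eq_0 add.commute)
      then show False using small by simp
    qed
    then show ?thesis by (auto simp: zero_cstar_analytic.rep_eq)
  qed
qed

end


section \<open>Derivations and fraction fields\<close>

definition derivation :: "('a::comm_ring_1 \<Rightarrow> 'a) \<Rightarrow> bool" where
  "derivation D \<longleftrightarrow> (\<forall>x y. D (x + y) = D x + D y \<and> D (x * y) = D x * y + x * D y)"

text \<open>
  Extension of a ring endomorphism, respectively of a derivation, to the field of fractions.
  The descriptions are proper as soon as \<open>h\<close> is multiplicative and injective at \<open>0\<close>,
  respectively \<open>D\<close> is a derivation; see the two lemmas below.
\<close>

definition fract_map :: "('a::idom \<Rightarrow> 'a) \<Rightarrow> 'a fract \<Rightarrow> 'a fract" where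
  "fract_map h z = (THE w. \<forall>f g. g \<noteq> 0 \<longrightarrow> z = Fract f g \<longrightarrow> w = Fract (h f) (h g))"

definition fract_deriv :: "('a::idom \<Rightarrow> 'a) \<Rightarrow> 'a fract \<Rightarrow> 'a fract" where
  "fract_deriv D z =
     (THE w. \<forall>f g. g \<noteq> 0 \<longrightarrow> z = Fract f g \<longrightarrow> w = Fract (D f * g - f * D g) (g * g))"

lemma fract_map_Fract:
  assumes mult: "\<And>x y. h (x * y) = h x * h y" and inj: "\<And>x. h x = 0 \<longleftrightarrow> x = 0" and "g \<noteq> 0"
  shows "fract_map h (Fract f g) = Fract (h f) (h g)"
  unfolding fract_map_def
proof (rule the_equality)
  show "\<forall>f' g'. g' \<noteq> 0 \<longrightarrow> Fract f g = Fract f' g' \<longrightarrow> Fract (h f) (h g) = Fract (h f') (h g')"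
  proof (intro allI impI)
    fix f' g' assume g': "g' \<noteq> 0" and "Fract f g = Fract f' g'"
    then have "f * g' = f' * g" using assms(3) by (simp add: eq_fract)
    then have "h f * h g' = h f' * h g" by (metis mult)
    then show "Fract (h f) (h g) = Fract (h f') (h g')"
      using g' assms(3) by (simp add: eq_fract inj)
  qed
qed (use assms(3) in blast)

lemma fract_deriv_Fract:
  assumes "derivation D" and "g \<noteq> 0"
  shows "fract_deriv D (Fract f g) = Fract (D f * g - f * D g) (g * g)"
  unfolding fract_deriv_def
proof (rule the_equality)
  show "\<forall>f' g'. g' \<noteq> 0 \<longrightarrow> Fract f g = Fract f' g' \<longrightarrow>
          Fract (D f * g - f * D g) (g * g) = Fract (D f' * g' - f' * D g') (g' * g')"
  proof (intro allI impI)
    fix f' g' assume g': "g' \<noteq> 0" and "Fract f g = Fract f' g'"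
    then have eq: "f * g' = f' * g" using assms(2) by (simp add: eq_fract)
    then have "D (f * g') = D (f' * g)" by simp
    then have eq': "D f * g' + f * D g' = D f' * g + f' * D g"
      using assms(1) by (simp add: derivation_def)
    have "(D f * g - f * D g) * (g' * g') - (D f' * g' - f' * D g') * (g * g) =
      g * g' * ((D f * g' + f * D g') - (D f' * g + f' * D g))
      - (g * D g' + g' * D g) * (f * g' - f' * g)"
      by (simp add: algebra_simps)
    also have "\<dots> = 0" by (simp add: eq eq')
    finally show "Fract (D f * g - f * D g) (g * g) = Fract (D f' * g' - f' * D g') (g' * g')"
      using g' assms(2) by (simp add: eq_fract)
  qed
qed (use assms(2) in blast)

section \<open>Meromorphic functions on the punctured line\<close>

type_synonym 'a cstar_mero = "'a cstar_analytic fract"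

definition const_mero :: "'a::complete_nonarch_field \<Rightarrow> 'a cstar_mero" where
  "const_mero c = to_fract (monom_an c 0)"

definition x_mero :: "'a::complete_nonarch_field cstar_mero" where
  "x_mero = to_fract (monom_an 1 1)"

text \<open>The dilation \<open>f(x) \<mapsto> f(q x)\<close>.\<close>

lift_definition sigma_an :: "'a::complete_nonarch_field \<Rightarrow> 'a cstar_analytic \<Rightarrow> 'a cstar_analytic" is
  "\<lambda>q a n. a n * q powi n"
proof -
  fix q x :: 'a and a :: "int \<Rightarrow> 'a"
  assume a: "\<And>x. x \<noteq> 0 \<Longrightarrow> (\<lambda>n. a n * x powi n) summable_on UNIV" and x: "x \<noteq> 0"
  show "(\<lambda>n. a n * q powi n * x powi n) summable_on UNIV"
  proof (cases "q = 0")
    case False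
    then have "(\<lambda>n. a n * (q * x) powi n) summable_on UNIV" using a[of "q * x"] x by simp
    then show ?thesis by (simp add: power_int_mult_distrib mult.assoc)
  next
    case True
    have "finite {n. a n * q powi n * x powi n \<noteq> 0}"
      by (rule finite_subset[of _ "{0}"]) (auto simp: True power_int_0_left_if)
    then show ?thesis by (rule summable_on_finite_support)
  qed
qed

definition sigma_mero :: "'a::complete_nonarch_field \<Rightarrow> 'a cstar_mero \<Rightarrow> 'a cstar_mero" where
  "sigma_mero q = fract_map (sigma_an q)"

text \<open>The derivation \<open>x d/dx\<close>.\<close>

lift_definition delta_x_an :: "'a::complete_nonarch_field cstar_analytic \<Rightarrow> 'a cstar_analytic" is
  "\<lambda>a n. of_int n * a n"
proof -
  fix a :: "int \<Rightarrow> 'a" and x :: 'a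
  assume a: "\<And>x. x \<noteq> 0 \<Longrightarrow> (\<lambda>n. a n * x powi n) summable_on UNIV" and x: "x \<noteq> 0"
  have "null_family (\<lambda>n. of_int n * a n * x powi n) UNIV"
  proof (rule null_family_dominated)
    show "null_family (\<lambda>n. a n * x powi n) UNIV" using a[OF x] by (simp add: na_summable_iff)
    show "absv (of_int n * a n * x powi n) \<le> 1 * absv (a n * x powi n)" for n
      using mult_right_mono[OF absv_of_int[of n, where ?'a = 'a], of "absv (a n * x powi n)"]
      by (simp add: absv_mult mult.assoc)
  qed
  then show "(\<lambda>n. of_int n * a n * x powi n) summable_on UNIV" by (simp add: na_summable_iff)
qed

definition delta_x :: "'a::complete_nonarch_field cstar_mero \<Rightarrow> 'a cstar_mero" where
  "delta_x = fract_deriv delta_x_an"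

text \<open>
  A derivation \<open>D\<close> of the coefficient field acts coefficientwise on Laurent series; this is the
  extension of \<open>D\<close> with \<open>D(x) = 0\<close>.  It preserves convergence if \<open>D\<close> is bounded, see
  \<open>coeff_coeffwise_an\<close>, and a continuous derivation is bounded, see \<open>continuous_derivation_bounded\<close>.
\<close>

definition coeffwise_an ::
  "('a::complete_nonarch_field \<Rightarrow> 'a) \<Rightarrow> 'a cstar_analytic \<Rightarrow> 'a cstar_analytic" where
  "coeffwise_an D f = Abs_an (\<lambda>n. D (coeff_an f n))"

definition delta_q :: "('a::complete_nonarch_field \<Rightarrow> 'a) \<Rightarrow> 'a cstar_mero \<Rightarrow> 'a cstar_mero" where
  "delta_q D = fract_deriv (coeffwise_an D)"

text \<open>The Laurent series is convergent for \<open>absv q > 1\<close>, see \<open>coeff_theta_an\<close>.\<close>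

definition theta_an :: "'a::complete_nonarch_field \<Rightarrow> 'a cstar_analytic" where
  "theta_an q = Abs_an (\<lambda>n. q powi (- (n * (n - 1) div 2)))"

definition ell :: "'a::complete_nonarch_field \<Rightarrow> 'a cstar_mero" where
  "ell q = delta_x (to_fract (theta_an q)) / to_fract (theta_an q)"

definition partial2 ::
  "'a::complete_nonarch_field \<Rightarrow> ('a \<Rightarrow> 'a) \<Rightarrow> 'a cstar_mero \<Rightarrow> 'a cstar_mero" where
  "partial2 q D f = ell q * delta_x f + delta_q D f"

definition elliptic_functions :: "'a::complete_nonarch_field \<Rightarrow> 'a cstar_mero set" where
  "elliptic_functions q = {f. sigma_mero q f = f}"

subsection \<open>These operations are well defined and have the expected values\<close>

definition eval_an :: "'a::complete_nonarch_field cstar_analytic \<Rightarrow> 'a \<Rightarrow> 'a" where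
  "eval_an f x = (\<Sum>\<^sub>\<infinity>n. coeff_an f n * x powi n)"

lemma eval_an_plus:
  assumes "x \<noteq> 0"
  shows "eval_an (f + g) x = eval_an f x + eval_an g x"
  unfolding eval_an_def plus_cstar_analytic.rep_eq distrib_right
  by (rule infsum_add) (use coeff_an_null[OF assms] in \<open>simp_all only: na_summable_iff\<close>)

lemma eval_an_times:
  assumes x: "x \<noteq> 0"
  shows "eval_an (f * g) x = eval_an f x * eval_an g x"
proof -
  define A B where "A = (\<lambda>n. coeff_an f n * x powi n)" and "B = (\<lambda>n. coeff_an g n * x powi n)"
  have null: "null_family A UNIV" "null_family B UNIV"
    unfolding A_def B_def by (rule coeff_an_null[OF x])+
  have sums: "A summable_on UNIV" "B summable_on UNIV"
    using null by (simp_all only: na_summable_iff)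
  have bij: "bij_betw (\<lambda>n. n - i) UNIV UNIV" for i :: int
    by (rule bij_betwI[where g = "\<lambda>n. n + i"]) auto
  have joint: "(\<lambda>(n, i). A i * B (n - i)) summable_on (UNIV \<times> UNIV)"
    unfolding na_summable_iff UNIV_Times_UNIV by (rule null_family_conv2[OF null])
  have row: "(\<lambda>i. A i * B (n - i)) summable_on UNIV" for n
    unfolding na_summable_iff by (rule null_family_conv1[OF null])
  have col: "(\<lambda>n. A i * B (n - i)) summable_on UNIV" for i
    using summable_on_reindex_bij_betw[OF bij, of B i] sums(2) by (intro summable_on_cmult_right) simp
  have coeff: "coeff_an (f * g) n * x powi n = (\<Sum>\<^sub>\<infinity>i. A i * B (n - i))" for n
  proof -
    have "A i * B (n - i) = coeff_an f i * coeff_an g (n - i) * x powi n" for i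
      using power_int_add[of x i "n - i"] x by (simp add: A_def B_def)
    then show ?thesis
      using infsum_cmult_left[OF conv_summable[of f g n], of "x powi n"]
      by (simp only: times_cstar_analytic.rep_eq)
  qed
  have "eval_an (f * g) x = (\<Sum>\<^sub>\<infinity>n. \<Sum>\<^sub>\<infinity>i. A i * B (n - i))"
    by (simp only: eval_an_def coeff)
  also have "\<dots> = (\<Sum>\<^sub>\<infinity>i. \<Sum>\<^sub>\<infinity>n. A i * B (n - i))"
    by (rule infsum_swap[OF na_plus_cont joint]) (rule row, rule col)
  also have "\<dots> = (\<Sum>\<^sub>\<infinity>i. A i * infsum B UNIV)"
  proof (rule infsum_cong)
    fix i
    have "(\<Sum>\<^sub>\<infinity>n. A i * B (n - i)) = (\<Sum>\<^sub>\<infinity>n. A i * B n)"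
      by (rule infsum_reindex_bij_betw[OF bij, of "\<lambda>n. A i * B n"])
    also have "\<dots> = A i * infsum B UNIV"
      by (rule infsum_cmult_right) (rule sums(2))
    finally show "(\<Sum>\<^sub>\<infinity>n. A i * B (n - i)) = A i * infsum B UNIV" .
  qed
  also have "\<dots> = infsum A UNIV * infsum B UNIV"
    by (rule infsum_cmult_left) (rule sums(1))
  finally show ?thesis by (simp only: eval_an_def A_def B_def)
qed

lemma eval_an_monom: "eval_an (monom_an c m) x = c * x powi m"
proof -
  have "eval_an (monom_an c m) x = (\<Sum>\<^sub>\<infinity>i\<in>{m}. c * x powi i)"
    unfolding eval_an_def monom_an.rep_eq by (rule infsum_cong_neutral) auto
  then show ?thesis by simp
qed

lemma eval_an_sigma: "eval_an (sigma_an q f) x = eval_an f (q * x)"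
  by (simp add: eval_an_def sigma_an.rep_eq power_int_mult_distrib mult.assoc)

lemma sigma_an_times:
  assumes "q \<noteq> 0"
  shows "sigma_an q (f * g) = sigma_an q f * sigma_an q g"
proof (rule cstar_analytic_eqI)
  fix n
  have *: "coeff_an f i * q powi i * (coeff_an g (n - i) * q powi (n - i)) =
        coeff_an f i * coeff_an g (n - i) * q powi n" for i
    using power_int_add[of q i "n - i"] assms by simp
  then show "coeff_an (sigma_an q (f * g)) n = coeff_an (sigma_an q f * sigma_an q g) n"
    using infsum_cmult_left[OF conv_summable[of f g n], of "q powi n"]
    by (simp only: sigma_an.rep_eq times_cstar_analytic.rep_eq *)
qed

lemma sigma_an_eq_0: "q \<noteq> 0 \<Longrightarrow> sigma_an q f = 0 \<longleftrightarrow> f = 0"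
  by transfer (auto simp: fun_eq_iff)

lemma sigma_mero_Fract:
  "q \<noteq> 0 \<Longrightarrow> g \<noteq> 0 \<Longrightarrow> sigma_mero q (Fract f g) = Fract (sigma_an q f) (sigma_an q g)"
  unfolding sigma_mero_def by (rule fract_map_Fract) (auto simp: sigma_an_times sigma_an_eq_0)

lemma derivation_delta_x_an: "derivation delta_x_an"
  unfolding derivation_def
proof (intro allI conjI)
  fix f g :: "'a cstar_analytic"
  show "delta_x_an (f + g) = delta_x_an f + delta_x_an g"
    by transfer (simp add: distrib_left)
  show "delta_x_an (f * g) = delta_x_an f * g + f * delta_x_an g"
  proof (rule cstar_analytic_eqI)
    fix n
    have "of_int n * (coeff_an f i * coeff_an g (n - i)) =
      of_int i * coeff_an f i * coeff_an g (n - i) + coeff_an f i * (of_int (n - i) * coeff_an g (n - i))" for i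
      by (simp add: algebra_simps)
    then show "coeff_an (delta_x_an (f * g)) n = coeff_an (delta_x_an f * g + f * delta_x_an g) n"
      using infsum_cmult_right[OF conv_summable[of f g n], of "of_int n"]
        infsum_add[OF conv_summable[of "delta_x_an f" g n] conv_summable[of f "delta_x_an g" n]]
      by (simp add: delta_x_an.rep_eq times_cstar_analytic.rep_eq plus_cstar_analytic.rep_eq)
  qed
qed

lemma delta_x_Fract:
  "g \<noteq> 0 \<Longrightarrow> delta_x (Fract f g) = Fract (delta_x_an f * g - f * delta_x_an g) (g * g)"
  unfolding delta_x_def by (rule fract_deriv_Fract[OF derivation_delta_x_an])

lemma coeff_coeffwise_an:
  assumes "\<And>c. absv (D c) \<le> B * absv c"
  shows "coeff_an (coeffwise_an D f) n = D (coeff_an f n)"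
proof -
  have "(\<lambda>n. D (coeff_an f n) * x powi n) summable_on UNIV" if x: "x \<noteq> 0" for x
    unfolding na_summable_iff
  proof (rule null_family_dominated[OF coeff_an_null[OF x, of f]])
    show "absv (D (coeff_an f n) * x powi n) \<le> B * absv (coeff_an f n * x powi n)" for n
      using mult_right_mono[OF assms[of "coeff_an f n"], of "absv (x powi n)"]
      by (simp add: absv_mult mult.assoc)
  qed
  then show ?thesis unfolding coeffwise_an_def by (subst coeff_Abs_an) auto
qed

lemma derivation_0: "derivation D \<Longrightarrow> D 0 = 0"
  unfolding derivation_def by (metis add_cancel_right_right)

lemma derivation_power:
  assumes "derivation D"
  shows "x * D (x ^ n) = of_nat n * x ^ n * D x"
proof (induction n)
  case 0
  have "D (1 * 1) = D 1 * 1 + 1 * D 1" using assms unfolding derivation_def by blast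
  then show ?case by simp
next
  case (Suc n)
  have "x * D (x ^ Suc n) = x * (D x * x ^ n + x * D (x ^ n))"
    using assms by (simp add: derivation_def)
  also have "\<dots> = x * D x * x ^ n + x * (of_nat n * x ^ n * D x)"
    by (simp add: distrib_left Suc.IH mult.assoc)
  finally show ?case by (simp add: algebra_simps)
qed

lemma continuous_derivation_bounded:
  fixes D :: "'a::complete_nonarch_field \<Rightarrow> 'a" and q :: 'a
  assumes D: "derivation D" and cont: "continuous_on UNIV D" and q: "absv q > 1"
  obtains B where "\<And>c. absv (D c) \<le> B * absv c"
proof -
  have q0: "q \<noteq> 0" using q by auto
  have D_add: "D (x + y) = D x + D y" and D_mult: "D (x * y) = D x * y + x * D y" for x y
    using D by (auto simp: derivation_def)
  obtain e where e: "e > 0" "\<And>x. absv x < e \<Longrightarrow> absv (D x) < 1"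
  proof -
    have "(D \<longlongrightarrow> D 0) (at 0)"
      using cont by (simp add: continuous_on_def)
    then have "eventually (\<lambda>x. dist (D x) (D 0) < 1) (at 0)"
      by (rule tendstoD) simp
    then obtain d where d: "d > 0" "\<And>x. x \<noteq> 0 \<Longrightarrow> dist x 0 < d \<Longrightarrow> dist (D x) (D 0) < 1"
      by (auto simp: eventually_at)
    have "absv (D x) < 1" if "absv x < d" for x
      using d(2)[of x] that derivation_0[OF D] by (cases "x = 0") (auto simp: dist_absv)
    then show ?thesis using that d(1) by blast
  qed
  define L where "L = absv (D q / q)"
  define B where "B = max (absv q / e) L"
  \<comment> \<open>\<open>y\<close> of absolute value in \<open>[e / \<bar>q\<bar>, e)\<close>\<close>
  have small: "absv (D y) \<le> B * absv y" if "absv y < e" "absv y * absv q \<ge> e" for y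
  proof -
    have "absv (D y) \<le> 1" using e that by (simp add: less_imp_le)
    also have "1 \<le> absv q / e * absv y" using that e(1) by (simp add: field_simps)
    also have "\<dots> \<le> B * absv y" by (rule mult_right_mono) (auto simp: B_def)
    finally show ?thesis .
  qed
  have transport: "absv (D x) \<le> B * absv x"
    if xy: "x * z = y" and z: "z \<noteq> 0" and Dz: "absv (D z / z) \<le> L" and y: "absv (D y) \<le> B * absv y"
    for x y z
  proof -
    have "D x * z = D y - x * D z" using D_mult[of x z] xy by simp
    then have Dx: "D x = D y / z - x * (D z / z)" using z by (simp add: field_simps)
    have "absv (D x) \<le> max (absv (D y / z)) (absv (x * (D z / z)))"
      unfolding Dx by (rule absv_diff)
    moreover have "absv (D y / z) \<le> B * absv x"
    proof -
      have "absv (D y) \<le> (B * absv x) * absv z"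
        using y unfolding xy[symmetric] absv_mult by (simp only: mult.assoc)
      then show ?thesis
        using z unfolding absv_divide by (subst pos_divide_le_eq) simp_all
    qed
    moreover have "absv (x * (D z / z)) \<le> B * absv x"
    proof -
      have "absv x * absv (D z / z) \<le> absv x * B"
        by (rule mult_left_mono) (use Dz in \<open>auto simp: B_def\<close>)
      then show ?thesis unfolding absv_mult by (simp only: mult.commute)
    qed
    ultimately show ?thesis by (meson max.boundedI order_trans)
  qed
  have qn: "absv (D (q ^ n) / q ^ n) \<le> L" for n
  proof -
    have "D (q ^ n) / q ^ n = of_nat n * (D q / q)"
      using derivation_power[OF D, of q n] q0 by (simp add: field_simps)
    then show ?thesis
      using mult_right_mono[OF absv_of_nat[of n, where ?'a = 'a], of "absv (D q / q)"]
      by (simp only: absv_mult L_def mult_1 absv_ge_0)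
  qed
  have qn': "absv (D (inverse (q ^ n)) / inverse (q ^ n)) \<le> L" for n
  proof -
    have "D 1 = D 1 + D 1" using D_mult[of 1 1] by (simp only: mult_1 mult_1_right)
    then have D1: "D 1 = 0" by (simp only: add_cancel_right_right)
    have "D (inverse (q ^ n)) * q ^ n + inverse (q ^ n) * D (q ^ n) = 0"
      using D_mult[of "inverse (q ^ n)" "q ^ n"] D1 q0 by simp
    then have "D (inverse (q ^ n)) / inverse (q ^ n) = - (D (q ^ n) / q ^ n)"
      using q0 by (simp add: field_simps eq_neg_iff_add_eq_0)
    then show ?thesis using qn[of n] by simp
  qed
  have "absv (D x) \<le> B * absv x" for x
  proof (cases "x = 0")
    case True
    then show ?thesis using derivation_0[OF D] by simp
  next
    case x: False
    define P where "P = (\<lambda>n. absv x < e * absv q ^ n)"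
    show ?thesis
    proof (cases "absv x < e")
      case False
      obtain n where "P n"
        unfolding P_def using real_arch_pow[OF q, of "absv x / e"] e(1) by (auto simp: field_simps)
      define m where "m = (LEAST n. P n)"
      have Pm: "P m" unfolding m_def using \<open>P n\<close> by (rule LeastI)
      have "m \<noteq> 0" using Pm False unfolding P_def by (cases m) simp_all
      then obtain l where l: "m = Suc l" using not0_implies_Suc by blast
      have "\<not> P l" using not_less_Least[of l P] l by (simp add: m_def)
      show ?thesis
      proof (rule transport[of x "inverse (q ^ m)" "x * inverse (q ^ m)"])
        have "absv q > 0" using q by linarith
        then have pos: "absv q ^ m > 0" "absv q ^ l > 0" by (rule zero_less_power)+
        have "absv (x * inverse (q ^ m)) = absv x / absv q ^ m"
          by (simp add: absv_mult absv_inverse absv_power divide_inverse)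
        moreover have "absv x / absv q ^ m < e" using Pm pos by (simp only: P_def pos_divide_less_eq)
        moreover have "absv x / absv q ^ m * absv q \<ge> e"
        proof -
          have "absv x / absv q ^ m * absv q = absv x / absv q ^ l" using q0 by (simp add: l)
          moreover have "e \<le> absv x / absv q ^ l"
            using \<open>\<not> P l\<close> pos by (simp only: P_def pos_le_divide_eq not_less)
          ultimately show ?thesis by simp
        qed
        ultimately show "absv (D (x * inverse (q ^ m))) \<le> B * absv (x * inverse (q ^ m))"
          by (intro small) auto
      qed (use q0 qn' in auto)
    next
      case True
      define Q where "Q = (\<lambda>n. absv x * absv q ^ n * absv q \<ge> e)"
      obtain n where "e / absv x < absv q ^ n" using real_arch_pow[OF q] by blast
      then have "e \<le> absv x * absv q ^ n" using x by (simp add: field_simps)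
      also have "\<dots> \<le> absv x * absv q ^ n * absv q"
        using q mult_left_mono[of 1 "absv q" "absv x * absv q ^ n"] by simp
      finally have "Q n" by (simp add: Q_def)
      define m where "m = (LEAST n. Q n)"
      have Qm: "Q m" unfolding m_def using \<open>Q n\<close> by (rule LeastI)
      have lt: "absv x * absv q ^ m < e"
      proof (cases m)
        case (Suc l)
        then have "\<not> Q l" using not_less_Least[of l Q] by (simp add: m_def)
        then show ?thesis by (simp add: Q_def Suc mult_ac)
      qed (use True in auto)
      show ?thesis
      proof (rule transport[of x "q ^ m" "x * q ^ m"])
        show "absv (D (x * q ^ m)) \<le> B * absv (x * q ^ m)"
          using lt Qm by (intro small) (auto simp: absv_mult absv_power Q_def)
      qed (use q0 qn in auto)
    qed
  qed
  then show ?thesis using that by blast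
qed

lemma coeff_theta_an:
  assumes q: "absv q > 1"
  shows "coeff_an (theta_an q) n = q powi (- (n * (n - 1) div 2))"
proof -
  have "(\<lambda>n. q powi (- (n * (n - 1) div 2)) * x powi n) summable_on UNIV" if x: "x \<noteq> 0" for x
    unfolding na_summable_iff null_family_def
  proof (intro allI impI)
    fix e :: real assume e: "e > 0"
    define Q where "Q = absv q"
    have Q: "Q > 1" using q by (simp add: Q_def)
    obtain N1 where N1: "absv x < Q ^ N1" using real_arch_pow[OF Q] by blast
    obtain N2 where N2: "inverse (absv x) < Q ^ N2" using real_arch_pow[OF Q] by blast
    obtain N3 where N3: "inverse e < Q ^ N3" using real_arch_pow[OF Q] by blast
    define N where "N = N1 + N2"
    have NN: "Q ^ N1 \<le> Q ^ N" "Q ^ N2 \<le> Q ^ N"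
      using Q by (auto simp: N_def intro!: power_increasing)
    have le1: "absv x \<le> Q ^ N" and le2: "inverse (absv x) \<le> Q ^ N"
      using NN N1 N2 by linarith+
    have xn: "absv x powi n \<le> Q powi (int N * \<bar>n\<bar>)" for n
    proof (cases "n \<ge> 0")
      case True
      then obtain k where k: "n = int k" using nonneg_eq_int by blast
      have "absv x powi n = absv x ^ k" by (simp add: k)
      also have "\<dots> \<le> (Q ^ N) ^ k" using le1 by (intro power_mono) auto
      also have "\<dots> = Q powi int (N * k)" unfolding power_int_of_nat by (simp only: power_mult)
      finally show ?thesis by (simp add: k)
    next
      case False
      then have "n = - int (nat (- n))" by simp
      then obtain k where k: "n = - int k" by blast
      have "absv x powi n = inverse (absv x) ^ k" by (simp add: k power_int_minus power_inverse)
      also have "\<dots> \<le> (Q ^ N) ^ k" using le2 by (intro power_mono) auto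
      also have "\<dots> = Q powi int (N * k)" unfolding power_int_of_nat by (simp only: power_mult)
      finally show ?thesis by (simp add: k)
    qed
    define b where "b = 2 * (int N + 1) + int N3 + 1"
    have bound: "\<bar>n\<bar> \<le> b" if ge: "absv (q powi (- (n * (n - 1) div 2)) * x powi n) \<ge> e" for n
    proof (rule ccontr)
      assume "\<not> \<bar>n\<bar> \<le> b"
      then have n: "\<bar>n\<bar> > b" by simp
      have "2 * (\<bar>n\<bar> * (int N + 1)) = \<bar>n\<bar> * (2 * (int N + 1))" by simp
      also have "\<dots> \<le> \<bar>n\<bar> * (\<bar>n\<bar> - 1)"
        by (rule mult_left_mono) (use n in \<open>auto simp: b_def\<close>)
      also have "\<dots> \<le> n * (n - 1)" by (cases "n \<ge> 0") (auto simp: algebra_simps)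
      finally have "\<bar>n\<bar> * (int N + 1) \<le> n * (n - 1) div 2" by linarith
      then have exp: "int N * \<bar>n\<bar> - n * (n - 1) div 2 \<le> - int N3"
        using n by (simp add: algebra_simps b_def)
      have "absv (q powi (- (n * (n - 1) div 2)) * x powi n)
          = Q powi (- (n * (n - 1) div 2)) * absv x powi n"
        by (simp add: absv_mult absv_powi Q_def)
      also have "\<dots> \<le> Q powi (- (n * (n - 1) div 2)) * Q powi (int N * \<bar>n\<bar>)"
        by (rule mult_left_mono[OF xn]) (use Q in auto)
      also have "\<dots> = Q powi (int N * \<bar>n\<bar> - n * (n - 1) div 2)"
        using Q by (subst power_int_add[symmetric]) auto
      also have "\<dots> \<le> Q powi (- int N3)"
        using exp Q by (intro power_int_increasing) auto
      also have "\<dots> = inverse (Q ^ N3)" by (simp add: power_int_minus)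
      also have "\<dots> < e" using N3 e Q by (simp add: field_simps)
      finally show False using ge by simp
    qed
    have "{n \<in> UNIV. e \<le> absv (q powi (- (n * (n - 1) div 2)) * x powi n)} \<subseteq> {- b..b}"
    proof
      fix n assume "n \<in> {n \<in> UNIV. e \<le> absv (q powi (- (n * (n - 1) div 2)) * x powi n)}"
      then have "\<bar>n\<bar> \<le> b" using bound[of n] by blast
      then show "n \<in> {- b..b}" unfolding atLeastAtMost_iff by linarith
    qed
    then show "finite {n \<in> UNIV. e \<le> absv (q powi (- (n * (n - 1) div 2)) * x powi n)}"
      by (rule finite_subset) simp
  qed
  then show ?thesis unfolding theta_an_def by (subst coeff_Abs_an) auto
qed

section \<open>Subfields of an ambient field\<close>

text \<open>
  The tower \<open>k \<subseteq> k(q) \<subseteq> K \<subseteq> C\<close> and the fields of functions are modelled as subsets of an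
  ambient field type.  Note that \<open>x / 0 = 0\<close>, so closure under division needs no side condition.
\<close>

definition is_subfield :: "'a::field set \<Rightarrow> bool" where
  "is_subfield F \<longleftrightarrow> 1 \<in> F \<and> (\<forall>x\<in>F. \<forall>y\<in>F. x - y \<in> F \<and> x * y \<in> F \<and> x / y \<in> F)"

definition subfield_generated :: "'a::field set \<Rightarrow> 'a set" where
  "subfield_generated S = \<Inter> {F. is_subfield F \<and> S \<subseteq> F}"

definition polys_over :: "'a::zero set \<Rightarrow> 'a poly set" where
  "polys_over F = {p. \<forall>i. coeff p i \<in> F}"

definition finite_extension :: "'a::field set \<Rightarrow> 'a set \<Rightarrow> bool" where
  "finite_extension F K \<longleftrightarrow> is_subfield F \<and> is_subfield K \<and> F \<subseteq> K \<and>
     (\<exists>B. finite B \<and> B \<subseteq> K \<and> (\<forall>y\<in>K. \<exists>c. c ` B \<subseteq> F \<and> y = (\<Sum>b\<in>B. c b * b)))"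

definition alg_closed_subfield :: "'a::field set \<Rightarrow> bool" where
  "alg_closed_subfield F \<longleftrightarrow> is_subfield F \<and>
     (\<forall>p\<in>polys_over F. Polynomial.degree p > 0 \<longrightarrow> (\<exists>z\<in>F. poly p z = 0))"

section \<open>Algebraic differential relations\<close>

text \<open>
  Polynomials in the variables \<open>X\<^sub>0, X\<^sub>1, \<dots>\<close> are finitely supported functions from exponent vectors
  to coefficients; \<open>poly_eval P v\<close> substitutes \<open>v i\<close> for \<open>X\<^sub>i\<close>.
\<close>

definition poly_eval :: "((nat \<Rightarrow>\<^sub>0 nat) \<Rightarrow>\<^sub>0 'a::comm_ring_1) \<Rightarrow> (nat \<Rightarrow> 'a) \<Rightarrow> 'a" where
  "poly_eval P v = (\<Sum>e\<in>Poly_Mapping.keys P.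
     Poly_Mapping.lookup P e * (\<Prod>i\<in>Poly_Mapping.keys e. v i ^ Poly_Mapping.lookup e i))"

definition satisfies_alg_relation :: "('a::comm_ring_1 \<Rightarrow> 'a) \<Rightarrow> 'a set \<Rightarrow> 'a \<Rightarrow> bool" where
  "satisfies_alg_relation D F u \<longleftrightarrow>
     (\<exists>m. \<exists>P :: (nat \<Rightarrow>\<^sub>0 nat) \<Rightarrow>\<^sub>0 'a. P \<noteq> 0 \<and>
        (\<forall>e\<in>Poly_Mapping.keys P. Poly_Mapping.lookup P e \<in> F \<and> Poly_Mapping.keys e \<subseteq> {..m}) \<and>
        poly_eval P (\<lambda>i. (D ^^ i) u) = 0)"

end

theory Submission
  imports Defs
begin

text \<open>
  Write \<open>F = C\<^sub>E(x, \<ell>\<^sub>q)\<close> and let \<open>\<partial>\<close> be one of the two derivations; both commute with the dilation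
  \<open>\<sigma> : f(x) \<mapsto> f(q x)\<close>.

  If \<open>a = \<mu> x\<^sup>r g(q x) / g(x)\<close>, then \<open>\<partial>(u / g) / (u / g)\<close>
  changes under \<open>\<sigma>\<close> by an explicit polynomial in \<open>\<ell>\<^sub>q\<close>.  As \<open>\<ell>\<^sub>q\<close> has increment \<open>1\<close>, this increment can be
  summed in \<open>C(\<ell>\<^sub>q)\<close>, and the difference is elliptic.  So \<open>\<partial> u / u \<in> F\<close>, which is a relation of order
  one.  Over \<open>C(x)\<close> one uses in addition that two elliptic functions are algebraically dependent over
  \<open>C\<close> (\<open>elliptic_algebraic\<close>).  This is a counting argument: the index of the dominant term of a Laurent series (\<open>last_max\<close>) counts zeros in a fundamental domain, a
  combination of the monomials \<open>e\<^sub>1\<^sup>i e\<^sub>2\<^sup>j\<close>, \<open>i, j \<le> N\<close>, has \<open>O(N)\<close> poles there, and its \<open>(N + 1)\<^sup>2\<close>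
  coefficients can be chosen to give it more zeros than poles.

  Conversely, let \<open>u\<close> satisfy an algebraic relation.  The derivatives \<open>y\<^sub>i = \<partial>\<^sup>i(\<partial> u / u)\<close> satisfy additive
  equations \<open>\<sigma> y\<^sub>i = y\<^sub>i + b\<^sub>i\<close> with \<open>b\<^sub>i = \<partial>\<^sup>i(\<partial> a / a) \<in> F\<close>.  An additive solution that is algebraic over a
  \<open>\<sigma>\<close>-field containing all invariants belongs to this field (\<open>additive_algebraic_in_subfield\<close>), and one
  that is rational in another additive solution is affine in it (\<open>additive_in_additive_extension\<close>).  In
  this way the relation for \<open>u\<close> leads to \<open>b\<^sub>j - \<Sum>\<^bsub>i<j\<^esub> c\<^sub>i b\<^sub>i = \<sigma> h - h\<close> with elliptic \<open>c\<^sub>i\<close> and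
  \<open>h \<in> F\<close> (\<open>telescoping_relation\<close>).

  Now \<open>F\<close> is the field of rational functions in the variable \<open>x\<close> over \<open>C\<^sub>E(\<ell>\<^sub>q)\<close> (\<open>x_transcendental\<close>), so one
  can speak of poles at points \<open>z \<in> C\<close>, \<open>z \<noteq> 0\<close>.  Modulo factors \<open>g(q x) / g(x)\<close> with \<open>g \<in> k(q, x)\<close> the zeros
  and poles of \<open>a\<close> outside the origin can be assumed to lie on distinct orbits \<open>z q\<^sup>\<int>\<close>
  (\<open>reduce_to_distinct_orbits\<close>).  If such a zero or pole \<open>z\<close> exists, \<open>b\<^sub>i\<close> has on its orbit a pole of exact
  order \<open>i + 1\<close> at \<open>z\<close> and no other pole; but a telescoping difference \<open>\<sigma> h - h\<close> never has exactly one pole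
  on an orbit (\<open>no_telescoping_relation\<close>).  Hence nothing but \<open>\<mu> x\<^sup>r\<close> remains of \<open>a\<close>.
\<close>

section \<open>Subfields and algebraic elements\<close>

lemma is_subfieldD:
  assumes "is_subfield F"
  shows subfield_one: "1 \<in> F" and subfield_diff: "x \<in> F \<Longrightarrow> y \<in> F \<Longrightarrow> x - y \<in> F"
    and subfield_mult: "x \<in> F \<Longrightarrow> y \<in> F \<Longrightarrow> x * y \<in> F"
    and subfield_divide: "x \<in> F \<Longrightarrow> y \<in> F \<Longrightarrow> x / y \<in> F"
  using assms by (auto simp: is_subfield_def)

lemma subfield_zero: "is_subfield F \<Longrightarrow> 0 \<in> F"
  using subfield_diff[of F 1 1] subfield_one[of F] by simp

lemma subfield_uminus: "is_subfield F \<Longrightarrow> x \<in> F \<Longrightarrow> - x \<in> F"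
  using subfield_diff[of F 0 x] subfield_zero[of F] by simp

lemma subfield_add: "is_subfield F \<Longrightarrow> x \<in> F \<Longrightarrow> y \<in> F \<Longrightarrow> x + y \<in> F"
  using subfield_diff[of F x "- y"] subfield_uminus[of F y] by simp

lemma subfield_inverse: "is_subfield F \<Longrightarrow> x \<in> F \<Longrightarrow> inverse x \<in> F"
  using subfield_divide[of F 1 x] subfield_one[of F] by (simp add: divide_inverse)

lemma subfield_power: "is_subfield F \<Longrightarrow> x \<in> F \<Longrightarrow> x ^ n \<in> F"
  by (induction n) (auto intro: subfield_one subfield_mult)

lemma subfield_power_int: "is_subfield F \<Longrightarrow> x \<in> F \<Longrightarrow> x powi n \<in> F"
  by (auto simp: power_int_def intro: subfield_power subfield_inverse)

lemma subfield_of_nat: "is_subfield F \<Longrightarrow> of_nat n \<in> F"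
  by (induction n) (auto intro: subfield_zero subfield_one subfield_add)

lemma subfield_numeral: "is_subfield F \<Longrightarrow> numeral n \<in> F"
  using subfield_of_nat[of F "numeral n"] by simp

lemma subfield_of_int: "is_subfield F \<Longrightarrow> of_int n \<in> F"
  by (cases n rule: int_cases2) (auto intro: subfield_uminus subfield_of_nat)

lemma subfield_sum: "is_subfield F \<Longrightarrow> (\<And>i. i \<in> I \<Longrightarrow> f i \<in> F) \<Longrightarrow> sum f I \<in> F"
  by (induction I rule: infinite_finite_induct) (auto intro: subfield_zero subfield_add)

lemma subfield_prod: "is_subfield F \<Longrightarrow> (\<And>i. i \<in> I \<Longrightarrow> f i \<in> F) \<Longrightarrow> prod f I \<in> F"
  by (induction I rule: infinite_finite_induct) (auto intro: subfield_one subfield_mult)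

lemmas subfield_closed =
  subfield_one subfield_zero subfield_add subfield_diff subfield_mult subfield_divide
  subfield_uminus subfield_inverse subfield_power subfield_power_int subfield_of_nat
  subfield_numeral subfield_of_int

lemma subfield_generated_subfield: "is_subfield (subfield_generated S)"
  unfolding subfield_generated_def is_subfield_def by auto

lemma subfield_generated_superset: "S \<subseteq> subfield_generated S"
  by (auto simp: subfield_generated_def)

lemma subfield_generated_least: "is_subfield F \<Longrightarrow> S \<subseteq> F \<Longrightarrow> subfield_generated S \<subseteq> F"
  by (auto simp: subfield_generated_def)

lemma subfield_generated_mono: "S \<subseteq> T \<Longrightarrow> subfield_generated S \<subseteq> subfield_generated T"
  by (auto simp: subfield_generated_def)

lemma subfield_generated_insert_generated:
  "subfield_generated (insert v (subfield_generated S)) = subfield_generated (insert v S)"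
proof
  show "subfield_generated (insert v (subfield_generated S)) \<subseteq> subfield_generated (insert v S)"
    using subfield_generated_mono[of S "insert v S"] subfield_generated_superset[of "insert v S"]
    by (intro subfield_generated_least subfield_generated_subfield) auto
  show "subfield_generated (insert v S) \<subseteq> subfield_generated (insert v (subfield_generated S))"
    using subfield_generated_superset[of S] by (intro subfield_generated_mono) auto
qed

subsection \<open>Polynomials over a subfield\<close>

lemma polys_overD: "p \<in> polys_over F \<Longrightarrow> coeff p i \<in> F"
  by (simp add: polys_over_def)

lemma polys_overI: "(\<And>i. coeff p i \<in> F) \<Longrightarrow> p \<in> polys_over F"
  by (simp add: polys_over_def)

lemma polys_over_mono: "F \<subseteq> G \<Longrightarrow> polys_over F \<subseteq> polys_over G"
  by (auto simp: polys_over_def)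

context
  fixes F :: "'a::field set"
  assumes F: "is_subfield F"
begin

lemma polys_over_0: "0 \<in> polys_over F"
  by (simp add: polys_over_def subfield_zero[OF F])

lemma polys_over_pCons_iff: "pCons c p \<in> polys_over F \<longleftrightarrow> c \<in> F \<and> p \<in> polys_over F"
proof
  assume p: "pCons c p \<in> polys_over F"
  show "c \<in> F \<and> p \<in> polys_over F"
    using polys_overD[OF p, of 0] polys_overD[OF p, of "Suc i" for i]
    by (auto intro: polys_overI)
next
  assume p: "c \<in> F \<and> p \<in> polys_over F"
  show "pCons c p \<in> polys_over F"
  proof (rule polys_overI)
    fix i show "coeff (pCons c p) i \<in> F"
      using p by (cases i) (auto dest: polys_overD)
  qed
qed

lemma polys_over_1: "1 \<in> polys_over F"
  unfolding one_pCons by (simp add: polys_over_pCons_iff polys_over_0 subfield_one[OF F])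

lemma polys_over_add: "p \<in> polys_over F \<Longrightarrow> r \<in> polys_over F \<Longrightarrow> p + r \<in> polys_over F"
  and polys_over_diff: "p \<in> polys_over F \<Longrightarrow> r \<in> polys_over F \<Longrightarrow> p - r \<in> polys_over F"
  and polys_over_uminus: "p \<in> polys_over F \<Longrightarrow> - p \<in> polys_over F"
  and polys_over_smult: "c \<in> F \<Longrightarrow> p \<in> polys_over F \<Longrightarrow> smult c p \<in> polys_over F"
  using F by (auto simp: polys_over_def intro: subfield_closed)

lemma polys_over_mult: "p \<in> polys_over F \<Longrightarrow> r \<in> polys_over F \<Longrightarrow> p * r \<in> polys_over F"
  using F by (auto simp: polys_over_def coeff_mult intro!: subfield_sum subfield_mult)

lemma polys_over_power: "p \<in> polys_over F \<Longrightarrow> p ^ n \<in> polys_over F"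
  by (induction n) (auto intro: polys_over_1 polys_over_mult)

lemma polys_over_monom: "c \<in> F \<Longrightarrow> monom c n \<in> polys_over F"
  using F by (auto simp: polys_over_def intro: subfield_zero)

lemma polys_over_pcompose: "p \<in> polys_over F \<Longrightarrow> r \<in> polys_over F \<Longrightarrow> pcompose p r \<in> polys_over F"
proof (induction p)
  case (pCons c p)
  then have "c \<in> F" "p \<in> polys_over F" by (auto simp: polys_over_pCons_iff)
  then show ?case using pCons
    by (auto simp: pcompose_pCons polys_over_pCons_iff polys_over_0
        intro!: polys_over_add polys_over_mult)
qed simp

lemma poly_in_subfield: "p \<in> polys_over F \<Longrightarrow> v \<in> F \<Longrightarrow> poly p v \<in> F"
  using F by (auto simp: poly_altdef polys_over_def intro!: subfield_sum subfield_closed)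

lemmas polys_over_closed =
  polys_over_0 polys_over_1 polys_over_add polys_over_diff polys_over_uminus polys_over_smult
  polys_over_mult polys_over_power polys_over_monom polys_over_pcompose

lemma polys_over_const: "c \<in> F \<Longrightarrow> [:c:] \<in> polys_over F"
  by (simp add: polys_over_pCons_iff polys_over_0)

lemma polys_over_linear: "c \<in> F \<Longrightarrow> b \<in> F \<Longrightarrow> [:c, b:] \<in> polys_over F"
  by (simp add: polys_over_pCons_iff polys_over_0)

text \<open>Long division only divides by the leading coefficient of the divisor.\<close>

lemma polys_over_div_mod:
  assumes "p \<in> polys_over F" "g \<in> polys_over F" "g \<noteq> 0"
  shows "\<exists>s\<in>polys_over F. \<exists>r\<in>polys_over F. p = g * s + r \<and> (r = 0 \<or> degree r < degree g)"
  using assms(1)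
proof (induction "degree p" arbitrary: p rule: less_induct)
  case less
  show ?case
  proof (cases "p = 0 \<or> degree p < degree g")
    case True
    then show ?thesis using less.prems
      by (intro bexI[of _ 0] bexI[of _ p]) (auto intro: polys_over_0)
  next
    case False
    define c where "c = lead_coeff p / lead_coeff g"
    define t where "t = monom c (degree p - degree g)"
    have c: "c \<in> F" unfolding c_def
      by (intro subfield_divide[OF F] polys_overD less.prems assms(2))
    have t: "t \<in> polys_over F" unfolding t_def by (rule polys_over_monom[OF c])
    have c0: "c \<noteq> 0" using False assms(3) by (simp add: c_def)
    have dt: "degree (g * t) = degree p"
      using False assms(3) c0
      by (subst degree_mult_eq) (auto simp: t_def degree_monom_eq monom_eq_0_iff)
    have lt: "lead_coeff (g * t) = lead_coeff p"
    proof -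
      have "lead_coeff t = c" using c0 by (simp add: t_def degree_monom_eq)
      then show ?thesis using assms(3) unfolding lead_coeff_mult by (simp add: c_def)
    qed
    define p' where "p' = p - g * t"
    have p': "p' \<in> polys_over F"
      unfolding p'_def using less.prems assms(2) t by (intro polys_over_closed)
    have small: "p' = 0 \<or> degree p' < degree p"
    proof (cases "degree p = 0")
      case True
      then have "p' = 0"
        using dt lt by (metis degree_0_id p'_def right_minus_eq)
      then show ?thesis ..
    next
      case False
      then show ?thesis
        unfolding p'_def using dt lt
        by (metis coeff_diff degree_diff_le eq_zero_or_degree_less le_refl right_minus_eq)
    qed
    then consider "p' = 0" | "degree p' < degree p" by blast
    then show ?thesis
    proof cases
      case 1
      then have "p = g * t + 0" by (simp add: p'_def)
      then show ?thesis using t polys_over_0 by blast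
    next
      case 2
      obtain s r where "s \<in> polys_over F" "r \<in> polys_over F" "p' = g * s + r"
        "r = 0 \<or> degree r < degree g"
        using less.hyps[OF 2 p'] by blast
      moreover from this have "p = g * (s + t) + r" by (simp add: p'_def algebra_simps)
      ultimately show ?thesis using polys_over_add t by blast
    qed
  qed
qed

lemma polys_over_split_root:
  assumes p: "p \<in> polys_over F" "c \<in> F" "poly p c = 0"
  obtains s where "s \<in> polys_over F" "p = [:- c, 1:] * s"
proof -
  obtain s r where *: "s \<in> polys_over F" "p = [:- c, 1:] * s + r" "r = 0 \<or> degree r < degree [:- c, 1:]"
    using polys_over_div_mod[OF p(1), of "[:- c, 1:]"] p(2)
    by (auto simp: polys_over_linear subfield_closed[OF F])
  have "r = 0"
  proof (rule ccontr)
    assume "r \<noteq> 0"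
    then have "degree r = 0" using *(3) by auto
    then obtain b where "r = [:b:]" by (rule degree_eq_zeroE)
    then show False using p(3) *(2) \<open>r \<noteq> 0\<close> by simp
  qed
  then show thesis using that * by simp
qed

text \<open>Values of rational functions at \<open>v\<close> are closed under the field operations.\<close>

lemma subfield_generated_insert:
  "subfield_generated (insert v F)
    = {poly P v / poly Q v | P Q. P \<in> polys_over F \<and> Q \<in> polys_over F \<and> poly Q v \<noteq> 0}" (is "_ = ?R")
proof
  have RI: "y \<in> ?R" if "P \<in> polys_over F" "Q \<in> polys_over F" "poly Q v \<noteq> 0"
    "y = poly P v / poly Q v" for y P Q using that by blast
  have sub: "is_subfield ?R"
    unfolding is_subfield_def
  proof (intro conjI ballI)
    show "1 \<in> ?R" by (rule RI[of 1 1]) (simp_all add: polys_over_1)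
  next
    fix x y assume "x \<in> ?R" "y \<in> ?R"
    then obtain P Q P' Q' where *: "x = poly P v / poly Q v" "y = poly P' v / poly Q' v"
      "P \<in> polys_over F" "Q \<in> polys_over F" "P' \<in> polys_over F" "Q' \<in> polys_over F"
      "poly Q v \<noteq> 0" "poly Q' v \<noteq> 0" by auto
    have "x - y = poly (P * Q' - P' * Q) v / poly (Q * Q') v"
      unfolding *(1,2) using *(7,8) by (simp add: field_simps)
    moreover have "P * Q' - P' * Q \<in> polys_over F" "Q * Q' \<in> polys_over F" "poly (Q * Q') v \<noteq> 0"
      using * by (auto intro: polys_over_closed)
    ultimately show "x - y \<in> ?R" by (intro RI)
    have "x * y = poly (P * P') v / poly (Q * Q') v" unfolding *(1,2) by simp
    moreover have "P * P' \<in> polys_over F" using * by (auto intro: polys_over_closed)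
    ultimately show "x * y \<in> ?R" using \<open>Q * Q' \<in> polys_over F\<close> \<open>poly (Q * Q') v \<noteq> 0\<close> by (intro RI)
    show "x / y \<in> ?R"
    proof (cases "poly P' v = 0")
      case True
      then show ?thesis using * by (intro RI[of 0 1]) (simp_all add: polys_over_1 polys_over_0)
    next
      case False
      then have "x / y = poly (P * Q') v / poly (Q * P') v" unfolding *(1,2) by simp
      moreover have "P * Q' \<in> polys_over F" "Q * P' \<in> polys_over F" "poly (Q * P') v \<noteq> 0"
        using * False by (auto intro: polys_over_closed)
      ultimately show ?thesis by (intro RI)
    qed
  qed
  have "insert v F \<subseteq> ?R"
  proof
    fix y assume y: "y \<in> insert v F"
    have "\<exists>P\<in>polys_over F. y = poly P v / poly 1 v"
    proof (cases "y = v")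
      case True
      then show ?thesis
        using subfield_closed[OF F] by (intro bexI[of _ "[:0, 1:]"]) (auto intro!: polys_over_linear)
    next
      case False
      then show ?thesis using y
        by (intro bexI[of _ "[:y:]"]) (auto intro!: polys_over_const)
    qed
    then show "y \<in> ?R" using RI[OF _ polys_over_1] by auto
  qed
  then show "subfield_generated (insert v F) \<subseteq> ?R"
    by (rule subfield_generated_least[OF sub])
  show "?R \<subseteq> subfield_generated (insert v F)"
  proof -
    have "F \<subseteq> subfield_generated (insert v F)" "v \<in> subfield_generated (insert v F)"
      using subfield_generated_superset[of "insert v F"] by auto
    then have "poly P v \<in> subfield_generated (insert v F)" if "P \<in> polys_over F" for P
      using that subfield_generated_subfield[of "insert v F"] 
      by (auto simp: poly_altdef polys_over_def intro!: subfield_sum subfield_closed)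
    then show ?thesis using subfield_generated_subfield[of "insert v F"]
      by (auto intro: subfield_divide)
  qed
qed

end

lemma subfield_generated_insertE:
  assumes "is_subfield F" "y \<in> subfield_generated (insert v F)"
  obtains P Q where "P \<in> polys_over F" "Q \<in> polys_over F" "poly Q v \<noteq> 0" "y = poly P v / poly Q v"
  using assms subfield_generated_insert[OF assms(1)] by auto

definition algebraic_over :: "'a::field set \<Rightarrow> 'a \<Rightarrow> bool" where
  "algebraic_over F v \<longleftrightarrow> (\<exists>p\<in>polys_over F. p \<noteq> 0 \<and> poly p v = 0)"

lemma algebraic_over_mono: "F \<subseteq> G \<Longrightarrow> algebraic_over F v \<Longrightarrow> algebraic_over G v"
  unfolding algebraic_over_def using polys_over_mono[of F G] by blast

lemma algebraic_over_affine:
  assumes F: "is_subfield F" and v: "algebraic_over F v" and c: "c \<in> F" "c \<noteq> 0" "b \<in> F"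
  shows "algebraic_over F (c * v + b)"
proof -
  obtain p where p: "p \<in> polys_over F" "p \<noteq> 0" "poly p v = 0"
    using v by (auto simp: algebraic_over_def)
  have "poly (pcompose p [:- b / c, 1 / c:]) (c * v + b) = 0"
    using p c by (simp add: poly_pcompose field_simps)
  moreover have "pcompose p [:- b / c, 1 / c:] \<noteq> 0"
    using p(2) c(2) by (simp add: pcompose_eq_0_iff)
  moreover have "pcompose p [:- b / c, 1 / c:] \<in> polys_over F"
    using p c F by (intro polys_over_pcompose polys_over_linear subfield_closed)
  ultimately show ?thesis unfolding algebraic_over_def by blast
qed

text \<open>
  Division by an annihilating polynomial of minimal degree leaves a remainder that annihilates
  \<open>v\<close> as well, hence vanishes.
\<close>

lemma minimal_polynomial_dvd:
  assumes F: "is_subfield F" and v: "algebraic_over F v"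
  obtains H where "H \<in> polys_over F" "H \<noteq> 0" "poly H v = 0" "degree H > 0"
    "\<And>p. p \<in> polys_over F \<Longrightarrow> poly p v = 0 \<Longrightarrow> \<exists>s\<in>polys_over F. p = H * s"
proof -
  define S where "S = {p \<in> polys_over F. p \<noteq> 0 \<and> poly p v = 0}"
  obtain p0 where "p0 \<in> S" using v by (auto simp: algebraic_over_def S_def)
  then obtain H where H: "H \<in> S" "\<And>p. p \<in> S \<Longrightarrow> degree H \<le> degree p"
    using ex_has_least_nat[of "\<lambda>p. p \<in> S" p0 degree] by blast
  have "\<exists>s\<in>polys_over F. p = H * s" if p: "p \<in> polys_over F" "poly p v = 0" for p
  proof -
    obtain s r where sr: "s \<in> polys_over F" "r \<in> polys_over F" "p = H * s + r"
      "r = 0 \<or> degree r < degree H"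
      using polys_over_div_mod[OF F p(1), of H] H(1) by (auto simp: S_def)
    have "poly r v = 0" using p(2) H(1) sr(3) by (simp add: S_def)
    then have "r = 0" using sr H(2)[of r] by (force simp: S_def)
    then show ?thesis using sr by auto
  qed
  moreover have "degree H > 0"
    using H(1) by (auto simp: S_def intro!: Nat.gr0I elim!: degree_eq_zeroE)
  ultimately show thesis using that H(1) by (auto simp: S_def)
qed

text \<open>
  Here \<open>w\<close> may lie outside \<open>F\<close>.  For \<open>H\<close> the minimal polynomial of \<open>w\<close>, or for \<open>H = X - w\<close> when
  \<open>w \<in> F\<close>, the exponent \<open>n\<close> is the multiplicity of the zero \<open>w\<close> of \<open>P\<close>.
\<close>

lemma polys_over_split_power:
  assumes F: "is_subfield F" and H: "H \<in> polys_over F" "degree H > 0"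
    and P: "P \<in> polys_over F" "P \<noteq> 0"
    and dvd: "\<And>p. p \<in> polys_over F \<Longrightarrow> poly p w = 0 \<Longrightarrow> \<exists>s\<in>polys_over F. p = H * s"
  obtains n R where "R \<in> polys_over F" "P = H ^ n * R" "poly R w \<noteq> 0"
proof -
  have "\<exists>n. \<exists>R\<in>polys_over F. P = H ^ n * R \<and> poly R w \<noteq> 0" using P
  proof (induction "degree P" arbitrary: P rule: less_induct)
    case less
    show ?case
    proof (cases "poly P w = 0")
      case False
      then show ?thesis using less.prems by (intro exI[of _ 0] bexI[of _ P]) auto
    next
      case True
      obtain s where s: "s \<in> polys_over F" "P = H * s" using dvd less.prems True by blast
      have "s \<noteq> 0" using less.prems s by auto
      then have "degree s < degree P" unfolding s(2) using H(2) by (subst degree_mult_eq) auto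
      then obtain n R where nR: "R \<in> polys_over F" "s = H ^ n * R" "poly R w \<noteq> 0"
        using less.hyps[of s] s \<open>s \<noteq> 0\<close> by blast
      have "P = H ^ Suc n * R" unfolding s(2) nR(2) by (simp add: mult.assoc)
      then show ?thesis using nR by blast
    qed
  qed
  then show thesis using that by blast
qed

section \<open>Algebraic relations and towers of algebraic extensions\<close>

text \<open>
  In a dependence between monomials in \<open>v\<^sub>0, \<dots>, v\<^bsub>m-1\<^esub>\<close>, sort by the exponent of the last
  variable: either this is a nontrivial equation for \<open>v\<^bsub>m-1\<^esub>\<close> over the field generated by the
  previous ones, or all its coefficients vanish and are shorter dependences.  The monomials carry
  indices of an arbitrary type, so that the induction can forget an exponent without renaming them.
\<close>

lemma dependent_monomials_imp_algebraic:
  fixes v :: "nat \<Rightarrow> 'a::field" and ex :: "'i \<Rightarrow> nat \<Rightarrow> nat"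
  assumes K: "is_subfield K" and S: "finite S" "S \<noteq> {}"
    and c: "\<And>s. s \<in> S \<Longrightarrow> c s \<in> K \<and> c s \<noteq> 0"
    and inj: "inj_on (\<lambda>s. restrict (ex s) {..<m}) S"
    and rel: "(\<Sum>s\<in>S. c s * (\<Prod>i<m. v i ^ ex s i)) = 0"
  shows "\<exists>i<m. algebraic_over (subfield_generated (K \<union> v ` {..<i})) (v i)"
  using S c inj rel
proof (induction m arbitrary: S)
  case 0
  obtain s where s: "s \<in> S" using 0 by blast
  have "S = {s}" using 0(4) s by (auto simp: inj_on_def)
  then show ?case using 0(3,5) by auto
next
  case (Suc m)
  define L where "L = subfield_generated (K \<union> v ` {..<m})"
  have L: "is_subfield L" unfolding L_def by (rule subfield_generated_subfield)
  have KL: "K \<subseteq> L" and vL: "\<And>i. i < m \<Longrightarrow> v i \<in> L"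
    using subfield_generated_superset[of "K \<union> v ` {..<m}"] by (auto simp: L_def)
  define T where "T = (\<lambda>j. {s \<in> S. ex s m = j})"
  define J where "J = (\<lambda>s. ex s m) ` S"
  define r where "r = (\<lambda>j. \<Sum>s\<in>T j. c s * (\<Prod>i<m. v i ^ ex s i))"
  define p where "p = (\<Sum>j\<in>J. monom (r j) j)"
  have fin: "finite J" using Suc.prems(1) by (simp add: J_def)
  have rL: "r j \<in> L" for j
    unfolding r_def using Suc.prems(3) KL vL
    by (intro subfield_sum[OF L] subfield_mult[OF L] subfield_prod[OF L] subfield_power[OF L])
      (auto simp: T_def)
  have coeff_p: "coeff p j = (if j \<in> J then r j else 0)" for j
    using fin by (simp add: p_def coeff_sum)
  have pL: "p \<in> polys_over L"
    by (rule polys_overI) (simp add: coeff_p rL subfield_zero[OF L])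
  have "poly p (v m) = (\<Sum>j\<in>J. \<Sum>s\<in>T j. c s * (\<Prod>i<Suc m. v i ^ ex s i))"
    unfolding p_def r_def poly_sum poly_monom sum_distrib_right
    by (intro sum.cong) (auto simp: T_def mult_ac)
  also have "\<dots> = (\<Sum>s\<in>S. c s * (\<Prod>i<Suc m. v i ^ ex s i))"
    unfolding J_def T_def by (rule sum.image_gen[symmetric]) (rule Suc.prems(1))
  finally have root: "poly p (v m) = 0" using Suc.prems(5) by simp
  show ?case
  proof (cases "p = 0")
    case False
    then have "algebraic_over L (v m)" using pL root by (auto simp: algebraic_over_def)
    then show ?thesis unfolding L_def by blast
  next
    case True
    obtain s where s: "s \<in> S" using Suc.prems(2) by blast
    define j where "j = ex s m"
    have "j \<in> J" using s by (simp add: J_def j_def)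
    then have rj: "r j = 0" using coeff_p[of j] True by simp
    have injT: "inj_on (\<lambda>s. restrict (ex s) {..<m}) (T j)"
    proof (rule inj_onI)
      fix s t assume st: "s \<in> T j" "t \<in> T j" "restrict (ex s) {..<m} = restrict (ex t) {..<m}"
      have "ex s i = ex t i" if "i < Suc m" for i
        using st(1,2) that fun_cong[OF st(3), of i] by (cases "i = m") (simp_all add: T_def)
      then have "restrict (ex s) {..<Suc m} = restrict (ex t) {..<Suc m}"
        by (auto simp: restrict_def)
      then show "s = t" using inj_onD[OF Suc.prems(4), of s t] st(1,2) by (simp add: T_def)
    qed
    have "\<exists>i<m. algebraic_over (subfield_generated (K \<union> v ` {..<i})) (v i)"
    proof (rule Suc.IH[OF _ _ _ injT])
      show "(\<Sum>s\<in>T j. c s * (\<Prod>i<m. v i ^ ex s i)) = 0" using rj by (simp only: r_def)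
    qed (use Suc.prems(1,3) s in \<open>auto simp: T_def j_def\<close>)
    then show ?thesis using less_SucI by blast
  qed
qed

lemma relation_imp_algebraic:
  assumes K: "is_subfield K" and rel: "satisfies_alg_relation D K u"
  obtains i where "algebraic_over (subfield_generated (K \<union> (\<lambda>i. (D ^^ i) u) ` {..<i})) ((D ^^ i) u)"
proof -
  obtain m and P :: "(nat \<Rightarrow>\<^sub>0 nat) \<Rightarrow>\<^sub>0 'a" where P: "P \<noteq> 0"
    "\<And>e. e \<in> Poly_Mapping.keys P \<Longrightarrow> Poly_Mapping.lookup P e \<in> K \<and> Poly_Mapping.keys e \<subseteq> {..m}"
    "poly_eval P (\<lambda>i. (D ^^ i) u) = 0"
    using rel by (auto simp: satisfies_alg_relation_def)
  define v where "v = (\<lambda>i. (D ^^ i) u)"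
  have "(\<Prod>i\<in>Poly_Mapping.keys e. v i ^ Poly_Mapping.lookup e i)
      = (\<Prod>i<Suc m. v i ^ Poly_Mapping.lookup e i)" if "e \<in> Poly_Mapping.keys P" for e
    using P(2)[OF that] by (intro prod.mono_neutral_left) (auto simp: in_keys_iff)
  then have "(\<Sum>e\<in>Poly_Mapping.keys P. Poly_Mapping.lookup P e *
      (\<Prod>i<Suc m. v i ^ Poly_Mapping.lookup e i)) = 0"
    using P(3) by (simp add: poly_eval_def v_def)
  moreover have "inj_on (\<lambda>e. restrict (Poly_Mapping.lookup e) {..<Suc m}) (Poly_Mapping.keys P)"
  proof (rule inj_onI)
    fix e f assume ef: "e \<in> Poly_Mapping.keys P" "f \<in> Poly_Mapping.keys P"
      "restrict (Poly_Mapping.lookup e) {..<Suc m} = restrict (Poly_Mapping.lookup f) {..<Suc m}"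
    show "e = f"
    proof (rule poly_mapping_eqI)
      fix i show "Poly_Mapping.lookup e i = Poly_Mapping.lookup f i"
      proof (cases "i < Suc m")
        case True
        then show ?thesis using fun_cong[OF ef(3), of i] by simp
      next
        case False
        then have "i \<notin> Poly_Mapping.keys e" "i \<notin> Poly_Mapping.keys f"
          using P(2)[OF ef(1)] P(2)[OF ef(2)] by auto
        then show ?thesis by (simp add: in_keys_iff)
      qed
    qed
  qed
  ultimately have "\<exists>i<Suc m. algebraic_over (subfield_generated (K \<union> v ` {..<i})) (v i)"
    using P(1,2) by (intro dependent_monomials_imp_algebraic[OF K]) (auto simp: in_keys_iff)
  then show thesis using that by (auto simp: v_def)
qed

subsection \<open>Clearing denominators\<close>

text \<open>
  Conversely, an algebraic equation for \<open>v\<^sub>m\<close> over \<open>K(v\<^sub>0, \<dots>, v\<^bsub>m-1\<^esub>)\<close> becomes a polynomial relation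
  after multiplication by a common denominator of its coefficients.
\<close>

lemma poly_eval_superset:
  assumes "finite S" "Poly_Mapping.keys P \<subseteq> S"
  shows "poly_eval P v = (\<Sum>e\<in>S. Poly_Mapping.lookup P e *
    (\<Prod>i\<in>Poly_Mapping.keys e. v i ^ Poly_Mapping.lookup e i))"
  unfolding poly_eval_def using assms by (intro sum.mono_neutral_left) (auto simp: in_keys_iff)

lemma poly_eval_add: "poly_eval (P + Q) v = poly_eval P v + poly_eval Q v"
proof -
  let ?S = "Poly_Mapping.keys P \<union> Poly_Mapping.keys Q"
  have "Poly_Mapping.keys (P + Q) \<subseteq> ?S" by (rule Poly_Mapping.keys_add)
  then show ?thesis
    by (simp add: poly_eval_superset[of ?S] lookup_add distrib_right sum.distrib)
qed

lemma poly_eval_0: "poly_eval 0 v = 0"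
  by (simp add: poly_eval_def)

lemma poly_eval_sum: "poly_eval (sum P I) v = (\<Sum>i\<in>I. poly_eval (P i) v)"
  by (induction I rule: infinite_finite_induct) (auto simp: poly_eval_0 poly_eval_add)

lemma poly_eval_single:
  "poly_eval (Poly_Mapping.single e c) v
    = c * (\<Prod>i\<in>Poly_Mapping.keys e. v i ^ Poly_Mapping.lookup e i)"
  by (subst poly_eval_superset[of "{e}"]) (auto simp: lookup_single)

text \<open>
  The ring \<open>K[v\<^sub>0, \<dots>, v\<^bsub>n-1\<^esub>]\<close>.
\<close>

definition polynomial_values :: "'a::field set \<Rightarrow> (nat \<Rightarrow> 'a) \<Rightarrow> nat \<Rightarrow> 'a set" where
  "polynomial_values K v n = {poly_eval P v | P. \<forall>e. Poly_Mapping.lookup P e \<in> K \<and>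
     (Poly_Mapping.lookup P e \<noteq> 0 \<longrightarrow> Poly_Mapping.keys e \<subseteq> {..<n})}"

lemma monomial_value_add:
  fixes v :: "nat \<Rightarrow> 'a::comm_ring_1"
  shows "(\<Prod>i\<in>Poly_Mapping.keys e. v i ^ Poly_Mapping.lookup e i) *
    (\<Prod>i\<in>Poly_Mapping.keys f. v i ^ Poly_Mapping.lookup f i)
    = (\<Prod>i\<in>Poly_Mapping.keys (e + f). v i ^ Poly_Mapping.lookup (e + f) i)"
proof -
  let ?S = "Poly_Mapping.keys e \<union> Poly_Mapping.keys f"
  have *: "(\<Prod>i\<in>Poly_Mapping.keys g. v i ^ Poly_Mapping.lookup g i)
    = (\<Prod>i\<in>?S. v i ^ Poly_Mapping.lookup g i)" if "Poly_Mapping.keys g \<subseteq> ?S" for g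
    using that by (intro prod.mono_neutral_left) (auto simp: in_keys_iff)
  have "Poly_Mapping.keys (e + f) \<subseteq> ?S" by (rule Poly_Mapping.keys_add)
  from *[OF this] show ?thesis
    by (simp add: *[of e] *[of f] lookup_add power_add prod.distrib)
qed

context
  fixes K :: "'a::field set" and v :: "nat \<Rightarrow> 'a" and n :: nat
  assumes K: "is_subfield K"
begin

lemma polynomial_values_add:
  assumes "x \<in> polynomial_values K v n" "y \<in> polynomial_values K v n"
  shows "x + y \<in> polynomial_values K v n"
proof -
  obtain P Q where *: "x = poly_eval P v" "y = poly_eval Q v"
    "\<forall>e. Poly_Mapping.lookup P e \<in> K \<and> (Poly_Mapping.lookup P e \<noteq> 0 \<longrightarrow> Poly_Mapping.keys e \<subseteq> {..<n})"
    "\<forall>e. Poly_Mapping.lookup Q e \<in> K \<and> (Poly_Mapping.lookup Q e \<noteq> 0 \<longrightarrow> Poly_Mapping.keys e \<subseteq> {..<n})"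
    using assms by (auto simp: polynomial_values_def)
  have "x + y = poly_eval (P + Q) v" using * by (simp add: poly_eval_add)
  moreover have "Poly_Mapping.lookup (P + Q) e \<in> K \<and>
      (Poly_Mapping.lookup (P + Q) e \<noteq> 0 \<longrightarrow> Poly_Mapping.keys e \<subseteq> {..<n})" for e
    using spec[OF *(3), of e] spec[OF *(4), of e] subfield_add[OF K] by (auto simp: lookup_add)
  ultimately show ?thesis unfolding polynomial_values_def by blast
qed

lemma polynomial_values_single:
  assumes "c \<in> K" "Poly_Mapping.keys e \<subseteq> {..<n}"
  shows "c * (\<Prod>i\<in>Poly_Mapping.keys e. v i ^ Poly_Mapping.lookup e i) \<in> polynomial_values K v n"
  unfolding polynomial_values_def
  using assms subfield_zero[OF K]
  by (intro CollectI exI[of _ "Poly_Mapping.single e c"])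
    (auto simp: poly_eval_single lookup_single when_def split: if_splits)

lemma polynomial_values_const: "c \<in> K \<Longrightarrow> c \<in> polynomial_values K v n"
  using polynomial_values_single[of c 0] by simp

lemma polynomial_values_var: "i < n \<Longrightarrow> v i \<in> polynomial_values K v n"
  using polynomial_values_single[of 1 "Poly_Mapping.single i 1"] subfield_one[OF K] by simp

lemma polynomial_values_sum:
  "(\<And>i. i \<in> I \<Longrightarrow> f i \<in> polynomial_values K v n) \<Longrightarrow> sum f I \<in> polynomial_values K v n"
  by (induction I rule: infinite_finite_induct)
    (auto intro: polynomial_values_const subfield_zero[OF K] polynomial_values_add)

lemma polynomial_values_mult:
  assumes "x \<in> polynomial_values K v n" "y \<in> polynomial_values K v n"
  shows "x * y \<in> polynomial_values K v n"
proof -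
  obtain P Q where *: "x = poly_eval P v" "y = poly_eval Q v"
    "\<forall>e. Poly_Mapping.lookup P e \<in> K \<and> (Poly_Mapping.lookup P e \<noteq> 0 \<longrightarrow> Poly_Mapping.keys e \<subseteq> {..<n})"
    "\<forall>e. Poly_Mapping.lookup Q e \<in> K \<and> (Poly_Mapping.lookup Q e \<noteq> 0 \<longrightarrow> Poly_Mapping.keys e \<subseteq> {..<n})"
    using assms by (auto simp: polynomial_values_def)
  have "x * y = (\<Sum>e\<in>Poly_Mapping.keys P. \<Sum>f\<in>Poly_Mapping.keys Q.
      (Poly_Mapping.lookup P e * Poly_Mapping.lookup Q f) *
      (\<Prod>i\<in>Poly_Mapping.keys (e + f). v i ^ Poly_Mapping.lookup (e + f) i))"
    unfolding *(1,2) poly_eval_def sum_product monomial_value_add[symmetric]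
    by (simp add: mult_ac)
  moreover have "Poly_Mapping.keys (e + f) \<subseteq> {..<n}"
    if "e \<in> Poly_Mapping.keys P" "f \<in> Poly_Mapping.keys Q" for e f
    using that Poly_Mapping.keys_add[of e f] spec[OF *(3), of e] spec[OF *(4), of f]
    by (auto simp: in_keys_iff)
  ultimately show ?thesis
    using *(3,4) by (auto intro!: polynomial_values_sum polynomial_values_single subfield_mult[OF K])
qed

lemma generated_quotient_polynomial_values:
  assumes "y \<in> subfield_generated (K \<union> v ` {..<n})"
  obtains a b where "a \<in> polynomial_values K v n" "b \<in> polynomial_values K v n" "b \<noteq> 0" "y = a / b"
proof -
  let ?V = "polynomial_values K v n"
  define R where "R = {a / b | a b. a \<in> ?V \<and> b \<in> ?V \<and> b \<noteq> 0}"
  have RI: "y \<in> R" if "a \<in> ?V" "b \<in> ?V" "b \<noteq> 0" "y = a / b" for y a b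
    using that by (auto simp: R_def)
  have one: "1 \<in> ?V" and zero: "0 \<in> ?V"
    using polynomial_values_const subfield_one[OF K] subfield_zero[OF K] by auto
  have neg: "- a \<in> ?V" if "a \<in> ?V" for a
    using polynomial_values_mult[OF polynomial_values_const[of "-1"] that]
      subfield_uminus[OF K subfield_one[OF K]] by simp
  have "is_subfield R"
    unfolding is_subfield_def
  proof (intro conjI ballI)
    show "1 \<in> R" by (rule RI[of 1 1]) (auto intro: one)
    fix x y assume "x \<in> R" "y \<in> R"
    then obtain a b a' b' where *: "x = a / b" "y = a' / b'"
      "a \<in> ?V" "b \<in> ?V" "a' \<in> ?V" "b' \<in> ?V" "b \<noteq> 0" "b' \<noteq> 0" by (auto simp: R_def)
    show "x - y \<in> R"
    proof (rule RI)
      show "x - y = (a * b' + - (a' * b)) / (b * b')"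
        unfolding *(1,2) using *(7,8) by (simp add: field_simps)
      show "b * b' \<noteq> 0" using * by simp
    qed (intro polynomial_values_add polynomial_values_mult neg *)+
    show "x * y \<in> R"
    proof (rule RI)
      show "x * y = (a * a') / (b * b')" unfolding *(1,2) by simp
      show "b * b' \<noteq> 0" using * by simp
    qed (intro polynomial_values_mult *)+
    show "x / y \<in> R"
    proof (cases "a' = 0")
      case True
      then show ?thesis using * by (intro RI[OF zero one]) auto
    next
      case False
      show ?thesis
      proof (rule RI)
        show "x / y = (a * b') / (b * a')" unfolding *(1,2) by simp
        show "b * a' \<noteq> 0" using * False by simp
      qed (intro polynomial_values_mult *)+
    qed
  qed
  moreover have "K \<union> v ` {..<n} \<subseteq> R"
    using polynomial_values_const polynomial_values_var by (auto intro!: RI[OF _ one])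
  ultimately have "y \<in> R" using subfield_generated_least assms by blast
  then show thesis using that by (auto simp: R_def)
qed

lemma common_denominator_polynomial_values:
  assumes "finite I" "\<And>i. i \<in> I \<Longrightarrow> y i \<in> subfield_generated (K \<union> v ` {..<n})"
  obtains d where "d \<noteq> 0" "\<And>i. i \<in> I \<Longrightarrow> d * y i \<in> polynomial_values K v n"
    "d \<in> polynomial_values K v n"
  using assms
proof (induction I arbitrary: thesis rule: finite_induct)
  case empty
  show ?case
    by (rule empty(1)[of 1]) (auto intro: polynomial_values_const subfield_one[OF K])
next
  case (insert j I)
  obtain d where d: "d \<noteq> 0" "\<And>i. i \<in> I \<Longrightarrow> d * y i \<in> polynomial_values K v n"
    "d \<in> polynomial_values K v n"
    using insert.IH insert.prems by blast
  obtain a b where ab: "a \<in> polynomial_values K v n" "b \<in> polynomial_values K v n" "b \<noteq> 0"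
    "y j = a / b"
    using generated_quotient_polynomial_values insert.prems(2) by blast
  show ?case
  proof (rule insert.prems(1)[of "d * b"])
    show "d * b \<noteq> 0" using d ab by simp
    show "d * b * y i \<in> polynomial_values K v n" if "i \<in> insert j I" for i
    proof (cases "i = j")
      case True
      then have "d * b * y i = d * a" using ab by simp
      then show ?thesis using polynomial_values_mult[OF d(3) ab(1)] by metis
    next
      case False
      then have "d * b * y i = b * (d * y i)" "d * y i \<in> polynomial_values K v n"
        using that d by simp_all
      then show ?thesis using polynomial_values_mult[OF ab(2)] by metis
    qed
    show "d * b \<in> polynomial_values K v n" using d ab polynomial_values_mult by simp
  qed
qed

end

lemma algebraic_imp_relation:
  assumes K: "is_subfield K"
    and alg: "algebraic_over (subfield_generated (K \<union> (\<lambda>i. (D ^^ i) u) ` {..<m})) ((D ^^ m) u)"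
  shows "satisfies_alg_relation D K u"
proof -
  define v where "v = (\<lambda>i. (D ^^ i) u)"
  obtain p where p: "p \<in> polys_over (subfield_generated (K \<union> v ` {..<m}))" "p \<noteq> 0" "poly p (v m) = 0"
    using alg by (auto simp: algebraic_over_def v_def)
  obtain d where d: "d \<noteq> 0" "\<And>j. j \<in> {..degree p} \<Longrightarrow> d * coeff p j \<in> polynomial_values K v m"
    by (rule common_denominator_polynomial_values[OF K, of "{..degree p}" "coeff p" v m])
      (use p(1) in \<open>auto dest: polys_overD\<close>)
  have "\<exists>Q. \<forall>j\<in>{..degree p}. d * coeff p j = poly_eval (Q j) v \<and>
      (\<forall>e. Poly_Mapping.lookup (Q j) e \<in> K \<and>
        (Poly_Mapping.lookup (Q j) e \<noteq> 0 \<longrightarrow> Poly_Mapping.keys e \<subseteq> {..<m}))"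
    using d(2) unfolding polynomial_values_def by (intro bchoice) fastforce
  then obtain Q :: "nat \<Rightarrow> (nat \<Rightarrow>\<^sub>0 nat) \<Rightarrow>\<^sub>0 'a" where Q:
    "\<And>j. j \<le> degree p \<Longrightarrow> d * coeff p j = poly_eval (Q j) v"
    "\<And>j e. j \<le> degree p \<Longrightarrow> Poly_Mapping.lookup (Q j) e \<in> K"
    "\<And>j e. j \<le> degree p \<Longrightarrow> e \<in> Poly_Mapping.keys (Q j) \<Longrightarrow> Poly_Mapping.keys e \<subseteq> {..<m}"
    by (auto simp: in_keys_iff)
  \<comment> \<open>Multiply the \<open>j\<close>-th coefficient by the \<open>j\<close>-th power of the new variable \<open>m\<close>.  The coefficients do
    not involve this variable, so the exponents \<open>ex\<close> are distinct and no terms cancel.\<close>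
  define S where "S = Sigma {..degree p} (\<lambda>j. Poly_Mapping.keys (Q j))"
  have finS: "finite S" by (simp add: S_def)
  define ex where "ex = (\<lambda>(j, e). e + Poly_Mapping.single m j :: nat \<Rightarrow>\<^sub>0 nat)"
  define P where "P = (\<Sum>s\<in>S. Poly_Mapping.single (ex s) (Poly_Mapping.lookup (Q (fst s)) (snd s)))"
  have lookup_ex: "Poly_Mapping.lookup (ex (j, e)) m = j"
    "i \<noteq> m \<Longrightarrow> Poly_Mapping.lookup (ex (j, e)) i = Poly_Mapping.lookup e i"
    if "(j, e) \<in> S" for i j e
  proof -
    have "m \<notin> Poly_Mapping.keys e" using that Q(3)[of j e] by (auto simp: S_def)
    then show "Poly_Mapping.lookup (ex (j, e)) m = j"
      by (simp add: ex_def lookup_add in_keys_iff)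
    show "i \<noteq> m \<Longrightarrow> Poly_Mapping.lookup (ex (j, e)) i = Poly_Mapping.lookup e i"
      by (simp add: ex_def lookup_add lookup_single)
  qed
  have inj: "s = t" if "s \<in> S" "t \<in> S" "ex s = ex t" for s t
  proof -
    obtain j e j' e' where st: "s = (j, e)" "t = (j', e')" by (metis surj_pair)
    have "j = j'" using lookup_ex(1) that st by metis
    moreover have "e = e'" using that(3) \<open>j = j'\<close> by (simp add: st ex_def)
    ultimately show ?thesis by (simp add: st)
  qed
  have keys_ex: "Poly_Mapping.keys (ex s) \<subseteq> {..m}" if "s \<in> S" for s
  proof -
    obtain j e where s: "s = (j, e)" by (metis surj_pair)
    have "Poly_Mapping.keys e \<subseteq> {..<m}" using that Q(3)[of j e] by (auto simp: S_def s)
    then show ?thesis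
      using Poly_Mapping.keys_add[of e "Poly_Mapping.single m j"]
      by (fastforce simp: s ex_def split: if_splits)
  qed
  have lookup_P: "Poly_Mapping.lookup P e =
      (\<Sum>s\<in>S. Poly_Mapping.lookup (Q (fst s)) (snd s) when ex s = e)" for e
    unfolding P_def by (simp add: lookup_sum lookup_single)
  have "poly_eval P v = 0"
  proof -
    have "poly_eval P v = (\<Sum>(j, e)\<in>S. Poly_Mapping.lookup (Q j) e *
       ((\<Prod>i\<in>Poly_Mapping.keys e. v i ^ Poly_Mapping.lookup e i) * v m ^ j))"
      unfolding P_def poly_eval_sum poly_eval_single
    proof (intro sum.cong refl)
      fix s assume "s \<in> S"
      obtain j e where s: "s = (j, e)" by (metis surj_pair)
      show "Poly_Mapping.lookup (Q (fst s)) (snd s) *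
          (\<Prod>i\<in>Poly_Mapping.keys (ex s). v i ^ Poly_Mapping.lookup (ex s) i) =
        (case s of (j, e) \<Rightarrow> Poly_Mapping.lookup (Q j) e *
          ((\<Prod>i\<in>Poly_Mapping.keys e. v i ^ Poly_Mapping.lookup e i) * v m ^ j))"
        unfolding s ex_def prod.case monomial_value_add[symmetric] by (cases "j = 0") auto
    qed
    also have "\<dots> = (\<Sum>j\<le>degree p. poly_eval (Q j) v * v m ^ j)"
      unfolding S_def poly_eval_def
      by (subst sum.Sigma[symmetric]) (auto simp: sum_distrib_right mult.assoc)
    also have "\<dots> = (\<Sum>j\<le>degree p. d * (coeff p j * v m ^ j))"
      by (intro sum.cong) (auto simp: Q(1)[symmetric])
    also have "\<dots> = d * poly p (v m)" by (simp add: poly_altdef sum_distrib_left)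
    finally show ?thesis using p(3) by simp
  qed
  moreover have "P \<noteq> 0"
  proof -
    define j where "j = degree p"
    have "poly_eval (Q j) v \<noteq> 0" using Q(1)[of j] d(1) p(2) by (metis j_def le_refl leading_coeff_0_iff mult_eq_0_iff)
    then obtain e where e: "e \<in> Poly_Mapping.keys (Q j)"
      by (force simp: poly_eval_def)
    have jS: "(j, e) \<in> S" using e by (auto simp: S_def j_def)
    have "Poly_Mapping.lookup P (ex (j, e)) = (\<Sum>s\<in>{(j, e)}. Poly_Mapping.lookup (Q (fst s)) (snd s))"
      unfolding lookup_P using jS inj
      by (intro sum.mono_neutral_cong_right finS) (auto simp: when_def)
    then have "Poly_Mapping.lookup P (ex (j, e)) \<noteq> 0" using e by (simp add: in_keys_iff)
    then show ?thesis by auto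
  qed
  moreover have "Poly_Mapping.lookup P e \<in> K \<and> Poly_Mapping.keys e \<subseteq> {..m}"
    if "e \<in> Poly_Mapping.keys P" for e
  proof
    show "Poly_Mapping.lookup P e \<in> K"
      unfolding lookup_P using Q(2) subfield_zero[OF K]
      by (intro subfield_sum[OF K]) (auto simp: when_def S_def)
    have "\<exists>s\<in>S. ex s = e"
    proof (rule ccontr)
      assume "\<not> ?thesis"
      then have "Poly_Mapping.lookup P e = 0" unfolding lookup_P by (intro sum.neutral) auto
      then show False using that by (simp add: in_keys_iff)
    qed
    then show "Poly_Mapping.keys e \<subseteq> {..m}" using keys_ex by blast
  qed
  ultimately show ?thesis
    unfolding satisfies_alg_relation_def v_def by blast
qed

section \<open>Solutions of first order difference equations\<close>

text \<open>
  If \<open>p(X + b)\<close> is to coincide with a twist of \<open>p\<close>, the second highest coefficient yields an additive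
  difference equation with right hand side a multiple of \<open>b\<close>; this is the source of all solutions of
  such equations below.
\<close>

lemma coeff_pcompose_shift:
  fixes p :: "'a::comm_ring_1 poly"
  assumes "degree p \<le> Suc n"
  shows "coeff (pcompose p [:b, 1:]) (Suc n) = coeff p (Suc n)"
    and "coeff (pcompose p [:b, 1:]) n = coeff p n + of_nat (Suc n) * b * coeff p (Suc n)"
proof -
  have "coeff (pcompose p [:b, 1:]) (Suc n) = coeff p (Suc n) \<and>
    coeff (pcompose p [:b, 1:]) n = coeff p n + of_nat (Suc n) * b * coeff p (Suc n)"
    using assms
  proof (induction p arbitrary: n)
    case 0
    show ?case by simp
  next
    case (pCons a p)
    have split: "pcompose (pCons a p) [:b, 1:] = [:a:] + (smult b (pcompose p [:b, 1:]) + pCons 0 (pcompose p [:b, 1:]))"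
      by (simp add: pcompose_pCons)
    have d: "degree p \<le> n" using pCons by (auto split: if_splits)
    have beyond: "coeff (pcompose p [:b, 1:]) (Suc n) = 0" "coeff p (Suc n) = 0"
    proof -
      have "degree (pcompose p [:b, 1:]) \<le> degree p * degree [:b, 1:]" by (rule degree_pcompose_le)
      then show "coeff (pcompose p [:b, 1:]) (Suc n) = 0" using d by (intro coeff_eq_0) simp
      show "coeff p (Suc n) = 0" using d by (intro coeff_eq_0) simp
    qed
    show ?case
    proof (cases n)
      case 0
      then obtain c where c: "p = [:c:]" using d degree_0_id[of p] by (metis le_zero_eq)
      show ?thesis unfolding c 0 by (simp add: pcompose_pCons)
    next
      case (Suc m)
      have "coeff (pcompose p [:b, 1:]) (Suc m) = coeff p (Suc m)"
        "coeff (pcompose p [:b, 1:]) m = coeff p m + of_nat (Suc m) * b * coeff p (Suc m)"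
        using pCons.IH[of m] d Suc by auto
      then show ?thesis using beyond unfolding split Suc by (simp add: algebra_simps)
    qed
  qed
  then show "coeff (pcompose p [:b, 1:]) (Suc n) = coeff p (Suc n)"
    and "coeff (pcompose p [:b, 1:]) n = coeff p n + of_nat (Suc n) * b * coeff p (Suc n)"
    by auto
qed

lemma coeff_pcompose_dilate:
  fixes p :: "'a::comm_ring_1 poly"
  shows "coeff (pcompose p [:0, a:]) n = a ^ n * coeff p n"
proof (induction p arbitrary: n)
  case (pCons c p)
  then show ?case by (cases n) (simp_all add: pcompose_pCons coeff_pCons)
qed simp

locale difference_field =
  fixes sg :: "'a::field_char_0 \<Rightarrow> 'a"
  assumes sg_add: "sg (x + y) = sg x + sg y"
    and sg_mult: "sg (x * y) = sg x * sg y"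
    and sg_1: "sg 1 = 1"
begin

lemma sg_0: "sg 0 = 0"
  using sg_add[of 0 0] by simp

lemma sg_uminus: "sg (- x) = - sg x"
  using sg_add[of x "- x"] by (simp add: sg_0 eq_neg_iff_add_eq_0 add.commute)

lemma sg_diff: "sg (x - y) = sg x - sg y"
  using sg_add[of x "- y"] by (simp add: sg_uminus)

lemma sg_eq_0_iff: "sg x = 0 \<longleftrightarrow> x = 0"
proof
  assume *: "sg x = 0"
  show "x = 0"
  proof (rule ccontr)
    assume "x \<noteq> 0"
    then have "sg 1 = sg x * sg (inverse x)" by (simp flip: sg_mult)
    then show False using * sg_1 by simp
  qed
qed (simp add: sg_0)

lemma sg_inverse: "sg (inverse x) = inverse (sg x)"
proof (cases "x = 0")
  case False
  then have "sg x * sg (inverse x) = 1" by (simp add: sg_1 flip: sg_mult)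
  then show ?thesis by (metis inverse_unique)
qed (simp add: sg_0)

lemma sg_divide: "sg (x / y) = sg x / sg y"
  by (simp add: divide_inverse sg_mult sg_inverse)

lemma sg_power: "sg (x ^ n) = sg x ^ n"
  by (induction n) (auto simp: sg_1 sg_mult)

lemma sg_power_int: "sg (x powi n) = sg x powi n"
  by (auto simp: power_int_def sg_power sg_inverse)

lemma sg_of_nat: "sg (of_nat n) = of_nat n"
  by (induction n) (auto simp: sg_0 sg_1 sg_add)

lemma sg_of_int: "sg (of_int n) = of_int n"
  by (cases n rule: int_cases2) (auto simp: sg_of_nat sg_uminus)

lemma sg_sum: "sg (sum f I) = (\<Sum>i\<in>I. sg (f i))"
  by (induction I rule: infinite_finite_induct) (auto simp: sg_0 sg_add)

lemma sg_prod: "sg (prod f I) = (\<Prod>i\<in>I. sg (f i))"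
  by (induction I rule: infinite_finite_induct) (auto simp: sg_1 sg_mult)

lemmas sg_hom = sg_0 sg_1 sg_add sg_mult sg_uminus sg_diff sg_inverse sg_divide sg_power
  sg_power_int sg_of_nat sg_of_int sg_sum sg_prod

definition consts_sg :: "'a set" where
  "consts_sg = {c. sg c = c}"

lemma consts_sg_iff: "c \<in> consts_sg \<longleftrightarrow> sg c = c"
  by (simp add: consts_sg_def)

lemma consts_sg_subfield: "is_subfield consts_sg"
  by (auto simp: is_subfield_def consts_sg_def sg_hom)

lemma coeff_twist: "coeff (map_poly sg p) i = sg (coeff p i)"
  by (simp add: coeff_map_poly sg_0)

lemma degree_twist: "degree (map_poly sg p) = degree p"
  by (rule degree_map_poly) (simp add: sg_eq_0_iff)

lemma poly_twist: "poly (map_poly sg p) (sg v) = sg (poly p v)"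
  by (simp add: poly_altdef degree_twist coeff_twist sg_hom)

lemma generated_stable:
  assumes "sg ` S \<subseteq> subfield_generated S"
  shows "sg ` subfield_generated S \<subseteq> subfield_generated S"
proof -
  have "is_subfield {y. sg y \<in> subfield_generated S}"
    using subfield_generated_subfield[of S] by (auto simp: is_subfield_def sg_hom)
  moreover have "S \<subseteq> {y. sg y \<in> subfield_generated S}" using assms by auto
  ultimately have "subfield_generated S \<subseteq> {y. sg y \<in> subfield_generated S}"
    by (rule subfield_generated_least)
  then show ?thesis by auto
qed

end

text \<open>
  Two solutions of the same additive equation \<open>sg y = y + b\<close> differ by an invariant element.  A
  subfield containing all invariant elements therefore contains all solutions as soon as it contains
  one.
\<close>

locale difference_subfield = difference_field sg
  for sg :: "'a::field_char_0 \<Rightarrow> 'a" +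
  fixes L :: "'a set"
  assumes L: "is_subfield L"
    and stable: "sg ` L \<subseteq> L"
    and consts_L: "consts_sg \<subseteq> L"
begin

lemma sg_L: "y \<in> L \<Longrightarrow> sg y \<in> L"
  using stable by auto

lemma polys_over_twist: "p \<in> polys_over L \<Longrightarrow> map_poly sg p \<in> polys_over L"
  by (auto simp: polys_over_def coeff_twist sg_L)

text \<open>
  The element \<open>v + s / (n + 1)\<close> is invariant.
\<close>

lemma additive_in_subfield:
  assumes v: "sg v = v + b" and s: "s \<in> L" "sg s + of_nat (Suc n) * b = s"
  shows "v \<in> L"
proof -
  define t where "t = s / of_nat (Suc n)"
  have t: "t \<in> L" unfolding t_def by (intro subfield_closed[OF L] s)
  have "sg t = t - b"
    unfolding t_def sg_divide sg_of_nat using s(2) by (simp add: field_simps del: of_nat_Suc)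
  then have "v + t \<in> consts_sg" by (simp add: consts_sg_iff sg_add v)
  then have "(v + t) - t \<in> L" using consts_L t subfield_diff[OF L] by blast
  then show ?thesis by simp
qed

text \<open>
  The minimal polynomial \<open>H\<close> of \<open>v\<close> is unique, so applying \<open>sg\<close> to its coefficients and substituting
  \<open>X + b\<close> for \<open>X\<close> gives \<open>H\<close> back.  The second highest coefficient is then a solution over \<open>L\<close>, up to
  the factor \<open>- degree H\<close>, which is invertible in characteristic \<open>0\<close>.
\<close>

lemma additive_algebraic_in_subfield:
  assumes v: "sg v = v + b" "b \<in> L" and alg: "algebraic_over L v"
  shows "v \<in> L"
proof -
  define S where "S = {p \<in> polys_over L. p \<noteq> 0 \<and> poly p v = 0}"
  obtain p0 where "p0 \<in> S" using alg by (auto simp: algebraic_over_def S_def)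
  then obtain p where p: "p \<in> S" "\<And>r. r \<in> S \<Longrightarrow> degree p \<le> degree r"
    using ex_has_least_nat[of "\<lambda>p. p \<in> S" p0 degree] by blast
  define H where "H = smult (inverse (lead_coeff p)) p"
  have H: "H \<in> polys_over L" "poly H v = 0" "degree H = degree p" "lead_coeff H = 1"
    using p(1) by (auto simp: H_def S_def intro!: polys_over_smult[OF L] subfield_inverse[OF L] dest: polys_overD)
  have "degree H \<noteq> 0"
  proof
    assume "degree H = 0"
    then obtain c where "H = [:c:]" by (rule degree_eq_zeroE)
    then show False using H by simp
  qed
  then obtain n where n: "degree H = Suc n" using not0_implies_Suc by blast
  define H' where "H' = pcompose (map_poly sg H) [:b, 1:]"
  have dt: "degree (map_poly sg H) \<le> Suc n" by (simp add: degree_twist n)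
  have "poly H' v = poly (map_poly sg H) (sg v)" by (simp add: H'_def poly_pcompose v add.commute)
  then have root: "poly H' v = 0" using H by (simp add: poly_twist sg_0)
  have H': "H' \<in> polys_over L" unfolding H'_def
    by (intro polys_over_pcompose[OF L] polys_over_twist polys_over_linear[OF L] H v subfield_one[OF L])
  have "degree (H' - H) < Suc n"
  proof (rule ccontr)
    assume "\<not> ?thesis"
    moreover have "degree H' \<le> Suc n"
      unfolding H'_def using degree_pcompose_le[of "map_poly sg H" "[:b, 1:]"] dt by simp
    ultimately have "degree (H' - H) = Suc n" using degree_diff_le[of H' "Suc n" H] n by simp
    moreover have "coeff (H' - H) (Suc n) = 0"
      using coeff_pcompose_shift(1)[OF dt, of b] H(4) by (simp add: H'_def coeff_twist n sg_1)
    ultimately show False by (metis leading_coeff_0_iff degree_0 nat.distinct(1))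
  qed
  moreover have "H' - H \<in> polys_over L" "poly (H' - H) v = 0"
    using H H' root by (auto intro: polys_over_diff[OF L])
  ultimately have "H' = H" using p(2)[of "H' - H"] n H(3) by (auto simp: S_def)
  then have "coeff H n = sg (coeff H n) + of_nat (Suc n) * b"
    using coeff_pcompose_shift(2)[OF dt, of b] H(4) n by (simp add: H'_def coeff_twist sg_1)
  then show ?thesis using additive_in_subfield[OF v(1) polys_overD[OF H(1), of n]] by metis
qed

text \<open>
  Call \<open>Q\<close> a denominator of \<open>y\<close> if \<open>Q(v) y \<in> L[v]\<close>.  The difference of two monic denominators of the
  same degree is a denominator of smaller degree, so a monic one of minimal degree is unique, and
  therefore compatible with \<open>sg\<close>.
\<close>

lemma minimal_denominator:
  assumes y: "y \<in> subfield_generated (insert v L)"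
  obtains Q P where "Q \<in> polys_over L" "lead_coeff Q = 1" "P \<in> polys_over L" "poly Q v * y = poly P v"
    "\<And>Q' P'. Q' \<in> polys_over L \<Longrightarrow> P' \<in> polys_over L \<Longrightarrow> poly Q' v * y = poly P' v \<Longrightarrow>
      degree Q' \<le> degree Q \<Longrightarrow> Q' = smult (coeff Q' (degree Q)) Q"
proof -
  define S where "S = {Q \<in> polys_over L. Q \<noteq> 0 \<and> (\<exists>P\<in>polys_over L. poly Q v * y = poly P v)}"
  obtain P0 Q0 where PQ: "P0 \<in> polys_over L" "Q0 \<in> polys_over L" "poly Q0 v \<noteq> 0" "y = poly P0 v / poly Q0 v"
    using subfield_generated_insertE[OF L y] by blast
  then have "Q0 \<in> S" unfolding S_def by (auto intro!: bexI[of _ P0])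
  then obtain R where R: "R \<in> S" "\<And>r. r \<in> S \<Longrightarrow> degree R \<le> degree r"
    using ex_has_least_nat[of "\<lambda>p. p \<in> S" Q0 degree] by blast
  obtain PR where PR: "PR \<in> polys_over L" "poly R v * y = poly PR v" using R(1) by (auto simp: S_def)
  define c where "c = inverse (lead_coeff R)"
  have c: "c \<in> L" "c \<noteq> 0" unfolding c_def using R(1) by (auto simp: S_def intro!: subfield_inverse[OF L] dest: polys_overD)
  define Q P where "Q = smult c R" and "P = smult c PR"
  have Q: "Q \<in> polys_over L" "degree Q = degree R" "lead_coeff Q = 1" "Q \<noteq> 0"
    using R(1) c by (auto simp: Q_def S_def c_def intro!: polys_over_smult[OF L])
  have P: "P \<in> polys_over L" "poly Q v * y = poly P v"
    using PR c by (auto simp: Q_def P_def mult.assoc intro!: polys_over_smult[OF L])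
  show thesis
  proof (rule that[OF Q(1,3) P])
    fix Q' P' assume *: "Q' \<in> polys_over L" "P' \<in> polys_over L" "poly Q' v * y = poly P' v"
      "degree Q' \<le> degree Q"
    define e where "e = coeff Q' (degree Q)"
    have e: "e \<in> L" unfolding e_def using * by (auto dest: polys_overD)
    define E where "E = Q' - smult e Q"
    have "E = 0"
    proof (rule ccontr)
      assume E: "E \<noteq> 0"
      have "poly E v * y = poly (P' - smult e P) v"
        using *(3) P(2) by (simp add: E_def algebra_simps)
      moreover have "E \<in> polys_over L" "P' - smult e P \<in> polys_over L"
        unfolding E_def using * P Q e by (auto intro!: polys_over_diff[OF L] polys_over_smult[OF L])
      ultimately have "E \<in> S" using E unfolding S_def by blast
      then have "degree Q \<le> degree E" using R(2) Q(2) by simp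
      moreover have "degree E \<le> degree Q"
        unfolding E_def using *(4) by (intro degree_diff_le) auto
      ultimately have "lead_coeff E = 0" using Q(3) by (simp add: E_def e_def)
      then show False using E by simp
    qed
    then show "Q' = smult (coeff Q' (degree Q)) Q" by (simp add: E_def e_def)
  qed
qed

text \<open>
  Write \<open>y = P(v) / Q(v)\<close> with the minimal denominator \<open>Q\<close>, where \<open>v\<close> is transcendental.  Then \<open>Q\<close> is
  stable under \<open>v \<mapsto> v + b\<close>; if its degree were positive, its second highest coefficient would put \<open>v\<close>
  into \<open>L\<close>.  So \<open>y = P(v)\<close>, and \<open>P\<close> is stable up to an additive constant, which excludes degrees above
  \<open>1\<close> in the same way.
\<close>

lemma additive_in_additive_extension:
  assumes v: "sg v = v + b" "b \<in> L" "v \<notin> L"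
    and y: "y \<in> subfield_generated (insert v L)" "sg y - y \<in> L"
  obtains c where "c \<in> consts_sg" "y - c * v \<in> L"
proof -
  have transc: "p = 0" if "p \<in> polys_over L" "poly p v = 0" for p
    using additive_algebraic_in_subfield[OF v(1,2)] v(3) that by (auto simp: algebraic_over_def)
  obtain Q P where Q: "Q \<in> polys_over L" "lead_coeff Q = 1" and P: "P \<in> polys_over L" and
    QP: "poly Q v * y = poly P v" and
    min: "\<And>Q' P'. Q' \<in> polys_over L \<Longrightarrow> P' \<in> polys_over L \<Longrightarrow> poly Q' v * y = poly P' v \<Longrightarrow>
      degree Q' \<le> degree Q \<Longrightarrow> Q' = smult (coeff Q' (degree Q)) Q"
    using minimal_denominator[OF y(1)] by metis
  define shift where "shift = (\<lambda>p. pcompose (map_poly sg p) [:b, 1:])"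
  have shift: "shift p \<in> polys_over L" if "p \<in> polys_over L" for p
    unfolding shift_def
    by (intro polys_over_pcompose[OF L] polys_over_twist polys_over_linear[OF L] that v subfield_one[OF L])
  have poly_shift: "poly (shift p) v = sg (poly p v)" for p
    by (simp add: shift_def poly_pcompose flip: poly_twist) (simp add: v add.commute)
  have degree_shift: "degree (shift p) \<le> degree p" for p
    using degree_pcompose_le[of "map_poly sg p" "[:b, 1:]"] by (simp add: shift_def degree_twist)
  have coeff_shift: "coeff (shift p) (Suc n) = sg (coeff p (Suc n))"
    "coeff (shift p) n = sg (coeff p n) + of_nat (Suc n) * b * sg (coeff p (Suc n))"
    if "degree p \<le> Suc n" for p n
    using coeff_pcompose_shift[of "map_poly sg p" n b] that by (simp_all add: shift_def degree_twist coeff_twist)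
  define e where "e = sg y - y"
  have "poly (shift Q) v * sg y = poly (shift P) v"
    unfolding poly_shift QP[symmetric] by (simp add: sg_mult)
  then have shift_rel: "poly (shift Q) v * y = poly (shift P - smult e (shift Q)) v"
    by (simp add: e_def algebra_simps)
  have shiftQ: "shift Q = smult (coeff (shift Q) (degree Q)) Q"
    using y(2) by (intro min[OF _ _ shift_rel] shift degree_shift polys_over_diff[OF L] polys_over_smult[OF L] Q P)
       (simp_all add: e_def)
  have "degree Q = 0"
  proof (rule ccontr)
    assume "degree Q \<noteq> 0"
    then obtain n where n: "degree Q = Suc n" using not0_implies_Suc by blast
    have "coeff (shift Q) (degree Q) = 1" using coeff_shift(1)[of Q n] Q(2) by (simp add: n sg_1)
    then have "shift Q = Q" using shiftQ by simp
    then have "coeff Q n = sg (coeff Q n) + of_nat (Suc n) * b"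
      using coeff_shift(2)[of Q n] Q(2) by (simp add: n sg_1)
    then show False using additive_in_subfield[OF v(1) polys_overD[OF Q(1), of n]] v(3) by metis
  qed
  then obtain c where "Q = [:c:]" by (rule degree_eq_zeroE)
  then have "Q = 1" using Q(2) by (simp add: one_pCons)
  then have yP: "y = poly P v" using QP by simp
  have "shift P - P - [:e:] = 0"
  proof (rule transc)
    show "shift P - P - [:e:] \<in> polys_over L"
      using y(2) by (intro polys_over_diff[OF L] shift P polys_over_const[OF L]) (simp add: e_def)
    show "poly (shift P - P - [:e:]) v = 0"
      by (simp add: poly_shift e_def yP)
  qed
  then have shiftP: "shift P = P + [:e:]" by (simp add: algebra_simps)
  have "degree P \<le> 1"
  proof (rule ccontr)
    assume "\<not> ?thesis"
    then obtain n where n: "degree P = Suc (Suc n)" by (cases "degree P"; cases "degree P - 1") auto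
    define a where "a = lead_coeff P"
    have "P \<noteq> 0" using n by auto
    then have a: "a \<noteq> 0" by (simp add: a_def)
    have a: "a \<noteq> 0" "a \<in> L" "sg a = a"
      using a n P coeff_shift(1)[of P "Suc n"] unfolding shiftP by (simp_all add: a_def polys_overD)
    have "coeff P (Suc n) = sg (coeff P (Suc n)) + of_nat (Suc (Suc n)) * b * a"
      using coeff_shift(2)[of P "Suc n"] a n unfolding shiftP by (simp add: a_def)
    then have "sg (coeff P (Suc n) / a) + of_nat (Suc (Suc n)) * b = coeff P (Suc n) / a"
      using a by (simp add: sg_divide field_simps)
    moreover have "coeff P (Suc n) / a \<in> L" using P a by (intro subfield_divide[OF L]) (auto dest: polys_overD)
    ultimately show False using additive_in_subfield[OF v(1)] v(3) by blast
  qed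
  then have P01: "P = [:coeff P 0, coeff P 1:]"
    by (intro poly_eqI) (auto simp: coeff_pCons coeff_eq_0 split: nat.splits)
  have "coeff P 1 \<in> consts_sg"
    using coeff_shift(1)[of P 0] \<open>degree P \<le> 1\<close> unfolding shiftP by (simp add: consts_sg_iff)
  moreover have "y - coeff P 1 * v = coeff P 0" unfolding yP by (subst P01) simp
  ultimately show thesis using that polys_overD[OF P] by metis
qed

text \<open>
  A polynomial which the substitution \<open>u \<mapsto> a u\<close> multiplies by the factor \<open>a\<^sup>n\<close> of a monomial is that
  monomial, unless a power of \<open>u\<close> differs from an element of \<open>L\<close> by an invariant factor.
\<close>

lemma semi_invariant_imp_power_in_subfield:
  assumes u: "sg u = a * u" "u \<noteq> 0" and s: "s \<in> L" "s \<noteq> 0" "sg s * a ^ j = a ^ n * s" "j \<noteq> n"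
  shows "\<exists>m>0. u ^ m \<in> L"
proof -
  have a: "a \<noteq> 0" using u sg_eq_0_iff[of u] by auto
  show ?thesis
  proof (cases "j < n")
    case True
    then have "a ^ n = a ^ (n - j) * a ^ j" by (simp flip: power_add)
    then have *: "sg s = a ^ (n - j) * s" using s(3) a by simp
    have "sg (u ^ (n - j) / s) = u ^ (n - j) / s"
      using a by (simp add: sg_hom u * power_mult_distrib)
    then have "u ^ (n - j) / s * s \<in> L" using consts_L s by (intro subfield_mult[OF L]) (auto simp: consts_sg_iff)
    then show ?thesis using True s by (intro exI[of _ "n - j"]) auto
  next
    case False
    then have "j > n" using s(4) by simp
    then have "a ^ j = a ^ (j - n) * a ^ n" by (simp flip: power_add)
    then have *: "sg s * a ^ (j - n) = s" using s(3) a by simp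
    have "sg (u ^ (j - n) * s) = u ^ (j - n) * (sg s * a ^ (j - n))"
      by (simp add: sg_hom u power_mult_distrib)
    then have "sg (u ^ (j - n) * s) = u ^ (j - n) * s" using * by simp
    then have "(u ^ (j - n) * s) / s \<in> L" using consts_L s by (intro subfield_divide[OF L]) (auto simp: consts_sg_iff)
    then show ?thesis using \<open>j > n\<close> s by (intro exI[of _ "j - n"]) auto
  qed
qed

text \<open>
  The minimal polynomial of \<open>u\<close> is multiplied by a power of \<open>a\<close> under \<open>u \<mapsto> a u\<close>, and it is not a
  monomial because \<open>u \<noteq> 0\<close>.
\<close>

lemma multiplicative_algebraic_imp_power:
  assumes u: "sg u = a * u" "a \<in> L" "u \<noteq> 0" and alg: "algebraic_over L u"
  shows "\<exists>m>0. u ^ m \<in> L"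
proof -
  define S where "S = {p \<in> polys_over L. p \<noteq> 0 \<and> poly p u = 0}"
  obtain p0 where "p0 \<in> S" using alg by (auto simp: algebraic_over_def S_def)
  then obtain p where p: "p \<in> S" "\<And>r. r \<in> S \<Longrightarrow> degree p \<le> degree r"
    using ex_has_least_nat[of "\<lambda>p. p \<in> S" p0 degree] by blast
  define H where "H = smult (inverse (lead_coeff p)) p"
  have H: "H \<in> polys_over L" "poly H u = 0" "degree H = degree p" "lead_coeff H = 1"
    using p(1) by (auto simp: H_def S_def intro!: polys_over_smult[OF L] subfield_inverse[OF L] dest: polys_overD)
  define n where "n = degree H"
  define H' where "H' = pcompose (map_poly sg H) [:0, a:] - smult (a ^ n) H"
  have coeff_H': "coeff H' j = sg (coeff H j) * a ^ j - a ^ n * coeff H j" for j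
    by (simp add: H'_def coeff_pcompose_dilate coeff_twist mult.commute)
  have "H' = 0"
  proof (rule ccontr)
    assume "H' \<noteq> 0"
    moreover have "H' \<in> polys_over L" unfolding H'_def
      by (intro polys_over_diff[OF L] polys_over_smult[OF L] polys_over_pcompose[OF L] polys_over_twist
          polys_over_linear[OF L] H u subfield_zero[OF L] subfield_power[OF L])
    moreover have "poly H' u = 0"
      using poly_twist[of H u] H(2) by (simp add: H'_def poly_pcompose u mult.commute sg_0)
    ultimately have "n \<le> degree H'" using p(2)[of H'] H(3) by (simp add: S_def n_def)
    moreover have "coeff H' j = 0" if "j \<ge> n" for j
      using that H(4) by (cases "j = n") (auto simp: coeff_H' n_def coeff_eq_0 sg_hom)
    ultimately show False using \<open>H' \<noteq> 0\<close> by (metis leading_coeff_0_iff)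
  qed
  have "\<exists>j<n. coeff H j \<noteq> 0"
  proof (rule ccontr)
    assume "\<not> ?thesis"
    then have "coeff H j = (if n = j then 1 else 0)" for j
      using H(4) by (cases j n rule: linorder_cases) (auto simp: n_def coeff_eq_0)
    then have "H = monom 1 n" by (intro poly_eqI) simp
    then show False using H(2) u by (simp add: poly_monom)
  qed
  then obtain j where j: "j < n" "coeff H j \<noteq> 0" by blast
  have "sg (coeff H j) * a ^ j = a ^ n * coeff H j" using coeff_H'[of j] \<open>H' = 0\<close> by simp
  then show ?thesis
    using j by (intro semi_invariant_imp_power_in_subfield[OF u(1,3) polys_overD[OF H(1)]]) auto
qed

text \<open>
  Here \<open>u\<close> is transcendental.  Under \<open>u \<mapsto> a u\<close> the minimal denominator of \<open>y\<close> is multiplied by a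
  power of \<open>a\<close>, so it is a monomial \<open>u\<^sup>n\<close>; all terms of the numerator except the one of the same degree
  \<open>n\<close> are forced to vanish.
\<close>

lemma additive_in_multiplicative_extension:
  assumes u: "sg u = a * u" "a \<in> L" "u \<noteq> 0" and nopow: "\<And>m. m > 0 \<Longrightarrow> u ^ m \<notin> L"
    and y: "y \<in> subfield_generated (insert u L)" "sg y - y \<in> L"
  shows "y \<in> L"
proof -
  have transc: "p = 0" if "p \<in> polys_over L" "poly p u = 0" for p
    using multiplicative_algebraic_imp_power[OF u] nopow that by (auto simp: algebraic_over_def)
  have mono: "coeff p j = 0" if p: "p \<in> polys_over L" "sg (coeff p j) * a ^ j = a ^ n * coeff p j" "j \<noteq> n" for p j n
    using semi_invariant_imp_power_in_subfield[OF u(1,3) polys_overD[OF p(1)] _ p(2,3)] nopow by blast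
  obtain Q P where Q: "Q \<in> polys_over L" "lead_coeff Q = 1" and P: "P \<in> polys_over L" and
    QP: "poly Q u * y = poly P u" and
    min: "\<And>Q' P'. Q' \<in> polys_over L \<Longrightarrow> P' \<in> polys_over L \<Longrightarrow> poly Q' u * y = poly P' u \<Longrightarrow>
      degree Q' \<le> degree Q \<Longrightarrow> Q' = smult (coeff Q' (degree Q)) Q"
    using minimal_denominator[OF y(1)] by metis
  define dil where "dil = (\<lambda>p. pcompose (map_poly sg p) [:0, a:])"
  have dil: "dil p \<in> polys_over L" if "p \<in> polys_over L" for p
    unfolding dil_def
    by (intro polys_over_pcompose[OF L] polys_over_twist polys_over_linear[OF L] that u subfield_zero[OF L])
  have poly_dil: "poly (dil p) u = sg (poly p u)" for p
    by (simp add: dil_def poly_pcompose flip: poly_twist) (simp add: u mult.commute)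
  have coeff_dil: "coeff (dil p) j = sg (coeff p j) * a ^ j" for p j
    by (simp add: dil_def coeff_pcompose_dilate coeff_twist mult.commute)
  have degree_dil: "degree (dil p) \<le> degree p" for p
    by (rule degree_le) (simp add: coeff_dil coeff_eq_0 sg_0)
  define e where "e = sg y - y"
  have e: "e \<in> L" using y(2) by (simp add: e_def)
  have "poly (dil Q) u * sg y = poly (dil P) u"
    unfolding poly_dil QP[symmetric] by (simp add: sg_mult)
  then have dil_rel: "poly (dil Q) u * y = poly (dil P - smult e (dil Q)) u"
    by (simp add: e_def algebra_simps)
  define n where "n = degree Q"
  have "dil Q = smult (coeff (dil Q) (degree Q)) Q"
    by (intro min[OF _ _ dil_rel] dil degree_dil polys_over_diff[OF L] polys_over_smult[OF L] Q P e)
  moreover have "coeff (dil Q) (degree Q) = a ^ n" using Q(2) by (simp add: coeff_dil n_def sg_1)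
  ultimately have dilQ: "dil Q = smult (a ^ n) Q" by simp
  have "coeff Q j = 0" if "j \<noteq> n" for j
    using arg_cong[OF dilQ, of "\<lambda>p. coeff p j"] mono[OF Q(1) _ that] by (simp add: coeff_dil)
  then have Qm: "Q = monom 1 n"
    using Q(2) by (intro poly_eqI) (auto simp: n_def)
  have "dil P - smult e (dil Q) - smult (a ^ n) P = 0"
  proof (rule transc)
    show "dil P - smult e (dil Q) - smult (a ^ n) P \<in> polys_over L"
      by (intro dil polys_over_diff[OF L] polys_over_smult[OF L] subfield_power[OF L] u Q P e)
    have "poly (dil Q) u * y = a ^ n * poly P u" by (simp add: dilQ QP[symmetric] mult.assoc)
    then show "poly (dil P - smult e (dil Q) - smult (a ^ n) P) u = 0"
      using dil_rel by simp
  qed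
  then have dilP: "dil P = smult e (dil Q) + smult (a ^ n) P" by (simp add: algebra_simps)
  have "coeff P j = 0" if "j \<noteq> n" for j
    using arg_cong[OF dilP, of "\<lambda>p. coeff p j"] mono[OF P _ that] that by (simp add: coeff_dil Qm sg_0)
  then have Pm: "P = monom (coeff P n) n" by (intro poly_eqI) auto
  have "u ^ n * y = coeff P n * u ^ n" using QP by (subst (asm) Pm) (simp add: Qm poly_monom)
  then have "y = coeff P n" using u by simp
  then show ?thesis using polys_overD[OF P] by simp
qed

end

section \<open>Derivations commuting with the difference operator\<close>

locale field_derivation =
  fixes del :: "'a::field_char_0 \<Rightarrow> 'a"
  assumes derivation_del: "derivation del"
begin

lemma del_add: "del (x + y) = del x + del y"
  and del_mult: "del (x * y) = del x * y + x * del y"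
  using derivation_del by (auto simp: derivation_def)

lemma del_0: "del 0 = 0"
  using del_add[of 0 0] by simp

lemma del_1: "del 1 = 0"
  using del_mult[of 1 1] by simp

lemma del_uminus: "del (- x) = - del x"
  using del_add[of x "- x"] by (simp add: del_0 eq_neg_iff_add_eq_0 add.commute)

lemma del_diff: "del (x - y) = del x - del y"
  using del_add[of x "- y"] by (simp add: del_uminus)

lemma del_divide: "del (x / y) = (del x * y - x * del y) / (y * y)"
proof (cases "y = 0")
  case False
  have "del x = del (x / y) * y + x / y * del y"
    using del_mult[of "x / y" y] False by simp
  then show ?thesis using False by (simp add: field_simps)
qed (simp add: del_0)

lemma del_power: "x * del (x ^ n) = of_nat n * x ^ n * del x"
  by (rule derivation_power[OF derivation_del])

lemma funpow_del_diff: "(del ^^ n) (x - y) = (del ^^ n) x - (del ^^ n) y"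
  by (induction n) (auto simp: del_diff)

lemma funpow_del_add: "(del ^^ n) (x + y) = (del ^^ n) x + (del ^^ n) y"
  by (induction n) (auto simp: del_add)

lemma generated_del_subset:
  assumes "is_subfield R" "S \<subseteq> R" "del ` S \<subseteq> R"
  shows "del ` subfield_generated S \<subseteq> R"
proof -
  have "is_subfield {y \<in> R. del y \<in> R}"
    using assms(1) unfolding is_subfield_def
    by (auto simp: del_1 del_diff del_mult del_divide intro!: subfield_closed[OF assms(1)])
  then have "subfield_generated S \<subseteq> {y \<in> R. del y \<in> R}"
    by (rule subfield_generated_least) (use assms in auto)
  then show ?thesis by auto
qed

lemma generated_del_stable:
  assumes "del ` S \<subseteq> subfield_generated S"
  shows "del ` subfield_generated S \<subseteq> subfield_generated S"
  by (rule generated_del_subset[OF subfield_generated_subfield subfield_generated_superset assms])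

definition dlog :: "'a \<Rightarrow> 'a" where
  "dlog y = del y / y"

lemma dlog_mult: "x \<noteq> 0 \<Longrightarrow> y \<noteq> 0 \<Longrightarrow> dlog (x * y) = dlog x + dlog y"
  by (simp add: dlog_def del_mult field_simps)

lemma dlog_divide: "x \<noteq> 0 \<Longrightarrow> y \<noteq> 0 \<Longrightarrow> dlog (x / y) = dlog x - dlog y"
  by (simp add: dlog_def del_divide field_simps)

lemma dlog_1: "dlog 1 = 0"
  by (simp add: dlog_def del_1)

lemma dlog_power: "x \<noteq> 0 \<Longrightarrow> dlog (x ^ n) = of_nat n * dlog x"
  by (induction n) (auto simp: dlog_1 dlog_mult algebra_simps)

lemma dlog_power_int: "x \<noteq> 0 \<Longrightarrow> dlog (x powi n) = of_int n * dlog x"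
proof (cases n rule: int_cases2)
  case (nonpos m)
  assume "x \<noteq> 0"
  then have "dlog (1 / x ^ m) = - (of_nat m * dlog x)"
    by (subst dlog_divide) (auto simp: dlog_1 dlog_power)
  then show ?thesis by (simp add: nonpos power_int_minus divide_inverse)
qed (simp add: dlog_power)

end

locale difference_differential_field = difference_field sg + field_derivation del
  for sg del :: "'a::field_char_0 \<Rightarrow> 'a" +
  assumes del_sg: "del (sg x) = sg (del x)"
begin

lemma funpow_del_sg: "(del ^^ n) (sg x) = sg ((del ^^ n) x)"
  by (induction n) (auto simp: del_sg)

lemma dlog_sg: "dlog (sg x) = sg (dlog x)"
  by (simp add: dlog_def del_sg sg_divide)

lemma del_consts: "c \<in> consts_sg \<Longrightarrow> del c \<in> consts_sg"
  by (simp add: consts_sg_iff flip: del_sg)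

end

text \<open>
  The tower \<open>F(u) \<subseteq> F(u, y\<^sub>0) \<subseteq> F(u, y\<^sub>0, y\<^sub>1) \<subseteq> \<dots>\<close> built from a solution \<open>u\<close> of \<open>sg u = a u\<close> and
  the derivatives \<open>y\<^sub>n\<close> of its logarithmic derivative, which satisfy \<open>sg y\<^sub>n = y\<^sub>n + b\<^sub>n\<close>.
\<close>

locale multiplicative_solution = difference_differential_field sg del + difference_subfield sg F
  for sg del :: "'a::field_char_0 \<Rightarrow> 'a" and F :: "'a set" +
  fixes a u :: 'a
  assumes del_F: "del ` F \<subseteq> F"
    and a: "a \<in> F" and u: "sg u = a * u" "u \<noteq> 0"
begin

definition y :: "nat \<Rightarrow> 'a" where "y n = (del ^^ n) (dlog u)"
definition b :: "nat \<Rightarrow> 'a" where "b n = (del ^^ n) (dlog a)"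

lemma a_nonzero: "a \<noteq> 0"
  using u sg_eq_0_iff[of u] by auto

lemma b_F: "b n \<in> F"
proof -
  have "dlog a \<in> F" unfolding dlog_def using a del_F by (intro subfield_divide[OF L]) auto
  then show ?thesis unfolding b_def using del_F by (induction n) auto
qed

lemma sg_y: "sg (y n) = y n + b n"
proof -
  have "sg (dlog u) = dlog u + dlog a"
    using u a_nonzero by (simp add: dlog_mult add.commute flip: dlog_sg)
  then show ?thesis by (simp add: y_def b_def funpow_del_add flip: funpow_del_sg)
qed

primrec tower :: "nat \<Rightarrow> 'a set" where
  "tower 0 = subfield_generated (insert u F)"
| "tower (Suc n) = subfield_generated (insert (y n) (tower n))"

lemma tower_subfield: "is_subfield (tower n)"
  by (cases n) (auto simp: subfield_generated_subfield)

lemma tower_Suc_superset: "tower n \<subseteq> tower (Suc n)"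
  using subfield_generated_superset[of "insert (y n) (tower n)"] by auto

lemma tower_mono: "m \<le> n \<Longrightarrow> tower m \<subseteq> tower n"
  by (rule lift_Suc_mono_le[of tower]) (rule tower_Suc_superset)

lemma u_in_tower: "u \<in> tower n" and F_subset_tower: "F \<subseteq> tower n"
  using tower_mono[of 0 n] subfield_generated_superset[of "insert u F"] by auto

lemma y_in_tower: "i < n \<Longrightarrow> y i \<in> tower n"
  using tower_mono[of "Suc i" n] subfield_generated_superset[of "insert (y i) (tower i)"] by auto

lemma difference_subfield_tower: "difference_subfield sg (tower n)"
proof
  show "is_subfield (tower n)" by (rule tower_subfield)
  show "consts_sg \<subseteq> tower n" using consts_L F_subset_tower by blast
  show "sg ` tower n \<subseteq> tower n"
  proof (induction n)
    case 0
    have "sg ` insert u F \<subseteq> tower 0"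
      using u_in_tower[of 0] F_subset_tower[of 0] a sg_L by (auto simp: u intro!: subfield_mult[OF subfield_generated_subfield])
    then show ?case using generated_stable[of "insert u F"] by simp
  next
    case (Suc n)
    have "sg ` insert (y n) (tower n) \<subseteq> tower (Suc n)"
      using Suc tower_Suc_superset[of n] y_in_tower[of n "Suc n"] b_F F_subset_tower[of "Suc n"]
      by (auto simp: sg_y intro!: subfield_add[OF subfield_generated_subfield])
    then show ?case using generated_stable[of "insert (y n) (tower n)"] by simp
  qed
qed

lemma del_u: "del u = u * y 0"
  using u by (simp add: y_def dlog_def)

lemma del_tower: "del ` tower n \<subseteq> tower (Suc n)"
proof (induction n)
  case 0
  have "del ` insert u F \<subseteq> tower (Suc 0)"
    using del_F F_subset_tower[of "Suc 0"] u_in_tower[of "Suc 0"] y_in_tower[of 0 "Suc 0"]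
    by (auto simp: del_u intro!: subfield_mult[OF subfield_generated_subfield])
  then show ?case
    using generated_del_subset[OF tower_subfield[of "Suc 0"], of "insert u F"]
      u_in_tower[of "Suc 0"] F_subset_tower[of "Suc 0"] by simp
next
  case (Suc n)
  have "del (y n) = y (Suc n)" by (simp add: y_def)
  then have "del ` insert (y n) (tower n) \<subseteq> tower (Suc (Suc n))"
    using Suc tower_Suc_superset[of "Suc n"] y_in_tower[of "Suc n" "Suc (Suc n)"] by auto
  moreover have "insert (y n) (tower n) \<subseteq> tower (Suc (Suc n))"
    using tower_mono[of n "Suc (Suc n)"] y_in_tower[of n "Suc (Suc n)"] by auto
  ultimately show ?case
    using generated_del_subset[OF tower_subfield[of "Suc (Suc n)"], of "insert (y n) (tower n)"] by simp
qed

lemma funpow_del_u_in_tower: "(del ^^ i) u \<in> tower i"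
proof (induction i)
  case (Suc i)
  then show ?case using del_tower[of i] by auto
qed (simp add: u_in_tower[of 0, simplified])

text \<open>Differentiating \<open>u y\<^sub>i\<close> reproduces \<open>u y\<^bsub>i+1\<^esub>\<close> up to terms which involve \<open>y\<^sub>0, \<dots>, y\<^sub>i\<close> only.\<close>

lemma funpow_del_u_leading: "(del ^^ Suc i) u - u * y i \<in> tower i"
proof (induction i)
  case 0
  show ?case by (simp add: del_u subfield_zero[OF tower_subfield[of 0, simplified]])
next
  case (Suc i)
  define l where "l = (del ^^ Suc i) u - u * y i"
  have "(del ^^ Suc (Suc i)) u = del (u * y i + l)" by (simp add: l_def)
  also have "\<dots> = u * y 0 * y i + u * y (Suc i) + del l"
    by (simp add: del_add del_mult del_u) (simp add: y_def)
  finally have "(del ^^ Suc (Suc i)) u - u * y (Suc i) = u * y 0 * y i + del l" by simp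
  moreover have "del l \<in> tower (Suc i)" using Suc del_tower[of i] unfolding l_def by blast
  ultimately show ?case
    using u_in_tower[of "Suc i"] y_in_tower[OF zero_less_Suc, of i] y_in_tower[OF lessI, of i]
    by (simp only:) (intro subfield_add[OF tower_subfield] subfield_mult[OF tower_subfield])
qed

text \<open>
  Each step of the tower adjoins an additive solution, so it either is trivial or contributes one
  term \<open>c\<^sub>i y\<^sub>i\<close>; the bottom step, which adjoins \<open>u\<close>, contributes none.
\<close>

lemma additive_in_tower:
  assumes nopow: "\<And>m. m > 0 \<Longrightarrow> u ^ m \<notin> F"
    and w: "w \<in> tower n" "sg w - w \<in> F"
  shows "\<exists>c. (\<forall>i. c i \<in> consts_sg) \<and> w - (\<Sum>i<n. c i * y i) \<in> F"
  using w
proof (induction n arbitrary: w)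
  case 0
  then have "w \<in> F" using additive_in_multiplicative_extension[OF u(1) a u(2) nopow, of w] by simp
  then show ?case
    using subfield_zero[OF consts_sg_subfield] by (intro exI[of _ "\<lambda>_. 0"]) simp
next
  case (Suc n)
  interpret tower: difference_subfield sg "tower n" by (rule difference_subfield_tower)
  have b: "b n \<in> tower n" using b_F F_subset_tower by blast
  show ?case
  proof (cases "y n \<in> tower n")
    case True
    then have "tower (Suc n) \<subseteq> tower n"
      using subfield_generated_least[OF tower_subfield[of n], of "insert (y n) (tower n)"] by simp
    then obtain c where c: "\<forall>i. c i \<in> consts_sg" "w - (\<Sum>i<n. c i * y i) \<in> F"
      using Suc.IH[of w] Suc.prems by blast
    then show ?thesis
      using subfield_zero[OF consts_sg_subfield] by (intro exI[of _ "c(n := 0)"]) auto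
  next
    case False
    obtain e where e: "e \<in> consts_sg" "w - e * y n \<in> tower n"
      using tower.additive_in_additive_extension[OF sg_y b False, of w] Suc.prems F_subset_tower
      by auto
    have "sg (w - e * y n) - (w - e * y n) = (sg w - w) - e * b n"
      using e by (simp add: sg_diff sg_mult sg_y consts_sg_iff algebra_simps)
    also have "\<dots> \<in> F"
      using b_F e consts_L
      by (intro subfield_diff[OF L Suc.prems(2)] subfield_mult[OF L]) auto
    finally obtain c where c: "\<forall>i. c i \<in> consts_sg" "w - e * y n - (\<Sum>i<n. c i * y i) \<in> F"
      using Suc.IH e(2) by blast
    then show ?thesis
      using e(1) by (intro exI[of _ "c(n := e)"]) (auto simp: algebra_simps)
  qed
qed

text \<open>
  If some power of \<open>u\<close> lies in \<open>F\<close>, so does \<open>dlog u\<close>, and \<open>h = dlog u\<close> will do.  Otherwise some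
  derivative of \<open>u\<close> is algebraic over the preceding ones, hence some \<open>y\<^sub>j\<close> is algebraic over, and thus
  belongs to, the \<open>j\<close>-th field of the tower.  Descending the tower, \<open>y\<^sub>j\<close> is the sum of an element \<open>h\<close> of
  \<open>F\<close> and of a combination of the previous \<open>y\<^sub>i\<close> with invariant coefficients.
\<close>

theorem telescoping_relation:
  assumes "satisfies_alg_relation del F u"
  shows "\<exists>j c h. (\<forall>i. c i \<in> consts_sg) \<and> h \<in> F \<and> sg h - h = b j - (\<Sum>i<j. c i * b i)"
proof -
  consider m where "m > 0" "u ^ m \<in> F" | "\<And>m. m > 0 \<Longrightarrow> u ^ m \<notin> F" by blast
  then show ?thesis
  proof cases
    case 1
    have "dlog (u ^ m) \<in> F" unfolding dlog_def using 1 del_F by (intro subfield_divide[OF L]) auto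
    then have "dlog (u ^ m) / of_nat m \<in> F" by (intro subfield_closed[OF L])
    then have "y 0 \<in> F" using 1 u by (simp add: dlog_power y_def)
    then show ?thesis
      using sg_y[of 0] subfield_zero[OF consts_sg_subfield]
      by (intro exI[of _ 0] exI[of _ "\<lambda>_. 0"] exI[of _ "y 0"]) simp
  next
    case 2
    obtain i where i: "algebraic_over (subfield_generated (F \<union> (\<lambda>i. (del ^^ i) u) ` {..<i})) ((del ^^ i) u)"
      using relation_imp_algebraic[OF L assms] by blast
    have "i \<noteq> 0"
    proof
      assume "i = 0"
      then have "algebraic_over F u"
        using i subfield_generated_least[OF L order_refl] algebraic_over_mono[of "subfield_generated F" F] by simp
      then show False using multiplicative_algebraic_imp_power[OF u(1) a u(2)] 2 by blast
    qed
    then obtain j where j: "i = Suc j" using not0_implies_Suc by blast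
    interpret tower: difference_subfield sg "tower j" by (rule difference_subfield_tower)
    have "(\<lambda>i. (del ^^ i) u) ` {..<i} \<subseteq> tower j"
      using subsetD[OF tower_mono funpow_del_u_in_tower] by (auto simp: j less_Suc_eq_le)
    then have "subfield_generated (F \<union> (\<lambda>i. (del ^^ i) u) ` {..<i}) \<subseteq> tower j"
      using F_subset_tower[of j] by (intro subfield_generated_least tower_subfield) auto
    then have "algebraic_over (tower j) ((del ^^ Suc j) u)"
      using i algebraic_over_mono unfolding j by blast
    moreover define l where "l = (del ^^ Suc j) u - u * y j"
    have l: "l \<in> tower j" unfolding l_def by (rule funpow_del_u_leading)
    ultimately have "algebraic_over (tower j) (inverse u * (del ^^ Suc j) u + (- l / u))"
      using u u_in_tower[of j] by (intro algebraic_over_affine[OF tower_subfield]) (auto intro!: subfield_closed[OF tower_subfield])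
    moreover have "inverse u * (del ^^ Suc j) u + (- l / u) = y j"
      using u by (simp add: l_def field_simps)
    ultimately have "y j \<in> tower j"
      using tower.additive_algebraic_in_subfield[OF sg_y] b_F F_subset_tower by auto
    then obtain c where c: "\<forall>i. c i \<in> consts_sg" "y j - (\<Sum>i<j. c i * y i) \<in> F"
      using additive_in_tower[OF 2, of "y j" j] b_F by (auto simp: sg_y)
    define h where "h = y j - (\<Sum>i<j. c i * y i)"
    have "sg h - h = b j - (\<Sum>i<j. c i * b i)"
      using c(1) by (simp add: h_def sg_diff sg_sum sg_mult sg_y consts_sg_iff algebra_simps
          sum.distrib sum_subtractf)
    then show ?thesis using c unfolding h_def by blast
  qed
qed

end

section \<open>Poles of telescoping sums\<close>

text \<open>
  Here \<open>x\<close> is a variable over the coefficient field \<open>E\<close>.  The derivation acts on \<open>E(x)\<close> with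
  \<open>del x = lam x\<close>: for \<open>x d/dx\<close> the factor \<open>lam\<close> is \<open>1\<close>, for the second derivation it is \<open>\<ell>\<^sub>q\<close>, and this is
  why \<open>\<ell>\<^sub>q\<close> has to be among the coefficients.
\<close>

locale orbit_poles = difference_differential_field sg del
  for sg del :: "'a::field_char_0 \<Rightarrow> 'a" +
  fixes E :: "'a set" and x q lam :: 'a
  assumes E: "is_subfield E" and sg_E: "sg ` E \<subseteq> E" and del_E: "del ` E \<subseteq> E"
    and transc: "\<And>p. p \<in> polys_over E \<Longrightarrow> poly p x = 0 \<Longrightarrow> p = 0"
    and sg_x: "sg x = q * x" and q: "q \<in> E" "sg q = q" "q \<noteq> 0" "\<And>n. n > 0 \<Longrightarrow> q ^ n \<noteq> 1"
    and del_x: "del x = lam * x" and lam: "lam \<in> E"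
begin

abbreviation "F \<equiv> subfield_generated (insert x E)"

text \<open>
  The value at \<open>x = w\<close> of a rational function without pole at \<open>w\<close>.  It is a relation because it is
  read off from a representation as a quotient, and \<open>f\<close> is an element of the ambient field.
\<close>

definition has_value :: "'a \<Rightarrow> 'a \<Rightarrow> 'a \<Rightarrow> bool" where
  "has_value w f c \<longleftrightarrow> (\<exists>P\<in>polys_over E. \<exists>Q\<in>polys_over E.
     f = poly P x / poly Q x \<and> poly Q w \<noteq> 0 \<and> c = poly P w / poly Q w)"

lemma has_valueE:
  assumes "has_value w f c"
  obtains P Q where "P \<in> polys_over E" "Q \<in> polys_over E" "f = poly P x / poly Q x"
    "poly Q w \<noteq> 0" "c = poly P w / poly Q w" "poly Q x \<noteq> 0"
proof -
  obtain P Q where *: "P \<in> polys_over E" "Q \<in> polys_over E" "f = poly P x / poly Q x"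
    "poly Q w \<noteq> 0" "c = poly P w / poly Q w"
    using assms by (auto simp: has_value_def)
  moreover have "poly Q x \<noteq> 0" using transc[of Q] * by auto
  ultimately show thesis using that by blast
qed

lemma has_valueI:
  assumes "P \<in> polys_over E" "Q \<in> polys_over E" "f = poly P x / poly Q x"
    "poly Q w \<noteq> 0" "c = poly P w / poly Q w"
  shows "has_value w f c"
  using assms by (auto simp: has_value_def)

lemma has_value_unique:
  assumes "has_value w f c" "has_value w f d"
  shows "c = d"
proof -
  obtain P Q where 1: "P \<in> polys_over E" "Q \<in> polys_over E" "f = poly P x / poly Q x"
    "poly Q w \<noteq> 0" "c = poly P w / poly Q w" "poly Q x \<noteq> 0" using assms(1) by (rule has_valueE)
  obtain R S where 2: "R \<in> polys_over E" "S \<in> polys_over E" "f = poly R x / poly S x"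
    "poly S w \<noteq> 0" "d = poly R w / poly S w" "poly S x \<noteq> 0" using assms(2) by (rule has_valueE)
  have "poly (P * S - R * Q) x = 0"
    using 1(3) 2(3) 1(6) 2(6) by (simp add: field_simps)
  then have "P * S - R * Q = 0"
    by (rule transc[rotated]) (intro polys_over_diff[OF E] polys_over_mult[OF E] 1 2)
  then have "poly (P * S) w = poly (R * Q) w" by simp
  then show ?thesis unfolding 1(5) 2(5) using 1(4) 2(4) by (simp add: field_simps)
qed

lemma has_value_poly: "P \<in> polys_over E \<Longrightarrow> has_value w (poly P x) (poly P w)"
  by (rule has_valueI[of P 1]) (auto simp: polys_over_1[OF E])

lemma has_value_const: "c \<in> E \<Longrightarrow> has_value w c c"
  using has_value_poly[of "[:c:]" w] by (simp add: polys_over_const[OF E])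

lemma has_value_mult:
  assumes "has_value w f c" "has_value w g d"
  shows "has_value w (f * g) (c * d)"
proof -
  obtain P Q where 1: "P \<in> polys_over E" "Q \<in> polys_over E" "f = poly P x / poly Q x"
    "poly Q w \<noteq> 0" "c = poly P w / poly Q w" "poly Q x \<noteq> 0" using assms(1) by (rule has_valueE)
  obtain R S where 2: "R \<in> polys_over E" "S \<in> polys_over E" "g = poly R x / poly S x"
    "poly S w \<noteq> 0" "d = poly R w / poly S w" "poly S x \<noteq> 0" using assms(2) by (rule has_valueE)
  show ?thesis
    by (rule has_valueI[of "P * R" "Q * S"]) (use 1 2 in \<open>auto intro: polys_over_mult[OF E]\<close>)
qed

lemma has_value_add:
  assumes "has_value w f c" "has_value w g d"
  shows "has_value w (f + g) (c + d)"
proof -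
  obtain P Q where 1: "P \<in> polys_over E" "Q \<in> polys_over E" "f = poly P x / poly Q x"
    "poly Q w \<noteq> 0" "c = poly P w / poly Q w" "poly Q x \<noteq> 0" using assms(1) by (rule has_valueE)
  obtain R S where 2: "R \<in> polys_over E" "S \<in> polys_over E" "g = poly R x / poly S x"
    "poly S w \<noteq> 0" "d = poly R w / poly S w" "poly S x \<noteq> 0" using assms(2) by (rule has_valueE)
  show ?thesis
  proof (rule has_valueI[of "P * S + R * Q" "Q * S"])
    show "f + g = poly (P * S + R * Q) x / poly (Q * S) x"
      unfolding 1(3) 2(3) using 1(6) 2(6) by (simp add: field_simps)
    show "c + d = poly (P * S + R * Q) w / poly (Q * S) w"
      unfolding 1(5) 2(5) using 1(4) 2(4) by (simp add: field_simps)
  qed (use 1 2 in \<open>auto intro: polys_over_mult[OF E] polys_over_add[OF E]\<close>)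
qed

lemma has_value_uminus: "has_value w f c \<Longrightarrow> has_value w (- f) (- c)"
  using has_value_mult[OF has_value_const[of "-1"]] subfield_uminus[OF E subfield_one[OF E]] by force

lemma has_value_diff: "has_value w f c \<Longrightarrow> has_value w g d \<Longrightarrow> has_value w (f - g) (c - d)"
  using has_value_add[of w f c "- g" "- d"] has_value_uminus[of w g d] by simp

lemma has_value_inverse:
  assumes "has_value w f c" "c \<noteq> 0"
  shows "has_value w (inverse f) (inverse c)"
proof -
  obtain P Q where 1: "P \<in> polys_over E" "Q \<in> polys_over E" "f = poly P x / poly Q x"
    "poly Q w \<noteq> 0" "c = poly P w / poly Q w" "poly Q x \<noteq> 0" using assms(1) by (rule has_valueE)
  show ?thesis
    by (rule has_valueI[of Q P]) (use 1 assms(2) in auto)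
qed

lemma has_value_power: "has_value w f c \<Longrightarrow> has_value w (f ^ n) (c ^ n)"
  by (induction n) (auto intro: has_value_mult has_value_const subfield_one[OF E])

lemma has_value_sum:
  "(\<And>i. i \<in> I \<Longrightarrow> has_value w (f i) (c i)) \<Longrightarrow> has_value w (sum f I) (sum c I)"
  by (induction I rule: infinite_finite_induct)
    (auto intro: has_value_add has_value_const subfield_zero[OF E])

definition regular :: "'a \<Rightarrow> 'a \<Rightarrow> bool" where
  "regular w f \<longleftrightarrow> (\<exists>c. has_value w f c)"

lemma regular_diff: "regular w f \<Longrightarrow> regular w g \<Longrightarrow> regular w (f - g)"
  and regular_add: "regular w f \<Longrightarrow> regular w g \<Longrightarrow> regular w (f + g)"
  and regular_mult: "regular w f \<Longrightarrow> regular w g \<Longrightarrow> regular w (f * g)"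
  and regular_const: "c \<in> E \<Longrightarrow> regular w c"
  by (auto simp: regular_def intro: has_value_diff has_value_add has_value_mult has_value_const)

lemma regular_sum: "(\<And>i. i \<in> I \<Longrightarrow> regular w (f i)) \<Longrightarrow> regular w (sum f I)"
  by (induction I rule: infinite_finite_induct)
    (auto intro: regular_add regular_const subfield_zero[OF E])

text \<open>
  Cancel the common factors \<open>x - w\<close>; then the numerator or the denominator does not vanish at \<open>w\<close>.
\<close>

lemma regular_or_inverse_vanishes:
  assumes w: "w \<in> E" and f: "f \<in> F"
  shows "regular w f \<or> has_value w (inverse f) 0"
proof -
  obtain P Q where PQ: "P \<in> polys_over E" "Q \<in> polys_over E" "poly Q x \<noteq> 0" "f = poly P x / poly Q x"
    using subfield_generated_insertE[OF E f] by blast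
  then show ?thesis
  proof (induction "degree Q" arbitrary: P Q rule: less_induct)
    case less
    show ?case
    proof (cases "poly Q w = 0")
      case False
      then have "has_value w f (poly P w / poly Q w)"
        using less.prems by (intro has_valueI[of P Q]) auto
      then show ?thesis by (auto simp: regular_def)
    next
      case Q: True
      show ?thesis
      proof (cases "poly P w = 0")
        case False
        then show ?thesis using less.prems Q by (intro disjI2 has_valueI[of Q P]) auto
      next
        case True
        obtain P1 where P1: "P1 \<in> polys_over E" "P = [:- w, 1:] * P1"
          using polys_over_split_root[OF E less.prems(1) w True] .
        obtain Q1 where Q1: "Q1 \<in> polys_over E" "Q = [:- w, 1:] * Q1"
          using polys_over_split_root[OF E less.prems(2) w Q] .
        have "x - w \<noteq> 0" "poly Q1 x \<noteq> 0" using less.prems(3) Q1 by auto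
        then have "f = poly P1 x / poly Q1 x"
          unfolding less.prems(4) P1(2) Q1(2) poly_mult by (intro mult_divide_mult_cancel_left) simp
        moreover have "Q1 \<noteq> 0" using \<open>poly Q1 x \<noteq> 0\<close> by auto
        then have "degree Q1 < degree Q" unfolding Q1(2) by (subst degree_mult_eq) auto
        ultimately show ?thesis using less.hyps P1 Q1 \<open>poly Q1 x \<noteq> 0\<close> by blast
      qed
    qed
  qed
qed

lemma has_value_sg:
  assumes "has_value (q * w) f c" "sg w = w"
  shows "has_value w (sg f) (sg c)"
proof -
  obtain P Q where 1: "P \<in> polys_over E" "Q \<in> polys_over E" "f = poly P x / poly Q x"
    "poly Q (q * w) \<noteq> 0" "c = poly P (q * w) / poly Q (q * w)" "poly Q x \<noteq> 0"
    using assms(1) by (rule has_valueE)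
  define T where "T = (\<lambda>p. pcompose (map_poly sg p) [:0, q:])"
  have T: "T p \<in> polys_over E" if "p \<in> polys_over E" for p
  proof -
    have "map_poly sg p \<in> polys_over E"
      using that sg_E by (auto simp: polys_over_def coeff_twist)
    then show ?thesis unfolding T_def
      by (intro polys_over_pcompose[OF E] polys_over_linear[OF E] q subfield_zero[OF E])
  qed
  have Tx: "poly (T p) x = sg (poly p x)" for p
    by (simp add: T_def poly_pcompose flip: poly_twist) (simp add: sg_x mult.commute)
  have Tw: "poly (T p) w = sg (poly p (q * w))" for p
    by (simp add: T_def poly_pcompose flip: poly_twist) (simp add: sg_mult q assms(2) mult.commute)
  show ?thesis
    by (rule has_valueI[of "T P" "T Q"]) (use 1 T in \<open>auto simp: Tx Tw sg_divide sg_eq_0_iff\<close>)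
qed

lemma del_poly: "P \<in> polys_over E \<Longrightarrow> \<exists>R\<in>polys_over E. del (poly P x) = poly R x"
proof (induction P)
  case 0
  then show ?case by (intro bexI[of _ 0]) (auto simp: del_0)
next
  case (pCons c P)
  then have c: "c \<in> E" and P: "P \<in> polys_over E" by (auto simp: polys_over_pCons_iff[OF E])
  obtain R where R: "R \<in> polys_over E" "del (poly P x) = poly R x" using pCons.IH[OF P] by blast
  show ?case
  proof (intro bexI)
    show "del (poly (pCons c P) x) = poly ([:del c:] + smult lam (pCons 0 P) + pCons 0 R) x"
      by (simp add: del_add del_mult del_x R algebra_simps)
    show "[:del c:] + smult lam (pCons 0 P) + pCons 0 R \<in> polys_over E"
      using c P R lam del_E
      by (intro polys_over_add[OF E] polys_over_smult[OF E])
        (auto simp: polys_over_pCons_iff[OF E] polys_over_0[OF E] subfield_zero[OF E])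
  qed
qed

lemma regular_del:
  assumes "regular w f"
  shows "regular w (del f)"
proof -
  obtain c where "has_value w f c" using assms by (auto simp: regular_def)
  then obtain P Q where 1: "P \<in> polys_over E" "Q \<in> polys_over E" "f = poly P x / poly Q x"
    "poly Q w \<noteq> 0" "poly Q x \<noteq> 0" by (rule has_valueE)
  obtain P' where P': "P' \<in> polys_over E" "del (poly P x) = poly P' x" using del_poly[OF 1(1)] by blast
  obtain Q' where Q': "Q' \<in> polys_over E" "del (poly Q x) = poly Q' x" using del_poly[OF 1(2)] by blast
  have "has_value w (del f) (poly (P' * Q - P * Q') w / poly (Q * Q) w)"
    by (rule has_valueI[of "P' * Q - P * Q'" "Q * Q"])
      (use 1 P' Q' in \<open>auto simp: del_divide intro!: polys_over_diff[OF E] polys_over_mult[OF E]\<close>)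
  then show ?thesis by (auto simp: regular_def)
qed

lemma regular_funpow_del: "regular w f \<Longrightarrow> regular w ((del ^^ n) f)"
  by (induction n) (auto intro: regular_del)

lemma has_value_local_parameter: "z \<in> E \<Longrightarrow> has_value z (x - z) 0"
  using has_value_poly[of "[:- z, 1:]" z] polys_over_linear[OF E] subfield_closed[OF E] by simp

lemma has_value_del_local_parameter: "z \<in> E \<Longrightarrow> has_value z (del (x - z)) (lam * z - del z)"
  using has_value_poly[of "[:- del z, lam:]" z] polys_over_linear[OF E, of "- del z" lam] lam del_E
    subfield_uminus[OF E, of "del z"]
  by (auto simp: del_diff del_x algebra_simps)

lemma regular_dlog_poly:
  assumes "P \<in> polys_over E" "poly P w \<noteq> 0"
  shows "regular w (dlog (poly P x))"
proof -
  have "regular w (poly P x)" using has_value_poly[OF assms(1)] by (auto simp: regular_def)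
  moreover have "regular w (inverse (poly P x))"
    using has_value_inverse[OF has_value_poly[OF assms(1)] assms(2)] by (auto simp: regular_def)
  ultimately show ?thesis
    unfolding dlog_def divide_inverse by (intro regular_mult regular_del)
qed

text \<open>
  If \<open>h\<close> has poles on the orbit of \<open>z\<close>, then \<open>sg h - h\<close> has a pole at the last pole of \<open>h\<close> and also
  just before the first one.  So it cannot have exactly one pole on the orbit.
\<close>

lemma telescoping_not_single_pole:
  assumes z: "z \<in> E" "z \<noteq> 0" "sg z = z" and h: "h \<in> F"
    and pole: "\<not> regular z (sg h - h)"
    and reg: "\<And>j. j \<noteq> 0 \<Longrightarrow> regular (q powi j * z) (sg h - h)"
  shows False
proof -
  define w where "w = (\<lambda>j::int. q powi j * z)"
  have w: "w j \<in> E" "sg (w j) = w j" "q * w j = w (j + 1)" for j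
    using q z by (auto simp: w_def sg_mult sg_power_int power_int_add_1 intro: subfield_closed[OF E])
  have w_inj: "inj w"
  proof (rule injI)
    have *: "i = j" if "i \<le> j" "w i = w j" for i j
    proof (rule ccontr)
      assume "i \<noteq> j"
      have "q powi (j - i) = 1" using that z q by (simp add: w_def power_int_diff)
      moreover have "j - i = int (nat (j - i))" "nat (j - i) > 0" using that \<open>i \<noteq> j\<close> by auto
      ultimately show False using q(4)[of "nat (j - i)"] by (metis power_int_of_nat)
    qed
    show "i = j" if "w i = w j" for i j using *[of i j] *[of j i] that by (cases "i \<le> j") auto
  qed
  define S where "S = {j. \<not> regular (w j) h}"
  obtain P Q where PQ: "P \<in> polys_over E" "Q \<in> polys_over E" "poly Q x \<noteq> 0" "h = poly P x / poly Q x"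
    using subfield_generated_insertE[OF E h] by blast
  have "S \<subseteq> w -` {c. poly Q c = 0}"
    using PQ by (auto simp: S_def regular_def intro: has_valueI[of P Q])
  moreover have "finite {c. poly Q c = 0}" using PQ by (intro poly_roots_finite) auto
  ultimately have finS: "finite S" using finite_vimageI[OF _ w_inj] finite_subset by blast
  have sg_regular: "regular (w j) (sg h) \<longleftrightarrow> j + 1 \<notin> S" for j
  proof
    assume "j + 1 \<notin> S"
    then obtain c where "has_value (q * w j) h c" by (auto simp: S_def regular_def w)
    then show "regular (w j) (sg h)" using has_value_sg w unfolding regular_def by blast
  next
    assume r: "regular (w j) (sg h)"
    show "j + 1 \<notin> S"
    proof
      assume jS: "j + 1 \<in> S"
      then have "h \<noteq> 0" using regular_const[OF subfield_zero[OF E]] by (auto simp: S_def)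
      have "has_value (q * w j) (inverse h) 0"
        using regular_or_inverse_vanishes[OF w(1) h, of "j + 1"] jS by (auto simp: S_def w)
      then have "has_value (w j) (sg (inverse h)) (sg 0)" by (rule has_value_sg) (rule w)
      moreover obtain c where "has_value (w j) (sg h) c" using r by (auto simp: regular_def)
      ultimately have "has_value (w j) (sg (inverse h) * sg h) (sg 0 * c)" by (rule has_value_mult)
      then have "has_value (w j) 1 0" using \<open>h \<noteq> 0\<close> by (simp add: sg_0 sg_1 flip: sg_mult)
      moreover have "has_value (w j) 1 1" by (rule has_value_const) (rule subfield_one[OF E])
      ultimately show False using has_value_unique by fastforce
    qed
  qed
  have w0: "w 0 = z" by (simp add: w_def)
  have "S \<noteq> {}"
  proof
    assume "S = {}"
    then have "regular (w 0) (sg h)" "regular (w 0) h" using sg_regular by (auto simp: S_def)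
    then show False using pole regular_diff w0 by simp
  qed
  define top bot where "top = Max S" and "bot = Min S"
  have topS: "top \<in> S" "top + 1 \<notin> S" and botS: "bot \<in> S" "bot - 1 \<notin> S" and "bot \<le> top"
    using \<open>S \<noteq> {}\<close> finS Max_ge[OF finS, of "Max S + 1"] Min_le[OF finS, of "Min S - 1"]
    by (auto simp: top_def bot_def)
  have "top = 0"
  proof (rule ccontr)
    assume "top \<noteq> 0"
    then have "regular (w top) (sg h - h)" using reg by (simp add: w_def)
    moreover have "regular (w top) (sg h)" using sg_regular topS by simp
    ultimately have "regular (w top) (sg h - (sg h - h))" using regular_diff by blast
    then show False using topS by (simp add: S_def)
  qed
  moreover have "bot - 1 = 0"
  proof (rule ccontr)
    assume "bot - 1 \<noteq> 0"
    then have "regular (w (bot - 1)) (sg h - h)" using reg by (simp add: w_def)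
    moreover have "regular (w (bot - 1)) h" using botS by (simp add: S_def)
    ultimately have "regular (w (bot - 1)) ((sg h - h) + h)" using regular_add by blast
    then show False using sg_regular[of "bot - 1"] botS by simp
  qed
  ultimately show False using \<open>bot \<le> top\<close> by simp
qed

text \<open>
  Put \<open>t = x - z\<close>.  The derivative of \<open>w / t\<^sup>m\<close> has leading term \<open>- m w del t / t\<^bsup>m+1\<^esup>\<close>, and
  nondegeneracy says that \<open>del t\<close> does not vanish at \<open>z\<close>.  So each derivation raises the pole order by
  exactly one.
\<close>

lemma derivative_pole_order:
  assumes z: "z \<in> E" and nondeg: "lam * z \<noteq> del z"
    and f: "has_value z ((x - z) * f) c" "c \<noteq> 0"
  shows "\<exists>c. c \<noteq> 0 \<and> has_value z ((x - z) ^ Suc i * (del ^^ i) f) c"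
proof (induction i)
  case 0
  show ?case using f by auto
next
  case (Suc i)
  define t where "t = x - z"
  define g where "g = (del ^^ i) f"
  obtain d where d: "d \<noteq> 0" "has_value z (t ^ Suc i * g) d" using Suc by (auto simp: t_def g_def)
  note t = has_value_local_parameter[OF z, folded t_def]
    and dt = has_value_del_local_parameter[OF z, folded t_def]
  have "regular z (t ^ Suc i * g)" using d by (auto simp: regular_def)
  then obtain e where e: "has_value z (del (t ^ Suc i * g)) e"
    using regular_del by (auto simp: regular_def)
  have *: "t ^ Suc (Suc i) * del g = t * del (t ^ Suc i * g) - of_nat (Suc i) * (t ^ Suc i * g) * del t"
    using del_power[of t "Suc i"] unfolding del_mult by (simp add: algebra_simps)
  have "has_value z (t ^ Suc (Suc i) * del g) (0 * e - of_nat (Suc i) * d * (lam * z - del z))"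
    unfolding * by (intro has_value_diff has_value_mult t e d dt has_value_const subfield_of_nat[OF E])
  moreover have "0 * e - of_nat (Suc i) * d * (lam * z - del z) \<noteq> 0"
    using d nondeg by (simp del: of_nat_Suc)
  ultimately show ?case unfolding g_def t_def funpow.simps comp_def by blast
qed

lemma dlog_simple_pole_poly:
  assumes z: "z \<in> E" and nondeg: "lam * z \<noteq> del z"
    and P: "P \<in> polys_over E" "P \<noteq> 0" "poly P z = 0"
  shows "\<exists>c. c \<noteq> 0 \<and> has_value z ((x - z) * dlog (poly P x)) c"
proof -
  have X: "[:- z, 1:] \<in> polys_over E" using z by (intro polys_over_linear[OF E] subfield_closed[OF E])
  have deg: "degree [:- z, 1:] > 0" by simp
  have dvd: "\<exists>s\<in>polys_over E. p = [:- z, 1:] * s" if "p \<in> polys_over E" "poly p z = 0" for p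
    using polys_over_split_root[OF E that(1) z that(2)] by blast
  obtain n R where nR: "R \<in> polys_over E" "P = [:- z, 1:] ^ n * R" "poly R z \<noteq> 0"
    using polys_over_split_power[OF E X deg P(1,2) dvd] by blast
  have "n > 0" using nR(2,3) P(3) by (cases n) auto
  have "poly R x \<noteq> 0" "x - z \<noteq> 0"
    using transc[OF nR(1)] nR(3) transc[OF X] by auto
  then have "dlog (poly P x) = of_nat n * dlog (x - z) + dlog (poly R x)"
    unfolding nR(2) by (simp add: poly_power dlog_mult dlog_power)
  then have *: "(x - z) * dlog (poly P x) = of_nat n * del (x - z) + (x - z) * dlog (poly R x)"
    using \<open>x - z \<noteq> 0\<close> by (simp add: dlog_def field_simps)
  obtain e where "has_value z (dlog (poly R x)) e" using regular_dlog_poly nR by (auto simp: regular_def)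
  then have "has_value z ((x - z) * dlog (poly P x)) (of_nat n * (lam * z - del z) + 0 * e)"
    unfolding * by (intro has_value_add has_value_mult has_value_local_parameter[OF z]
        has_value_del_local_parameter[OF z] has_value_const subfield_of_nat[OF E])
  then show ?thesis using \<open>n > 0\<close> nondeg by (intro exI[of _ "of_nat n * (lam * z - del z)"]) simp
qed

text \<open>
  At \<open>z\<close> the right hand side has a pole, because the term with the \<open>j\<close>-th derivative has a pole of higher
  order than the others; at the other points of the orbit it has none.
\<close>

theorem no_telescoping_relation:
  assumes z: "z \<in> E" "z \<noteq> 0" "sg z = z" and nondeg: "lam * z \<noteq> del z"
    and P: "P \<in> polys_over E" "P \<noteq> 0" and Q: "Q \<in> polys_over E" "Q \<noteq> 0"
    and at_z: "poly P z = 0 \<longleftrightarrow> poly Q z \<noteq> 0"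
    and off_z: "\<And>j. j \<noteq> 0 \<Longrightarrow> poly P (q powi j * z) \<noteq> 0 \<and> poly Q (q powi j * z) \<noteq> 0"
    and c: "\<And>i. c i \<in> E" and h: "h \<in> F"
    and tele: "sg h - h = (del ^^ j) (dlog (poly P x / poly Q x))
      - (\<Sum>i<j. c i * (del ^^ i) (dlog (poly P x / poly Q x)))"
  shows False
proof -
  define b where "b = dlog (poly P x / poly Q x)"
  have nz: "poly P x \<noteq> 0" "poly Q x \<noteq> 0" using transc P Q by auto
  have b: "b = dlog (poly P x) - dlog (poly Q x)" unfolding b_def using nz by (rule dlog_divide)
  note t = has_value_local_parameter[OF z(1)]
  have "\<exists>c. c \<noteq> 0 \<and> has_value z ((x - z) * b) c"
  proof (cases "poly P z = 0")
    case True
    obtain c where c: "c \<noteq> 0" "has_value z ((x - z) * dlog (poly P x)) c"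
      using dlog_simple_pole_poly[OF z(1) nondeg P True] by blast
    obtain e where "has_value z (dlog (poly Q x)) e"
      using regular_dlog_poly Q True at_z by (auto simp: regular_def)
    then have "has_value z ((x - z) * dlog (poly P x) - (x - z) * dlog (poly Q x)) (c - 0 * e)"
      by (intro has_value_diff has_value_mult c t)
    then show ?thesis using c by (auto simp: b right_diff_distrib)
  next
    case False
    then have Qz: "poly Q z = 0" using at_z by blast
    obtain c where c: "c \<noteq> 0" "has_value z ((x - z) * dlog (poly Q x)) c"
      using dlog_simple_pole_poly[OF z(1) nondeg Q Qz] by blast
    obtain e where "has_value z (dlog (poly P x)) e"
      using regular_dlog_poly P False by (auto simp: regular_def)
    then have "has_value z ((x - z) * dlog (poly P x) - (x - z) * dlog (poly Q x)) (0 * e - c)"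
      by (intro has_value_diff has_value_mult c t)
    then have "has_value z ((x - z) * b) (- c)" by (simp add: b right_diff_distrib)
    then show ?thesis using c by (intro exI[of _ "- c"]) simp
  qed
  then have "\<forall>i. \<exists>c. c \<noteq> 0 \<and> has_value z ((x - z) ^ Suc i * (del ^^ i) b) c"
    using derivative_pole_order[OF z(1) nondeg] by blast
  then obtain v where v: "\<And>i. v i \<noteq> 0" "\<And>i. has_value z ((x - z) ^ Suc i * (del ^^ i) b) (v i)"
    by metis
  have lower: "has_value z ((x - z) ^ Suc j * (c i * (del ^^ i) b)) 0" if "i < j" for i
  proof -
    have pw: "(x - z) ^ Suc j = (x - z) ^ (j - i) * (x - z) ^ Suc i"
      using that by (simp flip: power_add power_Suc)
    have *: "(x - z) ^ Suc j * (c i * (del ^^ i) b)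
        = (x - z) ^ (j - i) * (c i * ((x - z) ^ Suc i * (del ^^ i) b))"
      by (simp only: pw mult_ac)
    have "has_value z ((x - z) ^ Suc j * (c i * (del ^^ i) b)) (0 ^ (j - i) * (c i * v i))"
      unfolding * by (intro has_value_mult has_value_power t has_value_const c v)
    then show ?thesis using that by (simp add: power_0_left)
  qed
  have "has_value z ((x - z) ^ Suc j * (del ^^ j) b - (\<Sum>i<j. (x - z) ^ Suc j * (c i * (del ^^ i) b)))
      (v j - (\<Sum>i<j. 0))"
    by (intro has_value_diff has_value_sum v lower) simp
  then have val: "has_value z ((x - z) ^ Suc j * (sg h - h)) (v j)"
    unfolding tele b_def[symmetric] by (simp add: right_diff_distrib sum_distrib_left)
  show False
  proof (rule telescoping_not_single_pole[OF z h])
    show "\<not> regular z (sg h - h)"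
    proof
      assume "regular z (sg h - h)"
      then obtain e where "has_value z (sg h - h) e" by (auto simp: regular_def)
      then have "has_value z ((x - z) ^ Suc j * (sg h - h)) (0 ^ Suc j * e)"
        by (intro has_value_mult has_value_power t)
      then show False using has_value_unique[OF val] v(1)[of j] by simp
    qed
  next
    fix l :: int assume "l \<noteq> 0"
    then have "regular (q powi l * z) b"
      unfolding b using off_z P Q by (intro regular_diff regular_dlog_poly) auto
    then show "regular (q powi l * z) (sg h - h)"
      unfolding tele b_def[symmetric]
      by (intro regular_diff regular_funpow_del regular_sum regular_mult regular_const[OF c])
  qed
qed

end

section \<open>The criterion for differential algebraicity\<close>

text \<open>
  The field \<open>C\<close> of constants is algebraically closed, so every nonconstant polynomial over \<open>k\<close> has zeros
  in it, and \<open>nondeg\<close> makes every nonzero point of \<open>C\<close> usable as the centre of a pole.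
\<close>

locale rational_coefficients = orbit_poles sg del E x q lam
  for sg del :: "'a::field_char_0 \<Rightarrow> 'a" and E :: "'a set" and x q lam :: 'a +
  fixes k C :: "'a set"
  assumes k: "is_subfield k" and C: "is_subfield C" and k_C: "k \<subseteq> C" and C_consts: "C \<subseteq> consts_sg"
    and consts_E: "consts_sg \<subseteq> E" and q_k: "q \<in> k" and x_nonzero: "x \<noteq> 0"
    and C_closed: "\<And>p. p \<in> polys_over C \<Longrightarrow> degree p > 0 \<Longrightarrow> \<exists>z\<in>C. poly p z = 0"
    and nondeg: "\<And>z. z \<in> C \<Longrightarrow> z \<noteq> 0 \<Longrightarrow> lam * z \<noteq> del z"
begin

abbreviation "kx \<equiv> subfield_generated (insert x k)"

lemma k_E: "k \<subseteq> E"
  using k_C C_consts consts_E by blast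

lemma polys_k_E: "p \<in> polys_over k \<Longrightarrow> p \<in> polys_over E"
  using polys_over_mono[OF k_E] by blast

lemma poly_x_nonzero: "p \<in> polys_over k \<Longrightarrow> p \<noteq> 0 \<Longrightarrow> poly p x \<noteq> 0"
  using transc polys_k_E by blast

lemma sg_k: "c \<in> k \<Longrightarrow> sg c = c"
  using k_C C_consts by (auto simp: consts_sg_iff)

lemma sg_poly: "p \<in> polys_over k \<Longrightarrow> sg (poly p w) = poly p (sg w)"
  by (simp add: poly_altdef sg_hom sg_k polys_overD)

lemma q_orbit_infinite:
  assumes "z \<noteq> 0" "m > 0" "p \<noteq> 0" "\<And>n::nat. poly p (q ^ (m * n) * z) = 0"
  shows False
proof -
  have inj: "inj (\<lambda>n::nat. q ^ (m * n) * z)"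
  proof (rule injI)
    have *: "i = j" if ij: "i \<le> j" "q ^ (m * i) * z = q ^ (m * j) * z" for i j :: nat
    proof (rule ccontr)
      assume "i \<noteq> j"
      have "m * j = m * i + m * (j - i)" using ij(1) by (simp flip: add_mult_distrib2)
      then have "q ^ (m * j) = q ^ (m * i) * q ^ (m * (j - i))" by (simp only: power_add)
      then have "q ^ (m * (j - i)) = 1" using ij(2) q(3) assms(1) by simp
      then show False using q(4)[of "m * (j - i)"] ij \<open>i \<noteq> j\<close> assms(2) by simp
    qed
    show "i = j" if "q ^ (m * i) * z = q ^ (m * j) * z" for i j
      using *[of i j] *[of j i] that by (cases "i \<le> j") auto
  qed
  have "range (\<lambda>n::nat. q ^ (m * n) * z) \<subseteq> {w. poly p w = 0}" using assms(4) by auto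
  moreover have "finite {w. poly p w = 0}" using assms(3) by (rule poly_roots_finite)
  ultimately have "finite (range (\<lambda>n::nat. q ^ (m * n) * z))" by (rule finite_subset)
  then show False using range_inj_infinite[OF inj] by simp
qed

text \<open>
  The quotient telescopes: \<open>g\<close> is the product of the \<open>H(q\<^sup>i x)\<close> with \<open>i < m\<close>.
\<close>

lemma dilated_quotient:
  assumes "H \<in> polys_over k" "H \<noteq> 0"
  shows "\<exists>g\<in>kx. g \<noteq> 0 \<and> poly H (q ^ m * x) / poly H x = sg g / g"
proof -
  have kx: "is_subfield kx" and x_kx: "x \<in> kx" and k_kx: "k \<subseteq> kx"
    using subfield_generated_subfield subfield_generated_superset[of "insert x k"] by auto
  have in_kx: "poly H (q ^ i * x) \<in> kx" for i
    using polys_over_mono[OF k_kx] assms(1) q_k k_kx x_kx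
    by (intro poly_in_subfield[OF kx] subfield_mult[OF kx] subfield_power[OF kx]) auto
  have sg_H: "sg (poly H (q ^ i * x)) = poly H (q ^ Suc i * x)" for i
    using assms(1) by (simp add: sg_poly sg_hom sg_x q mult_ac)
  have nz: "poly H (q ^ i * x) \<noteq> 0" for i
  proof (induction i)
    case 0
    then show ?case using poly_x_nonzero[OF assms] by simp
  next
    case (Suc i)
    then show ?case unfolding sg_H[symmetric] sg_eq_0_iff .
  qed
  define g where "g = (\<Prod>i<m. poly H (q ^ i * x))"
  have "poly H (q ^ m * x) / poly H x = sg g / g"
  proof -
    have "sg g * poly H x = g * poly H (q ^ m * x)"
      unfolding g_def sg_prod sg_H by (induction m) (simp_all add: mult_ac)
    moreover have "g \<noteq> 0" using nz by (simp add: g_def)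
    ultimately show ?thesis using nz[of 0] by (simp add: field_simps)
  qed
  moreover have "g \<noteq> 0" "g \<in> kx" unfolding g_def using nz in_kx by (auto intro: subfield_prod[OF kx])
  ultimately show ?thesis by blast
qed

text \<open>
  A factor \<open>sg g / g\<close> can be split off so that the remaining zeros and poles lie on distinct
  \<open>q\<close>-orbits: minimal polynomials of points on the same orbit are dilations of each other and can be
  replaced by one another, which decreases the number of zeros and poles.
\<close>

lemma reduce_to_distinct_orbits:
  assumes "A \<in> polys_over k" "B \<in> polys_over k" "poly A 0 \<noteq> 0" "poly B 0 \<noteq> 0"
  shows "\<exists>A'\<in>polys_over k. \<exists>B'\<in>polys_over k. \<exists>g\<in>kx. g \<noteq> 0 \<and> poly A' 0 \<noteq> 0 \<and> poly B' 0 \<noteq> 0 \<and>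
    poly A x / poly B x = sg g / g * (poly A' x / poly B' x) \<and>
    (\<forall>z. \<not> (poly A' z = 0 \<and> poly B' z = 0)) \<and>
    (\<forall>z. \<forall>m>0. \<not> (poly (A' * B') z = 0 \<and> poly (A' * B') (q ^ m * z) = 0))"
  using assms
proof (induction "degree A + degree B + card {z. poly (A * B) z = 0}" arbitrary: A B rule: less_induct)
  case less
  note AB = less.prems
  have nz: "A \<noteq> 0" "B \<noteq> 0" using AB(3,4) by auto
  have kx: "is_subfield kx" by (rule subfield_generated_subfield)
  have fin: "finite {z. poly (A * B) z = 0}" using nz by (intro poly_roots_finite) simp
  consider (common) z where "poly A z = 0" "poly B z = 0"
    | (orbit) z m where "\<forall>z. \<not> (poly A z = 0 \<and> poly B z = 0)"
        "m > 0" "poly (A * B) z = 0" "poly (A * B) (q ^ m * z) = 0"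
    | (distinct) "\<forall>z. \<not> (poly A z = 0 \<and> poly B z = 0)"
        "\<forall>z. \<forall>m>0. \<not> (poly (A * B) z = 0 \<and> poly (A * B) (q ^ m * z) = 0)"
    by blast
  then show ?case
  proof cases
    case common
    then have "algebraic_over k z" using AB nz by (auto simp: algebraic_over_def)
    then obtain H where H: "H \<in> polys_over k" "H \<noteq> 0" "degree H > 0"
      "\<And>p. p \<in> polys_over k \<Longrightarrow> poly p z = 0 \<Longrightarrow> \<exists>s\<in>polys_over k. p = H * s"
      using minimal_polynomial_dvd[OF k] by metis
    obtain A1 where A1: "A1 \<in> polys_over k" "A = H * A1" using H(4) AB common by blast
    obtain B1 where B1: "B1 \<in> polys_over k" "B = H * B1" using H(4) AB common by blast
    have "degree A = degree H + degree A1" "degree B = degree H + degree B1"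
      using nz unfolding A1(2) B1(2) by (auto intro!: degree_mult_eq)
    moreover have "card {z. poly (A1 * B1) z = 0} \<le> card {z. poly (A * B) z = 0}"
      by (rule card_mono[OF fin]) (auto simp: A1 B1)
    ultimately have "degree A1 + degree B1 + card {z. poly (A1 * B1) z = 0}
      < degree A + degree B + card {z. poly (A * B) z = 0}" using H(3) by linarith
    moreover have "poly A x / poly B x = poly A1 x / poly B1 x"
      using poly_x_nonzero[OF H(1,2)] by (simp add: A1 B1)
    moreover have "poly A1 0 \<noteq> 0" "poly B1 0 \<noteq> 0" using AB A1 B1 by auto
    ultimately show ?thesis using less.hyps[of A1 B1] A1(1) B1(1) by simp
  next
    case orbit
    \<comment> \<open>\<open>G(x) = H(q\<^sup>m x)\<close> is, up to a constant, the minimal polynomial of \<open>z\<close>, so its zeros are already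
      among those of \<open>A B\<close>; replacing \<open>H\<close> by \<open>G\<close> removes the zero \<open>w\<close> and adds none.\<close>
    define w where "w = q ^ m * z"
    have z0: "z \<noteq> 0" using orbit(3) AB by auto
    have "algebraic_over k w"
      using orbit(4) AB nz polys_over_mult[OF k, of A B] unfolding algebraic_over_def w_def
      by (intro bexI[of _ "A * B"]) auto
    then obtain H where H: "H \<in> polys_over k" "H \<noteq> 0" "degree H > 0" "poly H w = 0"
      "\<And>p. p \<in> polys_over k \<Longrightarrow> poly p w = 0 \<Longrightarrow> \<exists>s\<in>polys_over k. p = H * s"
      using minimal_polynomial_dvd[OF k] by metis
    have H0: "poly H 0 \<noteq> 0"
    proof -
      have "poly A w = 0 \<or> poly B w = 0" using orbit(4) by (simp add: w_def)
      then obtain s where "A = H * s \<or> B = H * s" using H(5) AB by blast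
      then show ?thesis using AB by auto
    qed
    have lin: "[:0, c:] \<in> polys_over k" if "c \<in> k" for c
      using that by (intro polys_over_linear[OF k] subfield_zero[OF k])
    have qm: "q ^ m \<in> k" "inverse (q ^ m) \<in> k" "q ^ m \<noteq> 0"
      using q_k q by (auto intro: subfield_closed[OF k])
    define G where "G = pcompose H [:0, q ^ m:]"
    have G: "G \<in> polys_over k" unfolding G_def by (intro polys_over_pcompose[OF k] H lin qm)
    have polyG: "poly G v = poly H (q ^ m * v)" for v by (simp add: G_def poly_pcompose mult.commute)
    have dG: "degree G = degree H" using qm(3) by (simp add: G_def degree_pcompose del: power_eq_0_iff)
    have "G \<noteq> 0" using H0 polyG[of 0] by auto
    have rootsG: "poly (A * B) v = 0" if "poly G v = 0" for v
    proof -
      have *: "poly p v = 0" if p: "p \<in> polys_over k" "poly p z = 0" for p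
      proof -
        define r where "r = pcompose p [:0, inverse (q ^ m):]"
        have "r \<in> polys_over k" unfolding r_def by (intro polys_over_pcompose[OF k] p lin qm)
        moreover have "w * inverse (q ^ m) = z" using qm(3) by (simp add: w_def)
        then have "poly r w = 0" using p by (simp add: r_def poly_pcompose)
        ultimately obtain s where "r = H * s" using H(5) by blast
        then have "poly r (q ^ m * v) = 0" using \<open>poly G v = 0\<close> by (simp add: polyG)
        moreover have "q ^ m * v * inverse (q ^ m) = v" using qm(3) by simp
        ultimately show ?thesis by (simp add: r_def poly_pcompose)
      qed
      show ?thesis using orbit(3) *[OF AB(1)] *[OF AB(2)] by auto
    qed
    \<comment> \<open>otherwise the finite set of zeros of \<open>H\<close> would be stable under multiplication by \<open>q\<^sup>m\<close>\<close>
    have Gw: "poly G w \<noteq> 0"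
    proof
      assume "poly G w = 0"
      then obtain s where s: "G = H * s" using H(5) G by blast
      have "poly H (q ^ (m * n) * w) = 0" for n
      proof (induction n)
        case 0
        show ?case using H by simp
      next
        case (Suc n)
        then have "poly G (q ^ (m * n) * w) = 0" by (simp add: s)
        then show ?case by (simp add: polyG power_add mult_ac)
      qed
      then show False using q_orbit_infinite[of w m H] z0 qm orbit(2) H(2) by (simp add: w_def)
    qed
    obtain e A1 where A1: "A1 \<in> polys_over k" "A = H ^ e * A1" "poly A1 w \<noteq> 0"
      using polys_over_split_power[OF k H(1,3) AB(1) nz(1) H(5)] by blast
    obtain f B1 where B1: "B1 \<in> polys_over k" "B = H ^ f * B1" "poly B1 w \<noteq> 0"
      using polys_over_split_power[OF k H(1,3) AB(2) nz(2) H(5)] by blast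
    define A2 B2 where "A2 = G ^ e * A1" and "B2 = G ^ f * B1"
    have A2: "A2 \<in> polys_over k" "poly A2 0 \<noteq> 0" and B2: "B2 \<in> polys_over k" "poly B2 0 \<noteq> 0"
      using AB(3,4) A1 B1 H0 by (auto simp: A2_def B2_def polyG intro!: polys_over_mult[OF k] polys_over_power[OF k] G)
    have "degree A2 = degree A" "degree B2 = degree B"
      unfolding A1(2) B1(2) A2_def B2_def using A1(3) B1(3) H(2) \<open>G \<noteq> 0\<close>
      by (subst (1 2) degree_mult_eq; auto simp: degree_power_eq dG)+
    moreover have "card {v. poly (A2 * B2) v = 0} < card {v. poly (A * B) v = 0}"
    proof (rule psubset_card_mono[OF fin])
      have "{v. poly (A2 * B2) v = 0} \<subseteq> {v. poly (A * B) v = 0}"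
        using rootsG by (auto simp: A2_def B2_def A1(2) B1(2) poly_power)
      moreover have "w \<in> {v. poly (A * B) v = 0}" using orbit(4) by (simp add: w_def)
      moreover have "w \<notin> {v. poly (A2 * B2) v = 0}"
        using Gw A1(3) B1(3) by (simp add: A2_def B2_def poly_power)
      ultimately show "{v. poly (A2 * B2) v = 0} \<subset> {v. poly (A * B) v = 0}" by blast
    qed
    ultimately have "degree A2 + degree B2 + card {z. poly (A2 * B2) z = 0}
      < degree A + degree B + card {z. poly (A * B) z = 0}" by linarith
    then obtain A' B' g where IH: "A' \<in> polys_over k" "B' \<in> polys_over k" "g \<in> kx" "g \<noteq> 0"
      "poly A' 0 \<noteq> 0" "poly B' 0 \<noteq> 0" "poly A2 x / poly B2 x = sg g / g * (poly A' x / poly B' x)"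
      "\<forall>z. \<not> (poly A' z = 0 \<and> poly B' z = 0)"
      "\<forall>z. \<forall>m>0. \<not> (poly (A' * B') z = 0 \<and> poly (A' * B') (q ^ m * z) = 0)"
      using less.hyps[of A2 B2] A2 B2 by blast
    obtain p where p: "p \<in> kx" "p \<noteq> 0" "poly H (q ^ m * x) / poly H x = sg p / p"
      using dilated_quotient[OF H(1,2)] by blast
    define g0 where "g0 = p ^ f / p ^ e"
    have g0: "g0 \<in> kx" "g0 \<noteq> 0" using p by (auto simp: g0_def intro!: subfield_closed[OF kx])
    have "B1 \<noteq> 0" using B1(3) by auto
    then have nzx: "poly H x \<noteq> 0" "poly G x \<noteq> 0" "poly B1 x \<noteq> 0"
      using poly_x_nonzero[OF H(1,2)] poly_x_nonzero[OF G \<open>G \<noteq> 0\<close>] poly_x_nonzero[OF B1(1)]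
      by auto
    have "sg g0 / g0 = (sg p / p) ^ f / (sg p / p) ^ e"
      by (simp add: g0_def sg_hom power_divide)
    also have "sg p / p = poly G x / poly H x" using p(3) by (simp add: polyG)
    finally have "poly A x / poly B x = sg g0 / g0 * (poly A2 x / poly B2 x)"
      using nzx by (simp add: A1(2) B1(2) A2_def B2_def poly_power power_divide)
    then have "poly A x / poly B x = sg (g0 * g) / (g0 * g) * (poly A' x / poly B' x)"
      unfolding IH(7) by (simp add: sg_mult mult.assoc)
    moreover have "g0 * g \<in> kx" "g0 * g \<noteq> 0" using g0 IH by (auto intro: subfield_mult[OF kx])
    ultimately show ?thesis using IH(1,2,5,6,8,9) by blast
  next
    case distinct
    then show ?thesis using AB
      by (intro bexI[of _ A] bexI[of _ B] bexI[of _ 1]) (auto simp: sg_1 subfield_one[OF kx])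
  qed
qed

lemma F_stable: "sg ` F \<subseteq> F" "del ` F \<subseteq> F" "E \<subseteq> F" "x \<in> F"
proof -
  have F: "is_subfield F" and sup: "insert x E \<subseteq> F"
    using subfield_generated_subfield subfield_generated_superset[of "insert x E"] by auto
  then show "E \<subseteq> F" "x \<in> F" by auto
  have "sg x \<in> F" "del x \<in> F"
    unfolding sg_x del_x using sup q lam by (auto intro!: subfield_mult[OF F])
  then have "sg ` insert x E \<subseteq> F" "del ` insert x E \<subseteq> F" using sg_E del_E sup by auto
  then show "sg ` F \<subseteq> F" "del ` F \<subseteq> F"
    by (simp_all only: generated_stable generated_del_stable)
qed

text \<open>
  After the reduction to distinct orbits, a zero or pole of the remaining quotient \<open>A' / B'\<close> outside
  the origin is alone on its orbit and contradicts the telescoping relation for \<open>dlog a\<close>.  The factor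
  \<open>sg g / g\<close> itself contributes a telescoping term, which is moved into \<open>h\<close>.
\<close>

theorem differentially_algebraic_imp_standard_form:
  assumes a: "a \<in> kx" "a \<noteq> 0" and u: "u \<noteq> 0" "sg u = a * u"
    and rel: "satisfies_alg_relation del F u"
  shows "\<exists>r::int. \<exists>g\<in>kx. \<exists>\<mu>\<in>k. g \<noteq> 0 \<and> a = \<mu> * x powi r * (sg g / g)"
proof -
  have kx: "is_subfield kx" by (rule subfield_generated_subfield)
  have F: "is_subfield F" by (rule subfield_generated_subfield)
  have kx_F: "kx \<subseteq> F" using k_E by (intro subfield_generated_mono) auto
  obtain P Q where PQ: "P \<in> polys_over k" "Q \<in> polys_over k" "poly Q x \<noteq> 0" "a = poly P x / poly Q x"
    using subfield_generated_insertE[OF k a(1)] by blast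
  have PQ0: "P \<noteq> 0" "Q \<noteq> 0" using PQ a by auto
  have X: "[:0, 1:] \<in> polys_over k" by (intro polys_over_linear[OF k] subfield_closed[OF k])
  have dvdX: "\<exists>s\<in>polys_over k. p = [:0, 1:] * s" if "p \<in> polys_over k" "poly p 0 = 0" for p
    using polys_over_split_root[OF k that(1) subfield_zero[OF k] that(2)] by fastforce
  have degX: "degree [:0, 1 :: 'a:] > 0" by simp
  obtain i A where A: "A \<in> polys_over k" "P = [:0, 1:] ^ i * A" "poly A 0 \<noteq> 0"
    using polys_over_split_power[OF k X degX PQ(1) PQ0(1) dvdX] by blast
  obtain j B where B: "B \<in> polys_over k" "Q = [:0, 1:] ^ j * B" "poly B 0 \<noteq> 0"
    using polys_over_split_power[OF k X degX PQ(2) PQ0(2) dvdX] by blast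
  obtain A' B' g where red: "A' \<in> polys_over k" "B' \<in> polys_over k" "g \<in> kx" "g \<noteq> 0"
    "poly A' 0 \<noteq> 0" "poly B' 0 \<noteq> 0" "poly A x / poly B x = sg g / g * (poly A' x / poly B' x)"
    "\<forall>z. \<not> (poly A' z = 0 \<and> poly B' z = 0)"
    "\<forall>z. \<forall>m>0. \<not> (poly (A' * B') z = 0 \<and> poly (A' * B') (q ^ m * z) = 0)"
    using reduce_to_distinct_orbits[OF A(1) B(1) A(3) B(3)] by blast
  define P' Q' where "P' = [:0, 1:] ^ i * A'" and "Q' = [:0, 1:] ^ j * B'"
  have P': "P' \<in> polys_over k" and Q': "Q' \<in> polys_over k"
    unfolding P'_def Q'_def by (intro polys_over_mult[OF k] polys_over_power[OF k] X red)+
  have "A' \<noteq> 0" "B' \<noteq> 0" using red by auto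
  then have PQ'0: "P' \<noteq> 0" "Q' \<noteq> 0" by (auto simp: P'_def Q'_def)
  have a_eq: "a = sg g / g * (poly P' x / poly Q' x)"
  proof -
    have "a = x ^ i / x ^ j * (poly A x / poly B x)"
      unfolding PQ(4) A(2) B(2) by (simp add: poly_power)
    also have "\<dots> = sg g / g * (poly P' x / poly Q' x)"
      unfolding red(7) by (simp add: P'_def Q'_def poly_power mult_ac)
    finally show ?thesis .
  qed
  have "degree (A' * B') = 0"
  proof (rule ccontr)
    assume "degree (A' * B') \<noteq> 0"
    moreover have "A' * B' \<in> polys_over C"
      using polys_over_mult[OF k red(1,2)] polys_over_mono[OF k_C] by blast
    ultimately obtain z where z: "z \<in> C" "poly (A' * B') z = 0" using C_closed by blast
    have z0: "z \<noteq> 0" using z red by auto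
    have zE: "z \<in> E" "sg z = z" using z C_consts consts_E by (auto simp: consts_sg_iff)
    have off: "poly (A' * B') (q powi l * z) \<noteq> 0" if "l \<noteq> 0" for l
    proof
      assume l: "poly (A' * B') (q powi l * z) = 0"
      show False
      proof (cases "l > 0")
        case True
        then have "q powi l = q ^ nat l" by (simp add: power_int_def)
        then show False using red(9) z(2) l True by (metis zero_less_nat_eq)
      next
        case False
        then have "q ^ nat (- l) * (q powi l * z) = z"
          using q by (simp add: power_int_def power_inverse)
        moreover have "nat (- l) > 0" using False that by simp
        ultimately show False using red(9) z(2) l by metis
      qed
    qed
    interpret M: multiplicative_solution sg del F a u
    proof
      show "is_subfield F" by (rule F)
      show "sg ` F \<subseteq> F" "del ` F \<subseteq> F" by (rule F_stable)+
      show "consts_sg \<subseteq> F" using consts_E F_stable(3) by blast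
      show "a \<in> F" using a kx_F by blast
      show "sg u = a * u" "u \<noteq> 0" by (rule u)+
    qed
    obtain n c h where "\<forall>i. c i \<in> consts_sg" and tele': "h \<in> F" "sg h - h = M.b n - (\<Sum>i<n. c i * M.b i)"
      using M.telescoping_relation[OF rel] by (elim exE conjE)
    then have tele: "\<And>i. c i \<in> consts_sg" "h \<in> F" "sg h - h = M.b n - (\<Sum>i<n. c i * M.b i)"
      by simp_all
    define b' where "b' = (\<lambda>n. (del ^^ n) (dlog (poly P' x / poly Q' x)))"
    define \<gamma> where "\<gamma> = (\<lambda>n. (del ^^ n) (dlog g))"
    have nzs: "sg g / g \<noteq> 0" "poly P' x / poly Q' x \<noteq> 0"
      using red(4) sg_eq_0_iff poly_x_nonzero P' Q' PQ'0 by auto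
    have "dlog (sg g / g) = sg (dlog g) - dlog g"
      using red(4) sg_eq_0_iff[of g] by (simp add: dlog_divide dlog_sg)
    then have "dlog a = sg (dlog g) - dlog g + dlog (poly P' x / poly Q' x)"
      unfolding a_eq dlog_mult[OF nzs] by simp
    then have b: "M.b n = sg (\<gamma> n) - \<gamma> n + b' n" for n
      by (simp add: M.b_def b'_def \<gamma>_def funpow_del_add funpow_del_diff funpow_del_sg)
    have \<gamma>F: "\<gamma> n \<in> F" for n
    proof -
      have "g \<in> F" using red(3) kx_F by blast
      then have "dlog g \<in> F"
        unfolding dlog_def using F_stable(2) by (intro subfield_divide[OF F]) auto
      then show ?thesis unfolding \<gamma>_def using F_stable(2) by (induction n) auto
    qed
    define h' where "h' = h - \<gamma> n + (\<Sum>i<n. c i * \<gamma> i)"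
    show False
    proof (rule no_telescoping_relation[OF zE(1) z0 zE(2) nondeg[OF z(1) z0] polys_k_E[OF P'] PQ'0(1)
          polys_k_E[OF Q'] PQ'0(2)])
      show "poly P' z = 0 \<longleftrightarrow> poly Q' z \<noteq> 0"
        using z red(8) z0 by (auto simp: P'_def Q'_def poly_power)
      show "poly P' (q powi l * z) \<noteq> 0 \<and> poly Q' (q powi l * z) \<noteq> 0" if "l \<noteq> 0" for l
        using off[OF that] z0 q by (auto simp: P'_def Q'_def poly_power)
      show "c i \<in> E" for i using tele(1) consts_E by blast
      show "h' \<in> F"
        unfolding h'_def using tele \<gamma>F consts_E F_stable(3)
        by (intro subfield_add[OF F] subfield_diff[OF F] subfield_sum[OF F] subfield_mult[OF F]) auto
      have "sg h' - h' = (sg h - h) - (sg (\<gamma> n) - \<gamma> n) + (\<Sum>i<n. c i * (sg (\<gamma> i) - \<gamma> i))"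
        using tele(1) by (simp add: h'_def sg_hom consts_sg_iff right_diff_distrib sum_subtractf)
      also have "\<dots> = b' n - (\<Sum>i<n. c i * b' i)"
        unfolding tele(3) b by (simp add: algebra_simps sum.distrib sum_subtractf)
      finally show "sg h' - h' = (del ^^ n) (dlog (poly P' x / poly Q' x))
          - (\<Sum>i<n. c i * (del ^^ i) (dlog (poly P' x / poly Q' x)))"
        by (simp add: b'_def)
    qed
  qed
  then have "degree A' = 0" "degree B' = 0"
    using \<open>A' \<noteq> 0\<close> \<open>B' \<noteq> 0\<close> by (auto simp: degree_mult_eq)
  then obtain \<alpha> \<beta> where \<alpha>\<beta>: "A' = [:\<alpha>:]" "B' = [:\<beta>:]" by (metis degree_eq_zeroE)
  have "\<alpha> \<in> k" "\<beta> \<in> k" using red(1,2) by (auto simp: \<alpha>\<beta> polys_over_pCons_iff[OF k])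
  then have "\<alpha> / \<beta> \<in> k" by (intro subfield_divide[OF k])
  moreover have "a = \<alpha> / \<beta> * x powi (int i - int j) * (sg g / g)"
    unfolding a_eq using x_nonzero by (simp add: P'_def Q'_def \<alpha>\<beta> poly_power power_int_diff mult_ac)
  ultimately show ?thesis using red(3,4) by blast
qed

end

section \<open>Operators on meromorphic functions\<close>

lemma monom_an_add: "monom_an (c + d) m = monom_an c m + monom_an d m"
  by transfer auto

lemma monom_an_0: "monom_an 0 m = 0"
  by transfer auto

lemma monom_an_mult: "monom_an c m * monom_an d n = monom_an (c * d) (m + n)"
  by (rule cstar_analytic_eqI) (auto simp: coeff_monom_times monom_an.rep_eq)

lemma of_nat_an: "of_nat n = monom_an (of_nat n) 0"
  by (induction n) (auto simp: monom_an_0 monom_an_add one_cstar_analytic_def)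

lemma monom_an_eq_0_iff: "monom_an c m = 0 \<longleftrightarrow> c = 0"
proof
  assume "monom_an c m = 0"
  then have "coeff_an (monom_an c m) m = coeff_an 0 m" by simp
  then show "c = 0" by (simp add: monom_an.rep_eq zero_cstar_analytic.rep_eq)
qed (simp add: monom_an_0)

instance cstar_analytic :: ("{complete_nonarch_field, field_char_0}") ring_char_0
proof
  show "inj (of_nat :: nat \<Rightarrow> 'a cstar_analytic)"
  proof (rule injI)
    fix m n assume "(of_nat m :: 'a cstar_analytic) = of_nat n"
    then have "coeff_an (of_nat m :: 'a cstar_analytic) 0 = coeff_an (of_nat n) 0" by simp
    then show "m = n" by (simp add: of_nat_an monom_an.rep_eq)
  qed
qed

instance fract :: ("{idom, ring_char_0}") field_char_0
proof
  show "inj (of_nat :: nat \<Rightarrow> 'a fract)"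
    by (rule injI) (simp add: of_nat_fract eq_fract)
qed

lemma fract_quotient_cases:
  obtains f g where "g \<noteq> 0" "z = to_fract f / to_fract g"
  by (cases z) (metis Fract_conv_to_fract)

lemma derivation_fract_deriv:
  assumes D: "derivation D"
  shows "derivation (fract_deriv D)"
  unfolding derivation_def
proof (intro allI conjI)
  have D_add: "D (f + g) = D f + D g" and D_mult: "D (f * g) = D f * g + f * D g" for f g
    using D by (auto simp: derivation_def)
  fix y z :: "'a fract"
  obtain f g where y: "y = Fract f g" "g \<noteq> 0" by (cases y) auto
  obtain h k where z: "z = Fract h k" "k \<noteq> 0" by (cases z) auto
  show "fract_deriv D (y + z) = fract_deriv D y + fract_deriv D z"
    using y(2) z(2) unfolding y(1) z(1)
    by (simp add: fract_deriv_Fract[OF D] eq_fract D_add D_mult) (simp add: algebra_simps)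
  show "fract_deriv D (y * z) = fract_deriv D y * z + y * fract_deriv D z"
    using y(2) z(2) unfolding y(1) z(1)
    by (simp add: fract_deriv_Fract[OF D] eq_fract D_add D_mult) (simp add: algebra_simps)
qed

lemma derivation_one: "derivation D \<Longrightarrow> D 1 = 0"
  unfolding derivation_def by (metis add_cancel_right_right mult.right_neutral mult_1)

lemma fract_deriv_to_fract:
  assumes "derivation D"
  shows "fract_deriv D (to_fract f) = to_fract (D f)"
  using fract_deriv_Fract[OF assms, of 1 f] derivation_one[OF assms] by (simp add: to_fract_def)

text \<open>Both sides of the commutation rule obey the quotient rule.\<close>

lemma derivation_twist_fract:
  fixes s :: "'a::{idom, ring_char_0} fract \<Rightarrow> 'a fract"
  assumes "difference_field s" "derivation d1" "derivation d2"
    and ring: "\<And>f. d1 (s (to_fract f)) = s (d2 (to_fract f))"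
  shows "d1 (s z) = s (d2 z)"
proof -
  interpret s: difference_field s by fact
  interpret d1: field_derivation d1 by standard fact
  interpret d2: field_derivation d2 by standard fact
  obtain f g where "z = to_fract f / to_fract g" using fract_quotient_cases by metis
  then show ?thesis by (simp add: d1.del_divide d2.del_divide s.sg_hom ring)
qed

lemma sigma_an_plus: "sigma_an q (f + g) = sigma_an q f + sigma_an q g"
  by transfer (simp add: distrib_right)

lemma sigma_an_monom: "sigma_an q (monom_an c m) = monom_an (c * q powi m) m"
  by transfer auto

lemma sigma_an_1: "sigma_an q 1 = 1"
  by (simp add: one_cstar_analytic_def sigma_an_monom)

lemma sigma_mero_to_fract: "q \<noteq> 0 \<Longrightarrow> sigma_mero q (to_fract f) = to_fract (sigma_an q f)"
  using sigma_mero_Fract[of q 1 f] by (simp add: to_fract_def sigma_an_1)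

lemma difference_field_sigma_mero:
  fixes q :: "'c::{complete_nonarch_field, field_char_0}"
  assumes "q \<noteq> 0"
  shows "difference_field (sigma_mero q)"
proof
  fix y z :: "'c cstar_mero"
  obtain f g where y: "y = Fract f g" "g \<noteq> 0" by (cases y) auto
  obtain h k where z: "z = Fract h k" "k \<noteq> 0" by (cases z) auto
  show "sigma_mero q (y + z) = sigma_mero q y + sigma_mero q z"
    "sigma_mero q (y * z) = sigma_mero q y * sigma_mero q z"
    using y(2) z(2) assms unfolding y(1) z(1)
    by (simp_all add: sigma_mero_Fract sigma_an_eq_0 sigma_an_plus sigma_an_times)
  show "sigma_mero q 1 = 1" using sigma_mero_to_fract[OF assms, of 1] by (simp add: sigma_an_1)
qed

lemma derivation_delta_x: "derivation delta_x"
  unfolding delta_x_def by (rule derivation_fract_deriv[OF derivation_delta_x_an])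

lemma delta_x_to_fract: "delta_x (to_fract f) = to_fract (delta_x_an f)"
  unfolding delta_x_def by (rule fract_deriv_to_fract[OF derivation_delta_x_an])

lemma derivation_coeffwise_an:
  fixes D :: "'c::complete_nonarch_field \<Rightarrow> 'c"
  assumes D: "derivation D" and B: "\<And>c. absv (D c) \<le> B * absv c" and cont: "continuous_on UNIV D"
  shows "derivation (coeffwise_an D)"
  unfolding derivation_def
proof (intro allI conjI)
  have D_add: "D (x + y) = D x + D y" and D_mult: "D (x * y) = D x * y + x * D y" for x y
    using D by (auto simp: derivation_def)
  fix f g :: "'c cstar_analytic"
  note co = coeff_coeffwise_an[OF B]
  show "coeffwise_an D (f + g) = coeffwise_an D f + coeffwise_an D g"
    by (rule cstar_analytic_eqI) (simp add: co plus_cstar_analytic.rep_eq D_add)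
  show "coeffwise_an D (f * g) = coeffwise_an D f * g + f * coeffwise_an D g"
  proof (rule cstar_analytic_eqI)
    fix n
    define t where "t = (\<lambda>i. coeff_an f i * coeff_an g (n - i))"
    have t: "t summable_on UNIV" unfolding t_def by (rule conv_summable)
    have sum: "D (sum t A) = sum (D \<circ> t) A" for A
      using derivation_0[OF D] by (induction A rule: infinite_finite_induct) (auto simp: D_add)
    have "((D \<circ> t) has_sum D (infsum t UNIV)) UNIV"
    proof (rule has_sum_comm_additive_general)
      show "D \<midarrow>infsum t UNIV\<rightarrow> D (infsum t UNIV)"
        using cont by (simp add: continuous_on_def)
      show "(t has_sum infsum t UNIV) UNIV" using t by simp
    qed (simp add: sum)
    then have "D (infsum t UNIV) = infsum (D \<circ> t) UNIV" by (rule infsumI[symmetric])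
    also have "\<dots> = (\<Sum>\<^sub>\<infinity>i. coeff_an (coeffwise_an D f) i * coeff_an g (n - i)
        + coeff_an f i * coeff_an (coeffwise_an D g) (n - i))"
      by (rule infsum_cong) (simp add: t_def D_mult co)
    also have "\<dots> = coeff_an (coeffwise_an D f * g + f * coeffwise_an D g) n"
      using infsum_add[OF conv_summable[of "coeffwise_an D f" g n] conv_summable[of f "coeffwise_an D g" n]]
      by (simp add: times_cstar_analytic.rep_eq plus_cstar_analytic.rep_eq)
    finally show "coeff_an (coeffwise_an D (f * g)) n = coeff_an (coeffwise_an D f * g + f * coeffwise_an D g) n"
      by (simp add: co t_def times_cstar_analytic.rep_eq)
  qed
qed

lemma const_mero_hom:
  "const_mero (c + d) = const_mero c + const_mero d"
  "const_mero (c * d) = const_mero c * const_mero d"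
  "const_mero 0 = 0" "const_mero 1 = 1"
  by (simp_all add: const_mero_def monom_an_add monom_an_mult monom_an_0 flip: to_fract_add to_fract_mult one_cstar_analytic_def)

lemma const_mero_eq_0_iff: "const_mero c = 0 \<longleftrightarrow> c = 0"
  by (simp add: const_mero_def monom_an_eq_0_iff)

lemma const_mero_uminus: "const_mero (- c) = - const_mero c"
  using const_mero_hom(1)[of c "- c"] by (simp add: const_mero_hom(3) eq_neg_iff_add_eq_0 add.commute)

lemma const_mero_diff: "const_mero (c - d) = const_mero c - const_mero d"
  using const_mero_hom(1)[of c "- d"] by (simp add: const_mero_uminus)

lemma const_mero_eq_iff: "const_mero c = const_mero d \<longleftrightarrow> c = d"
  using const_mero_eq_0_iff[of "c - d"] by (simp add: const_mero_diff)

lemma const_mero_inverse: "const_mero (inverse c) = inverse (const_mero c)"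
proof (cases "c = 0")
  case False
  then have "const_mero c * const_mero (inverse c) = 1" by (simp flip: const_mero_hom(2) add: const_mero_hom(4))
  then show ?thesis by (metis inverse_unique)
qed (simp add: const_mero_hom)

lemma const_mero_divide: "const_mero (c / d) = const_mero c / const_mero d"
  by (simp add: divide_inverse const_mero_hom const_mero_inverse)

lemma const_mero_image_subfield:
  assumes "is_subfield k"
  shows "is_subfield (const_mero ` k)"
  unfolding is_subfield_def
proof (intro conjI ballI)
  show "1 \<in> const_mero ` k" using subfield_one[OF assms] const_mero_hom(4) by (metis imageI)
  fix x y assume "x \<in> const_mero ` k" "y \<in> const_mero ` k"
  then obtain c d where *: "c \<in> k" "d \<in> k" "x = const_mero c" "y = const_mero d" by auto
  show "x - y \<in> const_mero ` k" "x * y \<in> const_mero ` k" "x / y \<in> const_mero ` k"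
    using *(1,2) subfield_closed[OF assms] unfolding *(3,4)
    by (auto simp flip: const_mero_diff const_mero_hom const_mero_divide)
qed

lemma const_mero_image_generated:
  "const_mero ` subfield_generated S = subfield_generated (const_mero ` S)"
proof
  have "is_subfield {c. const_mero c \<in> subfield_generated (const_mero ` S)}"
    using subfield_generated_subfield[of "const_mero ` S"]
    by (auto simp: is_subfield_def const_mero_hom const_mero_diff const_mero_divide)
  moreover have "S \<subseteq> {c. const_mero c \<in> subfield_generated (const_mero ` S)}"
    using subfield_generated_superset[of "const_mero ` S"] by auto
  ultimately show "const_mero ` subfield_generated S \<subseteq> subfield_generated (const_mero ` S)"
    using subfield_generated_least by blast
  show "subfield_generated (const_mero ` S) \<subseteq> const_mero ` subfield_generated S"
    using subfield_generated_superset
    by (intro subfield_generated_least const_mero_image_subfield subfield_generated_subfield image_mono)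
qed

lemma const_mero_root:
  fixes p :: "'c::{complete_nonarch_field, alg_closed_field} cstar_mero poly"
  assumes p: "p \<in> polys_over (range const_mero)" "degree p > 0"
  shows "\<exists>z\<in>range const_mero. poly p z = 0"
proof -
  have "\<forall>i. \<exists>c. coeff p i = const_mero c" using p(1) by (auto simp: polys_over_def)
  then obtain f where f: "\<And>i. coeff p i = const_mero (f i)" by metis
  have "f (degree p) \<noteq> 0"
  proof
    assume "f (degree p) = 0"
    then have "lead_coeff p = 0" by (simp add: f const_mero_hom)
    then show False using p(2) by simp
  qed
  then obtain z where z: "(\<Sum>i\<le>degree p. f i * z ^ i) = 0" using alg_closed p(2) by blast
  have pow: "const_mero (z ^ n) = const_mero z ^ n" for n
    by (induction n) (auto simp: const_mero_hom)
  have sum: "const_mero (sum h A) = (\<Sum>i\<in>A. const_mero (h i))" for h :: "nat \<Rightarrow> 'c" and A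
    by (induction A rule: infinite_finite_induct) (auto simp: const_mero_hom)
  have "poly p (const_mero z) = const_mero (\<Sum>i\<le>degree p. f i * z ^ i)"
    by (simp add: poly_altdef f sum pow const_mero_hom)
  then have "poly p (const_mero z) = 0" by (simp add: z const_mero_hom)
  then show ?thesis by blast
qed

text \<open>
  The condition \<open>D q = q\<close> normalises \<open>D\<close> as an extension of \<open>q d/dq\<close>.
\<close>

locale tate_dilation =
  fixes q :: "'c::{complete_nonarch_field, alg_closed_field, field_char_0}" and D :: "'c \<Rightarrow> 'c"
  assumes q: "absv q > 1" and D: "derivation D" and D_cont: "continuous_on UNIV D" and Dq: "D q = q"
begin

lemma q0: "q \<noteq> 0"
  using q by auto

abbreviation sg :: "'c cstar_mero \<Rightarrow> 'c cstar_mero" where "sg \<equiv> sigma_mero q"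
abbreviation x :: "'c cstar_mero" where "x \<equiv> x_mero"
abbreviation l :: "'c cstar_mero" where "l \<equiv> ell q"

sublocale difference_field "sigma_mero q"
  by (rule difference_field_sigma_mero[OF q0])

lemma elliptic_eq_consts: "elliptic_functions q = consts_sg"
  by (simp add: elliptic_functions_def consts_sg_def)

lemma q_power_neq_1: "n > 0 \<Longrightarrow> const_mero q ^ n \<noteq> 1"
proof
  assume n: "n > 0" and "const_mero q ^ n = 1"
  moreover have "const_mero (q ^ n) = const_mero q ^ n" by (induction n) (auto simp: const_mero_hom)
  ultimately have "q ^ n = 1" by (metis const_mero_eq_iff const_mero_hom(4))
  then have "absv q ^ n = 1" by (metis absv_1 absv_power)
  then show False using one_less_power[OF q n] by simp
qed

lemma sg_const: "sg (const_mero c) = const_mero c"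
  by (simp add: const_mero_def sigma_mero_to_fract q0 sigma_an_monom)

lemma sg_x: "sg x = const_mero q * x"
  by (simp add: x_mero_def const_mero_def sigma_mero_to_fract q0 sigma_an_monom monom_an_mult flip: to_fract_mult)

lemma x_nonzero: "x \<noteq> 0"
  by (simp add: x_mero_def monom_an_eq_0_iff)

lemma const_mero_subset_consts: "range const_mero \<subseteq> consts_sg"
  by (auto simp: consts_sg_iff sg_const)

sublocale dx: difference_differential_field "sigma_mero q" delta_x
proof
  show "derivation (delta_x :: 'c cstar_mero \<Rightarrow> _)" by (rule derivation_delta_x)
  have "delta_x_an (sigma_an q f) = sigma_an q (delta_x_an f)" for f
    by transfer (simp add: mult.assoc)
  then have "delta_x (sg (to_fract f)) = sg (delta_x (to_fract f))" for f
    by (simp add: sigma_mero_to_fract q0 delta_x_to_fract)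
  then show "delta_x (sg z) = sg (delta_x z)" for z
    by (rule derivation_twist_fract[OF difference_field_sigma_mero[OF q0] derivation_delta_x derivation_delta_x])
qed

lemma delta_x_const: "delta_x (const_mero c) = 0"
proof -
  have "delta_x_an (monom_an c 0) = 0" by transfer auto
  then show ?thesis by (simp add: const_mero_def delta_x_to_fract)
qed

lemma delta_x_x: "delta_x x = x"
proof -
  have "delta_x_an (monom_an 1 1) = (monom_an 1 1 :: 'c cstar_analytic)" by transfer auto
  then show ?thesis by (simp add: x_mero_def delta_x_to_fract)
qed

lemma theta_functional_equation: "sigma_an q (theta_an q) = monom_an q 1 * theta_an q"
proof (rule cstar_analytic_eqI)
  fix n :: int
  have even: "(n - 1) * (n - 2) div 2 = n * (n - 1) div 2 - (n - 1)"
  proof -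
    have "(n - 1) * (n - 2) = n * (n - 1) + (- (n - 1)) * 2" by (simp add: algebra_simps)
    then show ?thesis by (simp only: div_mult_self1 zero_neq_numeral)
  qed
  have "coeff_an (monom_an q 1 * theta_an q) n = q * q powi (- ((n - 1) * (n - 2) div 2))"
    by (simp add: coeff_monom_times coeff_theta_an[OF q])
  also have "\<dots> = q powi (1 - ((n - 1) * (n - 2) div 2))"
    using q0 by (simp add: power_int_diff power_int_minus divide_inverse)
  also have "1 - ((n - 1) * (n - 2) div 2) = - (n * (n - 1) div 2) + n" by (simp add: even)
  also have "q powi (- (n * (n - 1) div 2) + n) = q powi (- (n * (n - 1) div 2)) * q powi n"
    by (rule power_int_add) (simp add: q0)
  also have "\<dots> = coeff_an (sigma_an q (theta_an q)) n"
    by (simp only: sigma_an.rep_eq coeff_theta_an[OF q])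
  finally show "coeff_an (sigma_an q (theta_an q)) n = coeff_an (monom_an q 1 * theta_an q) n" ..
qed

lemma theta_nonzero: "theta_an q \<noteq> 0"
proof
  assume "theta_an q = 0"
  then have "coeff_an (theta_an q) 0 = 0" by (simp add: zero_cstar_analytic.rep_eq)
  then show False by (simp add: coeff_theta_an[OF q])
qed

text \<open>
  This is the logarithmic derivative of the functional equation of \<open>\<theta>\<^sub>q\<close>.
\<close>

lemma sg_l: "sg l = l + 1"
proof -
  let ?t = "to_fract (theta_an q)"
  have t: "?t \<noteq> 0" by (simp add: theta_nonzero)
  have "sg ?t = const_mero q * x * ?t"
    by (simp add: sigma_mero_to_fract q0 theta_functional_equation const_mero_def x_mero_def monom_an_mult
        flip: to_fract_mult)
  moreover have "dx.dlog (const_mero q * x * ?t) = 1 + dx.dlog ?t"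
    using t x_nonzero q0 by (simp add: dx.dlog_mult const_mero_eq_0_iff)
      (simp add: dx.dlog_def delta_x_const delta_x_x x_nonzero)
  ultimately have "sg (dx.dlog ?t) = dx.dlog ?t + 1" by (simp add: add.commute flip: dx.dlog_sg)
  then show ?thesis by (simp add: ell_def dx.dlog_def)
qed

subsection \<open>The second derivation\<close>

lemma derivation_coeffwise: "derivation (coeffwise_an D)"
  and coeff_coeffwise: "coeff_an (coeffwise_an D f) n = D (coeff_an f n)"
proof -
  obtain B where B: "\<And>c. absv (D c) \<le> B * absv c"
    using continuous_derivation_bounded[OF D D_cont q] by blast
  show "derivation (coeffwise_an D)" by (rule derivation_coeffwise_an[OF D B D_cont])
  show "coeff_an (coeffwise_an D f) n = D (coeff_an f n)" by (rule coeff_coeffwise_an[OF B])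
qed

lemma derivation_delta_q: "derivation (delta_q D)"
  unfolding delta_q_def by (rule derivation_fract_deriv[OF derivation_coeffwise])

lemma delta_q_to_fract: "delta_q D (to_fract f) = to_fract (coeffwise_an D f)"
  unfolding delta_q_def by (rule fract_deriv_to_fract[OF derivation_coeffwise])

lemma D_q_powi: "D (q powi n) = of_int n * q powi n"
proof -
  interpret D: field_derivation D by standard (rule D)
  have "D.dlog q = 1" using q0 by (simp add: D.dlog_def Dq)
  then have "D.dlog (q powi n) = of_int n" using D.dlog_power_int[OF q0, of n] by simp
  then show ?thesis using q0 by (simp add: D.dlog_def field_simps)
qed

text \<open>
  Since \<open>D (q\<^sup>n) = n q\<^sup>n\<close>, differentiating the coefficients of \<open>f(q x)\<close> produces the extra term
  \<open>x f'(q x)\<close>.  The summand \<open>\<ell>\<^sub>q \<delta>\<^sub>x\<close> of the second derivation compensates it, because \<open>\<ell>\<^sub>q(q x) = \<ell>\<^sub>q(x) + 1\<close>.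
\<close>

lemma delta_q_sg: "delta_q D (sg z) = sg (delta_q D z + delta_x z)"
proof -
  have "coeffwise_an D (sigma_an q f) = sigma_an q (coeffwise_an D f + delta_x_an f)" for f
  proof (rule cstar_analytic_eqI)
    fix n
    have "D (coeff_an f n * q powi n) = D (coeff_an f n) * q powi n + coeff_an f n * D (q powi n)"
      using D by (simp add: derivation_def)
    then show "coeff_an (coeffwise_an D (sigma_an q f)) n
        = coeff_an (sigma_an q (coeffwise_an D f + delta_x_an f)) n"
      by (simp add: coeff_coeffwise sigma_an.rep_eq plus_cstar_analytic.rep_eq delta_x_an.rep_eq D_q_powi
          algebra_simps)
  qed
  then have ring: "delta_q D (sg (to_fract f)) = sg (delta_q D (to_fract f) + delta_x (to_fract f))" for f
    by (simp add: sigma_mero_to_fract q0 delta_q_to_fract delta_x_to_fract flip: to_fract_add)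
  have "derivation (\<lambda>z. delta_q D z + delta_x z)"
    using derivation_delta_q derivation_delta_x by (auto simp: derivation_def algebra_simps)
  from derivation_twist_fract[OF difference_field_sigma_mero[OF q0] derivation_delta_q this ring]
  show ?thesis .
qed

sublocale d2: difference_differential_field "sigma_mero q" "partial2 q D"
proof
  show "derivation (partial2 q D)"
    unfolding derivation_def
  proof (intro allI conjI)
    interpret dq: field_derivation "delta_q D" by standard (rule derivation_delta_q)
    fix y z
    show "partial2 q D (y + z) = partial2 q D y + partial2 q D z"
      by (simp add: partial2_def dx.del_add dq.del_add algebra_simps)
    show "partial2 q D (y * z) = partial2 q D y * z + y * partial2 q D z"
      by (simp add: partial2_def dx.del_mult dq.del_mult algebra_simps)
  qed
  show "partial2 q D (sg z) = sg (partial2 q D z)" for z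
    by (simp add: partial2_def dx.del_sg delta_q_sg sg_add sg_mult sg_l algebra_simps)
qed

lemma delta_q_const: "delta_q D (const_mero c) = const_mero (D c)"
proof -
  have "coeffwise_an D (monom_an c 0) = monom_an (D c) 0"
    by (rule cstar_analytic_eqI) (simp add: coeff_coeffwise monom_an.rep_eq derivation_0[OF D])
  then show ?thesis by (simp add: const_mero_def delta_q_to_fract)
qed

lemma delta_q_x: "delta_q D x = 0"
proof -
  have "coeffwise_an D (monom_an 1 1) = 0"
    by (rule cstar_analytic_eqI)
      (simp add: coeff_coeffwise monom_an.rep_eq derivation_0[OF D] derivation_one[OF D] zero_cstar_analytic.rep_eq)
  then show ?thesis by (simp add: x_mero_def delta_q_to_fract)
qed

lemma partial2_const: "partial2 q D (const_mero c) = const_mero (D c)"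
  by (simp add: partial2_def delta_x_const delta_q_const)

lemma partial2_x: "partial2 q D x = l * x"
  by (simp add: partial2_def delta_x_x delta_q_x)

subsection \<open>Transcendence of \<open>x\<close>\<close>

definition CEl :: "'c cstar_mero set" where
  "CEl = subfield_generated (insert l consts_sg)"

lemma CEl_subfield: "is_subfield CEl" and consts_CEl: "consts_sg \<subseteq> CEl" and l_CEl: "l \<in> CEl"
  using subfield_generated_superset[of "insert l consts_sg"]
  by (auto simp: CEl_def subfield_generated_subfield)

lemma sg_CEl: "sg ` CEl \<subseteq> CEl"
  unfolding CEl_def
proof (rule generated_stable)
  have "sg l \<in> CEl" unfolding sg_l by (intro subfield_add[OF CEl_subfield] l_CEl subfield_one[OF CEl_subfield])
  moreover have "sg c \<in> CEl" if "c \<in> consts_sg" for c using that consts_CEl by (auto simp: consts_sg_iff)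
  ultimately show "sg ` insert l consts_sg \<subseteq> subfield_generated (insert l consts_sg)"
    by (auto simp: CEl_def)
qed

text \<open>
  The derivative of \<open>\<ell>\<^sub>q\<close> is invariant, because the increment \<open>1\<close> of \<open>\<ell>\<^sub>q\<close> has derivative \<open>0\<close>.
\<close>

lemma del_CEl:
  assumes "difference_differential_field sg del"
  shows "del ` CEl \<subseteq> CEl"
proof -
  interpret del: difference_differential_field sg del by fact
  have "del l \<in> consts_sg"
    by (simp add: consts_sg_iff sg_l del.del_add del.del_1 flip: del.del_sg)
  then have "del ` insert l consts_sg \<subseteq> CEl"
    using consts_CEl del.del_consts by auto
  then show ?thesis unfolding CEl_def by (rule del.generated_del_stable)
qed

interpretation CE: difference_subfield "sigma_mero q" consts_sg
  by standard (auto simp: consts_sg_subfield consts_sg_iff)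

interpretation CEl: difference_subfield "sigma_mero q" CEl
  by standard (use CEl_subfield sg_CEl consts_CEl in auto)

lemma l_notin_consts: "l \<notin> consts_sg"
  by (simp add: consts_sg_iff sg_l)

lemma l_transcendental:
  assumes "p \<in> polys_over consts_sg" "poly p l = 0"
  shows "p = 0"
proof (rule ccontr)
  assume "p \<noteq> 0"
  then have "algebraic_over consts_sg l" using assms by (auto simp: algebraic_over_def)
  then have "l \<in> consts_sg"
    using CE.additive_algebraic_in_subfield[OF sg_l subfield_one[OF consts_sg_subfield]] by blast
  then show False using l_notin_consts by blast
qed

text \<open>
  An equation for \<open>x\<close> would put a power of \<open>x\<close> into \<open>C\<^sub>E(\<ell>)\<close>; comparing leading coefficients in
  \<open>\<ell>\<close>, the dilation multiplies no nonzero element of that field by a nontrivial power of \<open>q\<close>.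
\<close>

lemma x_transcendental:
  assumes "p \<in> polys_over CEl" "poly p x = 0"
  shows "p = 0"
proof (rule ccontr)
  assume "p \<noteq> 0"
  then have "algebraic_over CEl x" using assms by (auto simp: algebraic_over_def)
  moreover have "const_mero q \<in> CEl" using const_mero_subset_consts consts_CEl by blast
  ultimately obtain m where m: "m > 0" "x ^ m \<in> CEl"
    using CEl.multiplicative_algebraic_imp_power[OF sg_x _ x_nonzero] by blast
  obtain P Q where PQ: "P \<in> polys_over consts_sg" "Q \<in> polys_over consts_sg" "poly Q l \<noteq> 0"
    "x ^ m = poly P l / poly Q l"
    using subfield_generated_insertE[OF consts_sg_subfield m(2)[unfolded CEl_def]] by blast
  have PQ0: "P \<noteq> 0" "Q \<noteq> 0" using PQ x_nonzero by auto
  define T where "T = (\<lambda>p :: 'c cstar_mero poly. pcompose p [:1, 1:])"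
  have T: "T p \<in> polys_over consts_sg" "poly (T p) l = sg (poly p l)" if "p \<in> polys_over consts_sg" for p
  proof -
    show "T p \<in> polys_over consts_sg" unfolding T_def
      using that by (intro polys_over_pcompose polys_over_linear consts_sg_subfield subfield_one)
    have "map_poly sg p = p"
      using polys_overD[OF that] by (intro poly_eqI) (simp add: coeff_twist consts_sg_iff)
    then have "sg (poly p l) = poly p (sg l)" using poly_twist[of p l] by simp
    then show "poly (T p) l = sg (poly p l)" by (simp add: T_def poly_pcompose sg_l add.commute)
  qed
  have lead_T: "lead_coeff (T p) = lead_coeff p" for p
    unfolding T_def by (subst lead_coeff_comp) auto
  have "sg (x ^ m) = const_mero q ^ m * x ^ m" by (simp add: sg_power sg_x power_mult_distrib)
  then have "sg (poly P l) * poly Q l = const_mero q ^ m * poly P l * sg (poly Q l)"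
    using PQ(3) sg_eq_0_iff unfolding PQ(4) by (simp add: sg_divide field_simps)
  then have "poly (T P * Q - smult (const_mero q ^ m) (P * T Q)) l = 0"
    using PQ T by (simp add: mult.assoc)
  moreover have "T P * Q - smult (const_mero q ^ m) (P * T Q) \<in> polys_over consts_sg"
    using PQ T const_mero_subset_consts
    by (intro polys_over_diff polys_over_mult polys_over_smult subfield_power consts_sg_subfield) auto
  ultimately have "T P * Q - smult (const_mero q ^ m) (P * T Q) = 0" using l_transcendental by blast
  then have "lead_coeff (T P * Q) = lead_coeff (smult (const_mero q ^ m) (P * T Q))" by simp
  then have "const_mero q ^ m = 1"
    using PQ0 unfolding lead_coeff_mult lead_coeff_smult lead_T by simp
  then show False using q_power_neq_1 m(1) by blast
qed

end

section \<open>Elliptic functions are algebraically dependent\<close>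

text \<open>
  The index of the last dominant term of the Laurent series on the unit circle.  By the theory of
  Newton polygons, its increment when \<open>f(x)\<close> is replaced by \<open>f(q x)\<close> is the number of zeros of \<open>f\<close> in the
  annulus \<open>1 < |z| \<le> |q|\<close>, a fundamental domain of the dilation.
\<close>

definition last_max :: "'a::complete_nonarch_field cstar_analytic \<Rightarrow> int \<Rightarrow> bool" where
  "last_max f i \<longleftrightarrow> coeff_an f i \<noteq> 0 \<and> (\<forall>j. absv (coeff_an f j) \<le> absv (coeff_an f i)) \<and>
     (\<forall>j>i. absv (coeff_an f j) < absv (coeff_an f i))"

lemma last_max_exists:
  assumes "f \<noteq> 0"
  obtains i where "last_max f i"
proof -
  obtain k where "coeff_an f k \<noteq> 0"
    using assms cstar_analytic_eqI[of f 0] by (auto simp: zero_cstar_analytic.rep_eq)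
  then obtain i where "coeff_an f i \<noteq> 0" "\<And>j. absv (coeff_an f j) \<le> absv (coeff_an f i)"
    "\<And>j. j > i \<Longrightarrow> absv (coeff_an f j) < absv (coeff_an f i)"
    using null_family_last_max[OF coeff_an_null1[of f]] by blast
  then show thesis using that unfolding last_max_def by blast
qed

lemma last_max_unique: "last_max f i \<Longrightarrow> last_max f j \<Longrightarrow> i = j"
  unfolding last_max_def by (metis leD linorder_neqE)

lemma last_max_nonzero: "last_max f i \<Longrightarrow> f \<noteq> 0"
  by (auto simp: last_max_def zero_cstar_analytic.rep_eq)

text \<open>
  As in Gauss' lemma, in the coefficient of index \<open>i + j\<close> of the product one term dominates all others.
\<close>

lemma last_max_mult:
  fixes f g :: "'a::complete_nonarch_field cstar_analytic"
  assumes f: "last_max f i" and g: "last_max g j"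
  shows "last_max (f * g) (i + j)"
proof -
  define a b where "a = coeff_an f" and "b = coeff_an g"
  have a: "a i \<noteq> 0" "\<And>m. absv (a m) \<le> absv (a i)" "\<And>m. m > i \<Longrightarrow> absv (a m) < absv (a i)"
    and b: "b j \<noteq> 0" "\<And>m. absv (b m) \<le> absv (b j)" "\<And>m. m > j \<Longrightarrow> absv (b m) < absv (b j)"
    using f g by (auto simp: last_max_def a_def b_def)
  define B where "B = absv (a i) * absv (b j)"
  have B: "B > 0" using a b by (simp add: B_def)
  have coeff: "coeff_an (f * g) n = (\<Sum>\<^sub>\<infinity>m. a m * b (n - m))" for n
    by (simp add: times_cstar_analytic.rep_eq a_def b_def)
  have sum: "(\<lambda>m. a m * b (n - m)) summable_on UNIV" for n
    unfolding a_def b_def by (rule conv_summable)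
  have term_le: "absv (a m * b k) \<le> B" for m k
    unfolding absv_mult B_def by (intro mult_mono a b) auto
  have term_less: "absv (a m * b k) < B" if "m > i \<or> k > j" for m k
    using that
  proof
    assume "m > i"
    have "absv (a m) * absv (b k) \<le> absv (a m) * absv (b j)" by (intro mult_left_mono b) auto
    also have "\<dots> < B" unfolding B_def using a(3)[OF \<open>m > i\<close>] b(1) by simp
    finally show ?thesis by (simp add: absv_mult)
  next
    assume "k > j"
    have "absv (a m) * absv (b k) \<le> absv (a i) * absv (b k)" by (intro mult_right_mono a) auto
    also have "\<dots> < B" unfolding B_def using b(3)[OF \<open>k > j\<close>] a(1) by simp
    finally show ?thesis by (simp add: absv_mult)
  qed
  have le: "absv (coeff_an (f * g) n) \<le> B" for n
  proof (rule field_le_epsilon)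
    fix e :: real assume "e > 0"
    then have "absv (\<Sum>\<^sub>\<infinity>m. a m * b (n - m)) < B + e"
      using B by (intro na_infsum_less[OF sum] le_less_trans[OF term_le]) auto
    then show "absv (coeff_an (f * g) n) \<le> B + e" by (simp add: coeff)
  qed
  have less: "absv (coeff_an (f * g) n) < B" if "n > i + j" for n
    unfolding coeff using that by (intro na_infsum_less[OF sum _ B] term_less) auto
  have top: "absv (coeff_an (f * g) (i + j)) = B"
  proof (rule antisym[OF le])
    define s where "s = (\<lambda>m. a m * b (i + j - m))"
    have s: "s summable_on UNIV - {i}"
      unfolding s_def using sum by (rule summable_on_cofin_subset) auto
    have "coeff_an (f * g) (i + j) = infsum s (insert i (UNIV - {i}))"
      by (simp add: coeff s_def insert_absorb)
    also have "\<dots> = s i + infsum s (UNIV - {i})"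
      using s by (subst infsum_insert) auto
    finally have "s i = coeff_an (f * g) (i + j) - infsum s (UNIV - {i})" by simp
    then have "absv (s i) \<le> max (absv (coeff_an (f * g) (i + j))) (absv (infsum s (UNIV - {i})))"
      using absv_diff by metis
    moreover have "absv (infsum s (UNIV - {i})) < B"
      by (rule na_infsum_less[OF s _ B]) (auto simp: s_def intro!: term_less)
    moreover have "absv (s i) = B" by (simp add: s_def B_def absv_mult)
    ultimately show "B \<le> absv (coeff_an (f * g) (i + j))" by linarith
  qed
  have "coeff_an (f * g) (i + j) \<noteq> 0" using top B by auto
  then show ?thesis unfolding last_max_def top using le less by blast
qed

lemma last_max_power: "last_max f i \<Longrightarrow> last_max (f ^ n) (int n * i)"
proof (induction n)
  case 0
  show ?case by (auto simp: last_max_def one_cstar_analytic_def monom_an.rep_eq)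
next
  case (Suc n)
  then show ?case using last_max_mult[of f i "f ^ n" "int n * i"] by (simp add: algebra_simps)
qed

subsection \<open>Division by a linear factor\<close>

lemma null_family_subset:
  assumes "null_family f A" "B \<subseteq> A"
  shows "null_family f B"
  unfolding null_family_def
proof (intro allI impI)
  fix e :: real assume "e > 0"
  then have "finite {i \<in> A. e \<le> absv (f i)}" using assms(1) by (simp add: null_family_def)
  then show "finite {i \<in> B. e \<le> absv (f i)}" by (rule rev_finite_subset) (use assms(2) in auto)
qed

lemma powi_ratio_mono:
  fixes r :: real
  assumes "r > 0" "1 \<le> r \<and> n \<le> j \<or> r \<le> 1 \<and> j \<le> n"
  shows "r powi n \<le> r powi j"
proof (cases "1 \<le> r \<and> n \<le> j")
  case True
  then show ?thesis by (intro power_int_increasing) auto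
next
  case False
  then show ?thesis using assms by (intro power_int_decreasing) auto
qed

text \<open>
  The coefficients of the quotient are, up to powers of \<open>z\<close>, the tails of the series \<open>f(z)\<close>.  As the
  total sum is \<open>0\<close>, the tail in one direction is minus the tail in the other, and so they are small
  in both directions.
\<close>

lemma divide_linear_factor:
  fixes f :: "'a::complete_nonarch_field cstar_analytic"
  assumes z: "z \<noteq> 0" and root: "eval_an f z = 0"
  obtains g where "f = (monom_an 1 1 + monom_an (- z) 0) * g"
proof -
  define A where "A = (\<lambda>j. coeff_an f j * z powi j)"
  define c where "c = (\<lambda>n. infsum A {n<..})"
  define b where "b = (\<lambda>n. c n / z powi (n + 1))"
  have z_pow: "z powi (n + 1) = z powi n * z" for n
    by (rule power_int_add_1) (simp add: z)
  have null: "null_family (\<lambda>j. coeff_an f j * y powi j) I" if "y \<noteq> 0" for y I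
    using coeff_an_null[OF that, of f] by (rule null_family_subset) simp
  have sumA: "A summable_on I" for I
    unfolding na_summable_iff A_def by (rule null[OF z])
  have c_below: "c n = - infsum A {..n}" for n
  proof -
    have "infsum A ({..n} \<union> {n<..}) = infsum A {..n} + c n"
      unfolding c_def by (rule infsum_Un_disjoint) (use sumA in auto)
    moreover have "{..n} \<union> {n<..} = UNIV" by auto
    ultimately show ?thesis using root by (simp add: eval_an_def A_def eq_neg_iff_add_eq_0 add.commute)
  qed
  have c_step: "c (n - 1) = A n + c n" for n
  proof -
    have "{n - 1<..} = insert n {n<..}" by auto
    then show ?thesis unfolding c_def using sumA by (simp add: infsum_insert)
  qed
  \<comment> \<open>\<open>I\<close> is one of the two tails and \<open>X\<close> a point where the terms of \<open>f\<close> with index in \<open>I\<close> dominate: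
    a large term of the quotient comes from a large term of \<open>f\<close> further out\<close>
  have bound: "\<exists>j\<in>I. absv (coeff_an f j * X powi j) \<ge> e * absv z"
    if X: "X \<noteq> 0" and e: "e > 0" and cn: "c n = s * infsum A I" "s = 1 \<or> s = -1"
      and mono: "\<And>j. j \<in> I \<Longrightarrow> absv (X / z) powi n \<le> absv (X / z) powi j"
      and ge: "absv (b n * X powi n) \<ge> e" for X n e s I
  proof (rule ccontr)
    assume neg: "\<not> (\<exists>j\<in>I. absv (coeff_an f j * X powi j) \<ge> e * absv z)"
    have small: "absv (coeff_an f j * X powi j) < e * absv z" if "j \<in> I" for j
      using neg \<open>j \<in> I\<close> by (meson not_less)
    have "absv (infsum (\<lambda>j. A j * (X / z) powi n) I) < e * absv z"
    proof (rule na_infsum_less)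
      show "(\<lambda>j. A j * (X / z) powi n) summable_on I"
        using sumA by (rule summable_on_cmult_left)
      show "0 < e * absv z" using e z by simp
      fix j assume j: "j \<in> I"
      have "absv (A j * (X / z) powi n) = absv (A j) * absv (X / z) powi n"
        by (simp add: absv_mult absv_powi)
      also have "\<dots> \<le> absv (A j) * absv (X / z) powi j"
        by (rule mult_left_mono[OF mono[OF j]]) simp
      also have "\<dots> = absv (coeff_an f j * X powi j)"
        using z by (simp add: A_def absv_mult absv_powi absv_divide power_int_divide_distrib)
      also have "\<dots> < e * absv z" by (rule small[OF j])
      finally show "absv (A j * (X / z) powi n) < e * absv z" .
    qed
    moreover have "infsum (\<lambda>j. A j * (X / z) powi n) I = infsum A I * (X / z) powi n"
      using sumA by (rule infsum_cmult_left)
    moreover have "absv (c n) = absv (infsum A I)" using cn by auto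
    ultimately have "absv (c n * (X / z) powi n) < e * absv z" by (simp add: absv_mult)
    moreover have "c n * (X / z) powi n = b n * X powi n * z"
      using z by (simp add: b_def power_int_divide_distrib z_pow)
    ultimately have "absv (b n * X powi n) * absv z < e * absv z" by (simp add: absv_mult)
    then have "absv (b n * X powi n) < e" by (rule mult_right_less_imp_less) simp
    then show False using ge by linarith
  qed
  have "(\<lambda>n. b n * x powi n) summable_on UNIV" if x: "x \<noteq> 0" for x
    unfolding na_summable_iff null_family_def
  proof (intro allI impI)
    fix e :: real assume e: "e > 0"
    define X where "X = (if absv x \<ge> absv z then x else z)"
    define Y where "Y = (if absv x \<le> absv z then x else z)"
    have XY: "X \<noteq> 0" "Y \<noteq> 0" "absv x \<le> absv X" "absv z \<le> absv X" "absv Y \<le> absv x" "absv Y \<le> absv z"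
      using x z by (auto simp: X_def Y_def)
    define JX JY where "JX = {j. absv (coeff_an f j * X powi j) \<ge> e * absv z}"
      and "JY = {j. absv (coeff_an f j * Y powi j) \<ge> e * absv z}"
    have fin: "finite JX" "finite JY"
      using null[OF XY(1), of UNIV] null[OF XY(2), of UNIV] e z
      by (auto simp: null_family_def JX_def JY_def)
    have "n \<in> (\<Union>j\<in>JX. {0..j}) \<union> (\<Union>j\<in>JY. {j..0})" if ge: "absv (b n * x powi n) \<ge> e" for n
    proof (cases "n \<ge> 0")
      case True
      have "absv x powi n \<le> absv X powi n"
        using XY(3) True by (simp add: power_int_def power_mono)
      then have "absv (b n) * absv x powi n \<le> absv (b n) * absv X powi n" by (rule mult_left_mono) simp
      then have "absv (b n * X powi n) \<ge> e" using ge by (simp add: absv_mult absv_powi)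
      moreover have "absv (X / z) powi n \<le> absv (X / z) powi j" if "j \<in> {n<..}" for j
        using that XY z by (intro powi_ratio_mono) (auto simp: absv_divide field_simps)
      ultimately have "\<exists>j\<in>{n<..}. absv (coeff_an f j * X powi j) \<ge> e * absv z"
        by (intro bound[OF XY(1) e, of n 1]) (auto simp: c_def)
      then show ?thesis using True by (auto simp: JX_def)
    next
      case False
      have "absv x powi n \<le> absv Y powi n"
        using XY(2,5) False by (auto simp: power_int_def intro!: power_mono le_imp_inverse_le)
      then have "absv (b n) * absv x powi n \<le> absv (b n) * absv Y powi n" by (rule mult_left_mono) simp
      then have "absv (b n * Y powi n) \<ge> e" using ge by (simp add: absv_mult absv_powi)
      moreover have "absv (Y / z) powi n \<le> absv (Y / z) powi j" if "j \<in> {..n}" for j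
        using that XY z by (intro powi_ratio_mono) (auto simp: absv_divide field_simps)
      ultimately have "\<exists>j\<in>{..n}. absv (coeff_an f j * Y powi j) \<ge> e * absv z"
        by (intro bound[OF XY(2) e, of n "-1"]) (auto simp: c_below)
      then show ?thesis using False by (auto simp: JY_def)
    qed
    then have "{n \<in> UNIV. absv (b n * x powi n) \<ge> e} \<subseteq> (\<Union>j\<in>JX. {0..j}) \<union> (\<Union>j\<in>JY. {j..0})"
      by blast
    moreover have "finite ((\<Union>j\<in>JX. {0..j}) \<union> (\<Union>j\<in>JY. {j..0::int}))" using fin by simp
    ultimately show "finite {n \<in> UNIV. absv (b n * x powi n) \<ge> e}" by (rule finite_subset)
  qed
  then have coeff_b: "coeff_an (Abs_an b) = b" by (rule coeff_Abs_an)
  have "f = (monom_an 1 1 + monom_an (- z) 0) * Abs_an b"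
  proof (rule cstar_analytic_eqI)
    fix n
    have "coeff_an ((monom_an 1 1 + monom_an (- z) 0) * Abs_an b) n = b (n - 1) - z * b n"
      by (simp add: distrib_right plus_cstar_analytic.rep_eq coeff_monom_times coeff_b)
    also have "\<dots> = (c (n - 1) - c n) / z powi n"
    proof -
      have "z * b n = c n / z powi n" using z by (simp add: b_def z_pow)
      moreover have "b (n - 1) = c (n - 1) / z powi n" by (simp add: b_def)
      ultimately show ?thesis by (simp only: diff_divide_distrib)
    qed
    also have "\<dots> = coeff_an f n" using z by (simp add: c_step A_def)
    finally show "coeff_an f n = coeff_an ((monom_an 1 1 + monom_an (- z) 0) * Abs_an b) n" ..
  qed
  then show thesis by (rule that)
qed

text \<open>
  For a linear factor \<open>x - z\<close> with \<open>|z| = |q|\<close> the dilation moves the dominant term from the constant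
  term to \<open>x\<close>; split off one such factor for each zero.
\<close>

lemma zeros_le_last_max_increment:
  fixes f :: "'a::complete_nonarch_field cstar_analytic"
  assumes q: "absv q > 1" and Z: "finite Z" "\<And>z. z \<in> Z \<Longrightarrow> absv z = absv q \<and> eval_an f z = 0"
    and i: "last_max f i" "last_max (sigma_an q f) i'"
  shows "int (card Z) \<le> i' - i"
  using Z i
proof (induction Z arbitrary: f i i' rule: finite_induct)
  case empty
  show ?case
  proof (rule ccontr)
    assume "\<not> ?thesis"
    then have less: "i' < i" by simp
    have "absv (coeff_an f i') * absv q powi i' \<le> absv (coeff_an f i) * absv q powi i'"
      using empty.prems(2) q by (intro mult_right_mono) (auto simp: last_max_def)
    also have "\<dots> < absv (coeff_an f i) * absv q powi i"
      using empty.prems(2) q less by (intro mult_strict_left_mono power_int_strict_increasing) (auto simp: last_max_def)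
    finally have "absv (coeff_an (sigma_an q f) i') < absv (coeff_an (sigma_an q f) i)"
      by (simp add: sigma_an.rep_eq absv_mult absv_powi)
    then show False using empty.prems(3) unfolding last_max_def by (meson leD)
  qed
next
  case (insert z Z)
  have zq: "absv z = absv q" "eval_an f z = 0" using insert.prems(1) by auto
  have "z \<noteq> 0" and q0: "q \<noteq> 0" using zq(1) q by (auto simp del: absv_pos)
  then have z: "absv z = absv q" "eval_an f z = 0" "z \<noteq> 0" using zq by simp_all
  define t where "t = monom_an 1 1 + monom_an (- z) 0"
  obtain g where g: "f = t * g" using divide_linear_factor[OF z(3,2)] by (auto simp: t_def)
  have "g \<noteq> 0" using last_max_nonzero[OF insert.prems(2)] g by auto
  then obtain k where k: "last_max g k" by (rule last_max_exists)
  have "sigma_an q g \<noteq> 0" using \<open>g \<noteq> 0\<close> q0 by (simp add: sigma_an_eq_0)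
  then obtain k' where k': "last_max (sigma_an q g) k'" by (rule last_max_exists)
  have "last_max t 0"
    using z q by (auto simp: last_max_def t_def plus_cstar_analytic.rep_eq monom_an.rep_eq)
  then have "i = k" using last_max_mult[OF _ k] insert.prems(2) last_max_unique g by fastforce
  have "last_max (sigma_an q t) 1"
    using z q q0 by (auto simp: last_max_def t_def sigma_an.rep_eq plus_cstar_analytic.rep_eq monom_an.rep_eq)
  then have "last_max (sigma_an q f) (1 + k')"
    unfolding g sigma_an_times[OF q0] by (rule last_max_mult[OF _ k'])
  then have "i' = 1 + k'" using insert.prems(3) last_max_unique by blast
  have "absv w = absv q \<and> eval_an g w = 0" if "w \<in> Z" for w
  proof -
    have wq: "absv w = absv q" "eval_an f w = 0" "w \<noteq> z"
      using insert.prems(1)[of w] that insert.hyps by auto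
    have "w \<noteq> 0" using wq(1) q by auto
    then have w: "absv w = absv q" "eval_an f w = 0" "w \<noteq> 0" "w \<noteq> z" using wq by simp_all
    have "eval_an t w = w - z" using w(3) by (simp add: t_def eval_an_plus eval_an_monom)
    then show ?thesis using w eval_an_times[OF w(3), of t g] g by simp
  qed
  then have "int (card Z) \<le> k' - k" using k k' by (rule insert.IH)
  then show ?case using insert.hyps \<open>i = k\<close> \<open>i' = 1 + k'\<close> by simp
qed

text \<open>
  Gaussian elimination of one unknown for each equation.
\<close>

lemma nontrivial_solution_underdetermined:
  fixes v :: "'i \<Rightarrow> nat \<Rightarrow> 'a::field"
  assumes "finite I" "n < card I"
  shows "\<exists>c. (\<exists>i\<in>I. c i \<noteq> 0) \<and> (\<forall>j<n. (\<Sum>i\<in>I. c i * v i j) = 0)"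
  using assms
proof (induction n arbitrary: I v)
  case 0
  then show ?case by (intro exI[of _ "\<lambda>_. 1"]) (auto simp: card_gt_0_iff)
next
  case (Suc n)
  show ?case
  proof (cases "\<forall>i\<in>I. v i n = 0")
    case True
    obtain c where "\<exists>i\<in>I. c i \<noteq> 0" "\<forall>j<n. (\<Sum>i\<in>I. c i * v i j) = 0"
      using Suc.IH[of I v] Suc.prems by auto
    then show ?thesis using True by (intro exI[of _ c]) (auto simp: less_Suc_eq)
  next
    case False
    then obtain p where p: "p \<in> I" "v p n \<noteq> 0" by blast
    define v' where "v' = (\<lambda>i j. v i j - v i n / v p n * v p j)"
    obtain c where c: "\<exists>i\<in>I - {p}. c i \<noteq> 0" "\<forall>j<n. (\<Sum>i\<in>I - {p}. c i * v' i j) = 0"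
    proof -
      have "n < card (I - {p})" using Suc.prems p by (simp add: card_Diff_singleton)
      then show thesis using Suc.IH[of "I - {p}" v'] Suc.prems(1) that by blast
    qed
    define s where "s = (\<Sum>i\<in>I - {p}. c i * (v i n / v p n))"
    define c' where "c' = c(p := - s)"
    have "(\<Sum>i\<in>I. c' i * v i j) = (\<Sum>i\<in>I - {p}. c i * v' i j)" for j
    proof -
      have "(\<Sum>i\<in>I. c' i * v i j) = c' p * v p j + (\<Sum>i\<in>I - {p}. c' i * v i j)"
        using Suc.prems(1) p(1) by (rule sum.remove)
      also have "(\<Sum>i\<in>I - {p}. c' i * v i j) = (\<Sum>i\<in>I - {p}. c i * v i j)"
        by (intro sum.cong) (auto simp: c'_def)
      also have "c' p * v p j = - (\<Sum>i\<in>I - {p}. c i * (v i n / v p n * v p j))"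
        unfolding c'_def s_def fun_upd_same mult_minus_left sum_distrib_right by (simp add: mult_ac)
      finally show ?thesis by (simp add: v'_def right_diff_distrib sum_subtractf)
    qed
    moreover have "v' i n = 0" for i using p by (simp add: v'_def)
    ultimately show ?thesis
      using c by (intro exI[of _ c']) (auto simp: less_Suc_eq c'_def)
  qed
qed

lemma eval_an_sum:
  assumes "w \<noteq> 0"
  shows "eval_an (sum f I) w = (\<Sum>i\<in>I. eval_an (f i) w)"
  using assms
  by (induction I rule: infinite_finite_induct)
    (auto simp: eval_an_plus, simp_all add: eval_an_def zero_cstar_analytic.rep_eq)

context tate_dilation
begin

text \<open>
  A combination of the monomials \<open>e\<^sub>1\<^sup>i e\<^sub>2\<^sup>j\<close>, \<open>i, j \<le> N\<close>, has at most \<open>O(N)\<close> poles in a fundamental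
  domain, so it vanishes identically if it has more zeros; and there are \<open>(N + 1)\<^sup>2\<close> coefficients
  to impose these zeros.
\<close>

lemma elliptic_dependence:
  assumes e: "sg e1 = e1" "sg e2 = e2"
  obtains N c where "\<exists>p\<in>{..N} \<times> {..N}. c p \<noteq> 0"
    "(\<Sum>p\<in>{..N} \<times> {..N}. const_mero (c p) * (e1 ^ fst p * e2 ^ snd p)) = 0"
proof -
  obtain f1 g1 where 1: "g1 \<noteq> 0" "e1 = to_fract f1 / to_fract g1" by (rule fract_quotient_cases)
  obtain f2 g2 where 2: "g2 \<noteq> 0" "e2 = to_fract f2 / to_fract g2" by (rule fract_quotient_cases)
  define g F1 F2 where "g = g1 * g2" and "F1 = f1 * g2" and "F2 = f2 * g1"
  have g: "g \<noteq> 0" "e1 = to_fract F1 / to_fract g" "e2 = to_fract F2 / to_fract g"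
    using 1 2 by (simp_all add: g_def F1_def F2_def)
  obtain k where k: "last_max g k" using g(1) by (rule last_max_exists)
  have "sigma_an q g \<noteq> 0" using g(1) q0 by (simp add: sigma_an_eq_0)
  then obtain k' where k': "last_max (sigma_an q g) k'" by (rule last_max_exists)
  have kk': "k \<le> k'" using zeros_le_last_max_increment[OF q, of "{}" g k k'] k k' by simp
  \<comment> \<open>\<open>\<kappa>\<close> bounds the number of poles of \<open>e1\<close> and \<open>e2\<close> in a fundamental domain, and \<open>m\<close> exceeds the number
    of poles of a combination with exponents up to \<open>N\<close>; then \<open>m < (N + 1)\<^sup>2\<close>\<close>
  define \<kappa> where "\<kappa> = nat (k' - k)"
  define N where "N = 2 * \<kappa> + 1"
  define m where "m = 2 * N * \<kappa> + 1"
  define I where "I = {..N} \<times> {..N}"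
  have I: "finite I" "card I = (N + 1) * (N + 1)" by (simp_all add: I_def card_cartesian_product)
  have "m < card I" unfolding I(2) m_def N_def by (simp add: algebra_simps)
  \<comment> \<open>infinitely many points of absolute value \<open>|q|\<close>: natural numbers have absolute value at most \<open>1\<close>\<close>
  define w where "w = (\<lambda>j::nat. q + of_nat j)"
  have w: "absv (w j) = absv q" for j
  proof (rule antisym)
    have j: "absv (of_nat j :: 'c) \<le> 1" by (rule absv_of_nat)
    then show "absv (w j) \<le> absv q" using absv_add[of q "of_nat j"] q by (simp add: w_def)
    have "absv q \<le> max (absv (w j)) (absv (of_nat j :: 'c))"
      using absv_diff[of "w j" "of_nat j"] by (simp add: w_def)
    then show "absv q \<le> absv (w j)" using j q by linarith
  qed
  have w0: "w j \<noteq> 0" for j using w[of j] q by auto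
  have "inj w" by (auto simp: inj_def w_def)
  define G where "G = (\<lambda>p. F1 ^ fst p * F2 ^ snd p * g ^ (2 * N - fst p - snd p))"
  obtain c where c: "\<exists>p\<in>I. c p \<noteq> 0" "\<forall>j<m. (\<Sum>p\<in>I. c p * eval_an (G p) (w j)) = 0"
    using nontrivial_solution_underdetermined[OF I(1) \<open>m < card I\<close>, of "\<lambda>p j. eval_an (G p) (w j)"] by blast
  define \<Phi> where "\<Phi> = (\<Sum>p\<in>I. monom_an (c p) 0 * G p)"
  have root: "eval_an \<Phi> (w j) = 0" if "j < m" for j
    using c(2) that by (simp add: \<Phi>_def eval_an_sum w0 eval_an_times eval_an_monom)
  define \<epsilon> where "\<epsilon> = (\<Sum>p\<in>I. const_mero (c p) * (e1 ^ fst p * e2 ^ snd p))"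
  have to_fract_power: "to_fract (h ^ n) = to_fract h ^ n" for h :: "'c cstar_analytic" and n
    by (induction n) auto
  have to_fract_sum: "to_fract (sum h J) = (\<Sum>p\<in>J. to_fract (h p))"
    for h :: "nat \<times> nat \<Rightarrow> 'c cstar_analytic" and J
    by (induction J rule: infinite_finite_induct) auto
  have tg: "to_fract g \<noteq> 0" using g(1) by simp
  have \<epsilon>: "\<epsilon> = to_fract \<Phi> / to_fract g ^ (2 * N)"
  proof -
    have "to_fract (G p) = e1 ^ fst p * e2 ^ snd p * to_fract g ^ (2 * N)" if "p \<in> I" for p
    proof -
      have "2 * N = fst p + snd p + (2 * N - fst p - snd p)" using that by (auto simp: I_def)
      then have "to_fract g ^ (2 * N) = to_fract g ^ fst p * to_fract g ^ snd p * to_fract g ^ (2 * N - fst p - snd p)"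
        by (simp only: flip: power_add)
      then show ?thesis using tg by (simp add: G_def to_fract_power g(2,3) power_divide)
    qed
    then have "to_fract \<Phi> = \<epsilon> * to_fract g ^ (2 * N)"
      by (simp add: \<Phi>_def \<epsilon>_def to_fract_sum const_mero_def sum_distrib_right mult.assoc)
    then show ?thesis using tg by simp
  qed
  have "\<Phi> = 0"
  proof (rule ccontr)
    assume "\<Phi> \<noteq> 0"
    then obtain i where i: "last_max \<Phi> i" by (rule last_max_exists)
    have "sigma_an q \<Phi> \<noteq> 0" using \<open>\<Phi> \<noteq> 0\<close> q0 by (simp add: sigma_an_eq_0)
    then obtain i' where i': "last_max (sigma_an q \<Phi>) i'" by (rule last_max_exists)
    have "int (card (w ` {..<m})) \<le> i' - i"
      using root w by (intro zeros_le_last_max_increment[OF q _ _ i i']) auto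
    then have "int m \<le> i' - i" using \<open>inj w\<close> by (simp add: card_image inj_on_def inj_def)
    have "sg \<epsilon> = \<epsilon>" by (simp add: \<epsilon>_def sg_sum sg_mult sg_power sg_const e)
    then have "to_fract (sigma_an q \<Phi>) / to_fract (sigma_an q g) ^ (2 * N) = to_fract \<Phi> / to_fract g ^ (2 * N)"
      by (simp add: \<epsilon> sg_divide sg_power sigma_mero_to_fract q0)
    then have "to_fract (sigma_an q \<Phi> * g ^ (2 * N)) = to_fract (\<Phi> * sigma_an q g ^ (2 * N))"
      using tg \<open>sigma_an q g \<noteq> 0\<close> by (simp add: to_fract_power field_simps)
    then have "sigma_an q \<Phi> * g ^ (2 * N) = \<Phi> * sigma_an q g ^ (2 * N)" by (simp only: to_fract_eq_iff)
    then have "i' + int (2 * N) * k = i + int (2 * N) * k'"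
      using last_max_mult[OF i' last_max_power[OF k, of "2 * N"]]
        last_max_mult[OF i last_max_power[OF k', of "2 * N"]] last_max_unique by metis
    then have "i' - i = int (2 * N) * (k' - k)" by (simp add: algebra_simps)
    also have "k' - k = int \<kappa>" using kk' by (simp add: \<kappa>_def)
    finally show False using \<open>int m \<le> i' - i\<close> by (simp add: m_def flip: of_nat_mult)
  qed
  then have "\<epsilon> = 0" by (simp add: \<epsilon>)
  then show thesis using that[of N c] c(1) by (simp add: \<epsilon>_def I_def)
qed

lemma elliptic_algebraic:
  assumes e: "sg e1 = e1" "sg e2 = e2"
  shows "algebraic_over (range const_mero) e1 \<or>
    algebraic_over (subfield_generated (insert e1 (range const_mero))) e2"
proof -
  obtain N c where c: "\<exists>p\<in>{..N} \<times> {..N}. c p \<noteq> 0"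
    "(\<Sum>p\<in>{..N} \<times> {..N}. const_mero (c p) * (e1 ^ fst p * e2 ^ snd p)) = 0"
    using elliptic_dependence[OF e] by blast
  have C: "is_subfield (range (const_mero :: 'c \<Rightarrow> _))"
    by (rule const_mero_image_subfield) (auto simp: is_subfield_def)
  define v where "v = (\<lambda>i::nat. if i = 0 then e1 else e2)"
  define ex where "ex = (\<lambda>(p :: nat \<times> nat) (i::nat). if i = 0 then fst p else snd p)"
  define S where "S = {p \<in> {..N} \<times> {..N}. c p \<noteq> 0}"
  have two: "{..<2::nat} = {0, 1}" by auto
  have "(\<Sum>p\<in>S. const_mero (c p) * (\<Prod>i<2. v i ^ ex p i)) = 0"
  proof -
    have "(\<Sum>p\<in>S. const_mero (c p) * (\<Prod>i<2. v i ^ ex p i))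
        = (\<Sum>p\<in>{..N} \<times> {..N}. const_mero (c p) * (e1 ^ fst p * e2 ^ snd p))"
      by (rule sum.mono_neutral_cong_left) (auto simp: S_def two v_def ex_def const_mero_hom)
    then show ?thesis using c(2) by simp
  qed
  moreover have "inj_on (\<lambda>p. restrict (ex p) {..<2}) S"
  proof (rule inj_onI)
    fix p r assume eq: "restrict (ex p) {..<2} = restrict (ex r) {..<2}"
    show "p = r" using fun_cong[OF eq, of 0] fun_cong[OF eq, of 1] by (simp add: ex_def prod_eq_iff)
  qed
  moreover have "finite S" by (simp add: S_def)
  moreover have "S \<noteq> {}" using c(1) by (auto simp: S_def)
  ultimately obtain i where "i < 2" "algebraic_over (subfield_generated (range const_mero \<union> v ` {..<i})) (v i)"
    using dependent_monomials_imp_algebraic[OF C, of S "\<lambda>p. const_mero (c p)" ex 2 v]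
    by (auto simp: S_def const_mero_eq_0_iff)
  moreover have "subfield_generated (range const_mero) \<subseteq> (range const_mero :: 'c cstar_mero set)"
    by (rule subfield_generated_least[OF C order_refl])
  moreover have "range const_mero \<union> v ` {..<1} = insert e1 (range const_mero)" by (auto simp: v_def)
  ultimately show ?thesis
    using algebraic_over_mono[of "subfield_generated (range const_mero)" "range const_mero" e1]
    by (cases "i = 0") (simp_all add: v_def less_2_cases_iff)
qed

end

section \<open>The three equivalent conditions\<close>

lemma algebraic_over_member: "is_subfield L \<Longrightarrow> v \<in> L \<Longrightarrow> algebraic_over L v"
  unfolding algebraic_over_def
  by (intro bexI[of _ "[:- v, 1:]"]) (auto intro!: polys_over_linear subfield_closed)

lemma first_order_imp_relation:
  assumes F: "is_subfield F" and w: "w \<in> F" "del u = w * u"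
  shows "satisfies_alg_relation del F u"
proof (rule algebraic_imp_relation[OF F, where m = 1])
  let ?L = "subfield_generated (F \<union> (\<lambda>i. (del ^^ i) u) ` {..<1})"
  have "u \<in> ?L" "w \<in> ?L"
    using subfield_generated_superset[of "F \<union> (\<lambda>i. (del ^^ i) u) ` {..<1}"] w(1) by auto
  then have "(del ^^ 1) u \<in> ?L"
    using w(2) by (simp add: subfield_mult[OF subfield_generated_subfield])
  then show "algebraic_over ?L ((del ^^ 1) u)"
    by (rule algebraic_over_member[OF subfield_generated_subfield])
qed

lemma (in field_derivation) del_of_int: "del (of_int r) = 0"
proof -
  have "del (of_nat n) = 0" for n by (induction n) (auto simp: del_0 del_1 del_add)
  then show ?thesis by (cases r rule: int_cases2) (auto simp: del_uminus)
qed

context tate_dilation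
begin

abbreviation "F \<equiv> subfield_generated (elliptic_functions q \<union> {x, l})"

lemma F_eq: "F = subfield_generated (insert x CEl)"
  unfolding CEl_def subfield_generated_insert_generated elliptic_eq_consts
  by (simp add: insert_commute Un_commute)

lemma F_subfield: "is_subfield F"
  by (rule subfield_generated_subfield)

lemma F_members: "consts_sg \<subseteq> F" "x \<in> F" "l \<in> F" "range const_mero \<subseteq> F"
  using subfield_generated_superset[of "elliptic_functions q \<union> {x, l}"] const_mero_subset_consts
  by (auto simp: elliptic_eq_consts)

text \<open>
  The nondegeneracy condition holds because constants are annihilated by \<open>\<delta>\<^sub>x\<close>, whereas \<open>z \<noteq> 0\<close>.
\<close>

lemma criterion_delta_x:
  assumes k: "is_subfield k" "q \<in> k"
  shows "rational_coefficients sg delta_x CEl x (const_mero q) 1 (const_mero ` k) (range const_mero)"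
proof
  show "is_subfield (range (const_mero :: 'c \<Rightarrow> _))"
    by (rule const_mero_image_subfield) (auto simp: is_subfield_def)
  show "delta_x ` CEl \<subseteq> CEl" by (rule del_CEl) (rule dx.difference_differential_field_axioms)
  show "\<exists>z\<in>range const_mero. poly p z = 0"
    if "p \<in> polys_over (range const_mero)" "degree p > 0" for p :: "'c cstar_mero poly"
    using that by (rule const_mero_root)
  show "1 * z \<noteq> delta_x z" if "z \<in> range const_mero" "z \<noteq> 0" for z
    using that by (auto simp: delta_x_const)
qed (use k const_mero_subset_consts consts_CEl q0 CEl_subfield sg_CEl subfield_one[OF CEl_subfield] in
    \<open>auto simp: sg_x sg_const x_nonzero delta_x_x const_mero_eq_0_iff q_power_neq_1
      intro: x_transcendental const_mero_image_subfield\<close>)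

text \<open>
  The nondegeneracy condition holds because otherwise \<open>\<ell>\<^sub>q = D z / z\<close> would be a constant.
\<close>

lemma criterion_partial2:
  assumes k: "is_subfield k" "q \<in> k"
  shows "rational_coefficients sg (partial2 q D) CEl x (const_mero q) l (const_mero ` k) (range const_mero)"
proof
  show "is_subfield (range (const_mero :: 'c \<Rightarrow> _))"
    by (rule const_mero_image_subfield) (auto simp: is_subfield_def)
  show "partial2 q D ` CEl \<subseteq> CEl" by (rule del_CEl) (rule d2.difference_differential_field_axioms)
  show "\<exists>z\<in>range const_mero. poly p z = 0"
    if "p \<in> polys_over (range const_mero)" "degree p > 0" for p :: "'c cstar_mero poly"
    using that by (rule const_mero_root)
  show "l * z \<noteq> partial2 q D z" if z: "z \<in> range const_mero" "z \<noteq> 0" for z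
  proof
    assume *: "l * z = partial2 q D z"
    obtain c where c: "z = const_mero c" using z by auto
    have "l = const_mero (D c) / z" using * z by (simp add: c partial2_const field_simps)
    then have "l \<in> consts_sg" by (simp add: c consts_sg_iff sg_divide sg_const)
    then show False using l_notin_consts by blast
  qed
qed (use k const_mero_subset_consts consts_CEl q0 CEl_subfield sg_CEl l_CEl in
    \<open>auto simp: sg_x sg_const x_nonzero partial2_x const_mero_eq_0_iff q_power_neq_1
      intro: x_transcendental const_mero_image_subfield\<close>)

lemma dx_dlog_x: "dx.dlog x = 1"
  by (simp add: dx.dlog_def delta_x_x x_nonzero)

lemma dx_dlog_const: "dx.dlog (const_mero c) = 0"
  by (simp add: dx.dlog_def delta_x_const)

lemma d2_dlog_x: "d2.dlog x = l"
  by (simp add: d2.dlog_def partial2_x x_nonzero)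

lemma d2_dlog_const: "d2.dlog (const_mero c) = const_mero (D c / c)"
  by (simp add: d2.dlog_def partial2_const const_mero_divide)

text \<open>
  A solution of \<open>y(q x) = \<mu> x\<^sup>r g(q x) / g(x) y(x)\<close> is \<open>g\<close> times a solution of \<open>y(q x) = \<mu> x\<^sup>r y(x)\<close>.  The
  logarithmic derivative of the latter has increment \<open>r\<close> for \<open>\<delta>\<^sub>x\<close> and \<open>D \<mu> / \<mu> + r \<ell>\<^sub>q\<close> for the second
  derivation.  The functions \<open>r \<ell>\<^sub>q\<close> and \<open>(D \<mu> / \<mu>) \<ell>\<^sub>q + r \<ell>\<^sub>q (\<ell>\<^sub>q - 1) / 2\<close> have the same
  increments, so they differ from the logarithmic derivatives by elliptic functions.
\<close>

context
  fixes a u g :: "'c cstar_mero" and \<mu> :: 'c and r :: int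
  assumes u: "u \<noteq> 0" "sg u = a * u" and a: "a \<noteq> 0"
    and g: "g \<in> subfield_generated (range const_mero \<union> {x})" "g \<noteq> 0"
    and form: "a = const_mero \<mu> * x powi r * (sg g / g)"
begin

lemma mu_nonzero: "const_mero \<mu> \<noteq> 0"
  using a form by auto

lemma g_F: "g \<in> F"
proof -
  have "subfield_generated (range const_mero \<union> {x}) \<subseteq> F"
    using F_members by (intro subfield_generated_least F_subfield) auto
  then show ?thesis using g by blast
qed

lemma sg_quotient: "sg (u / g) = const_mero \<mu> * x powi r * (u / g)"
  using g(2) sg_eq_0_iff[of g] by (simp add: sg_divide u(2) form)

lemma quotient_nonzero: "u / g \<noteq> 0"
  using u g by simp

lemma sg_dlog_delta_x: "sg (dx.dlog (u / g)) = dx.dlog (u / g) + of_int r"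
proof -
  have "sg (dx.dlog (u / g)) = dx.dlog (const_mero \<mu> * x powi r * (u / g))"
    by (simp only: sg_quotient flip: dx.dlog_sg)
  also have "\<dots> = dx.dlog (const_mero \<mu> * x powi r) + dx.dlog (u / g)"
    by (rule dx.dlog_mult) (use mu_nonzero x_nonzero quotient_nonzero in auto)
  also have "dx.dlog (const_mero \<mu> * x powi r) = of_int r"
    using mu_nonzero x_nonzero
    by (simp add: dx.dlog_mult dx.dlog_power_int dx_dlog_const dx_dlog_x)
  finally show ?thesis by (simp add: add.commute)
qed

lemma standard_form_imp_delta_x_relation: "satisfies_alg_relation delta_x F u"
proof -
  define w where "w = dx.dlog (u / g)"
  have "w - of_int r * l \<in> consts_sg"
    using sg_dlog_delta_x by (simp add: w_def consts_sg_iff sg_hom sg_l algebra_simps)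
  then have "w - of_int r * l + of_int r * l \<in> F"
    using F_members by (intro subfield_add[OF F_subfield] subfield_mult[OF F_subfield] subfield_of_int[OF F_subfield]) auto
  then have wF: "w \<in> F" by simp
  have "delta_x ` F \<subseteq> F"
  proof -
    interpret crit: rational_coefficients sg delta_x CEl x "const_mero q" 1 "const_mero ` UNIV" "range const_mero"
      by (rule criterion_delta_x) (auto simp: is_subfield_def)
    show ?thesis using crit.F_stable(2) unfolding F_eq .
  qed
  then have "dx.dlog g \<in> F" unfolding dx.dlog_def using g_F by (intro subfield_divide[OF F_subfield]) auto
  moreover have "dx.dlog u = w + dx.dlog g" using u g by (simp add: w_def dx.dlog_divide)
  ultimately have "dx.dlog u \<in> F" using wF subfield_add[OF F_subfield] by simp
  moreover have "delta_x u = dx.dlog u * u" using u by (simp add: dx.dlog_def)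
  ultimately show ?thesis by (rule first_order_imp_relation[OF F_subfield])
qed

lemma standard_form_imp_partial2_relation: "satisfies_alg_relation (partial2 q D) F u"
proof -
  define w where "w = d2.dlog (u / g)"
  define e where "e = const_mero (D \<mu> / \<mu>)"
  have "sg w = d2.dlog (const_mero \<mu> * x powi r * (u / g))"
    unfolding w_def by (simp only: sg_quotient flip: d2.dlog_sg)
  also have "\<dots> = d2.dlog (const_mero \<mu> * x powi r) + w"
    unfolding w_def by (rule d2.dlog_mult) (use mu_nonzero x_nonzero quotient_nonzero in auto)
  also have "d2.dlog (const_mero \<mu> * x powi r) = e + of_int r * l"
    using mu_nonzero x_nonzero
    by (simp add: d2.dlog_mult d2.dlog_power_int d2_dlog_const d2_dlog_x e_def)
  finally have sg_w: "sg w = w + e + of_int r * l" by (simp add: algebra_simps)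
  define s where "s = e * l + of_int r * (l * (l - 1) / 2)"
  have "sg s = s + e + of_int r * l"
  proof -
    have "sg 2 = 2" using sg_of_nat[of 2] by simp
    then have "sg s = e * (l + 1) + of_int r * ((l + 1) * l / 2)"
      by (simp add: s_def sg_hom sg_l e_def sg_const)
    also have "(l + 1) * l / 2 = l * (l - 1) / 2 + l" by (simp add: field_simps)
    finally show ?thesis by (simp add: s_def algebra_simps)
  qed
  then have "w - s \<in> consts_sg" by (simp add: consts_sg_iff sg_diff sg_w)
  moreover have "s \<in> F"
  proof -
    have "e \<in> F" using F_members(4) by (auto simp: e_def)
    then show ?thesis
      unfolding s_def using F_members(3)
      by (intro subfield_closed[OF F_subfield])
  qed
  ultimately have "(w - s) + s \<in> F" using F_members(1) by (intro subfield_add[OF F_subfield]) auto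
  then have wF: "w \<in> F" by simp
  have "partial2 q D ` F \<subseteq> F"
  proof -
    interpret crit: rational_coefficients sg "partial2 q D" CEl x "const_mero q" l "const_mero ` UNIV" "range const_mero"
      by (rule criterion_partial2) (auto simp: is_subfield_def)
    show ?thesis using crit.F_stable(2) unfolding F_eq .
  qed
  then have "d2.dlog g \<in> F" unfolding d2.dlog_def using g_F by (intro subfield_divide[OF F_subfield]) auto
  moreover have "d2.dlog u = w + d2.dlog g" using u g by (simp add: w_def d2.dlog_divide)
  ultimately have "d2.dlog u \<in> F" using wF subfield_add[OF F_subfield] by simp
  moreover have "partial2 q D u = d2.dlog u * u" using u by (simp add: d2.dlog_def)
  ultimately show ?thesis by (rule first_order_imp_relation[OF F_subfield])
qed

text \<open>
  Over \<open>C(x)\<close> one differentiates once more: \<open>e = \<delta>\<^sub>x (dlog (u / g))\<close> is elliptic, hence algebraically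
  dependent on its own derivative.  As \<open>e\<close> and \<open>\<delta>\<^sub>x e\<close> determine \<open>\<delta>\<^sub>x\<^sup>2 u\<close> and \<open>\<delta>\<^sub>x\<^sup>3 u\<close> over the previous
  derivatives, the dependence becomes one for \<open>u\<close> of order two or three.
\<close>

lemma standard_form_imp_relation_over_Cx:
  "satisfies_alg_relation delta_x (subfield_generated (range const_mero \<union> {x})) u"
proof -
  define R where "R = subfield_generated (range const_mero \<union> {x})"
  have R: "is_subfield R" and CR: "range const_mero \<subseteq> R" and xR: "x \<in> R"
    using subfield_generated_superset[of "range const_mero \<union> {x}"]
    by (auto simp: R_def subfield_generated_subfield)
  have dR: "delta_x y \<in> R" if "y \<in> R" for y
  proof -
    have "delta_x ` (range const_mero \<union> {x}) \<subseteq> R"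
      using xR subfield_zero[OF R] by (auto simp: delta_x_const delta_x_x)
    then show ?thesis using dx.generated_del_stable[of "range const_mero \<union> {x}"] that by (auto simp: R_def)
  qed
  define \<gamma> where "\<gamma> = delta_x (dx.dlog g)"
  have gR: "g \<in> R" using g by (simp add: R_def)
  have \<gamma>: "\<gamma> \<in> R" unfolding \<gamma>_def dx.dlog_def by (intro dR subfield_divide[OF R] gR)
  define e where "e = delta_x (dx.dlog (u / g))"
  have sg_e: "sg e = e"
  proof -
    have "sg e = delta_x (dx.dlog (u / g) + of_int r)"
      unfolding e_def dx.del_sg[symmetric] sg_dlog_delta_x ..
    then show ?thesis by (simp add: e_def dx.del_add dx.del_of_int)
  qed
  have sg_de: "sg (delta_x e) = delta_x e" by (simp add: sg_e flip: dx.del_sg)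
  define U where "U = (\<lambda>i. (delta_x ^^ i) u)"
  have U0: "U 0 = u" and dU: "delta_x (U i) = U (Suc i)" for i by (simp_all add: U_def)
  have du: "delta_x u = U 1" using dU[of 0] by (simp add: U0)
  have e_eq: "e = delta_x (dx.dlog u) - \<gamma>"
    using u g by (simp add: e_def \<gamma>_def dx.dlog_divide dx.del_diff)
  have dlog_u: "delta_x (dx.dlog u) = U 2 / u - U 1 * U 1 / (u * u)"
    using u dU[of 1] by (simp add: dx.dlog_def dx.del_divide du numeral_2_eq_2 field_simps)
  have U2: "U 2 = u * e + (u * \<gamma> + U 1 * U 1 / u)"
    using u by (simp add: e_eq dlog_u field_simps)
  define L where "L = (\<lambda>n. subfield_generated (R \<union> U ` {..<n}))"
  have L: "is_subfield (L n)" and RL: "R \<subseteq> L n" and UL: "i < n \<Longrightarrow> U i \<in> L n" for i n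
    using subfield_generated_superset[of "R \<union> U ` {..<n}"]
    by (auto simp: L_def subfield_generated_subfield)
  have uL: "u \<in> L n" if "n > 0" for n using UL[OF that] by (simp add: U0)
  have goal: "satisfies_alg_relation delta_x R u" if "algebraic_over (L n) (U n)" for n
    using algebraic_imp_relation[OF R, of delta_x u n] that by (simp add: L_def U_def)
  consider "algebraic_over (range const_mero) e"
    | "algebraic_over (subfield_generated (insert e (range const_mero))) (delta_x e)"
    using elliptic_algebraic[OF sg_e sg_de] by blast
  then have "satisfies_alg_relation delta_x R u"
  proof cases
    case 1
    have "algebraic_over (L 2) e" using 1 CR RL[of 2] algebraic_over_mono by (meson order_trans)
    moreover have "u * \<gamma> + U 1 * U 1 / u \<in> L 2"
      using uL[of 2] UL[of 1 2] RL[of 2] \<gamma>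
      by (intro subfield_add[OF L] subfield_mult[OF L] subfield_divide[OF L]) auto
    ultimately have "algebraic_over (L 2) (U 2)"
      unfolding U2 using uL[of 2] u by (intro algebraic_over_affine[OF L]) auto
    then show ?thesis by (rule goal)
  next
    case 2
    have mem: "u \<in> L 3" "U 1 \<in> L 3" "U 2 \<in> L 3" "\<gamma> \<in> L 3" "delta_x \<gamma> \<in> L 3"
      using uL[of 3] UL[of 1 3] UL[of 2 3] RL[of 3] \<gamma> dR[OF \<gamma>] by auto
    have eL: "e \<in> L 3"
      unfolding e_eq dlog_u using mem by (intro subfield_closed[OF L])
    have "subfield_generated (insert e (range const_mero)) \<subseteq> L 3"
      using eL CR RL[of 3] by (intro subfield_generated_least L) auto
    then have alg: "algebraic_over (L 3) (delta_x e)" using 2 algebraic_over_mono by blast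
    define \<beta> where "\<beta> = U 1 * e + (U 1 * \<gamma> + u * delta_x \<gamma> +
        ((U 2 * U 1 + U 1 * U 2) * u - U 1 * U 1 * U 1) / (u * u))"
    have "delta_x (U 1) = U 2" using dU[of 1] by (simp add: numeral_2_eq_2)
    then have "delta_x (u * e + (u * \<gamma> + U 1 * U 1 / u)) = u * delta_x e + \<beta>"
      by (simp add: \<beta>_def dx.del_add dx.del_mult dx.del_divide du algebra_simps)
    moreover have "U 3 = delta_x (U 2)" using dU[of 2] by (simp add: numeral_3_eq_3 numeral_2_eq_2)
    ultimately have U3: "U 3 = u * delta_x e + \<beta>" by (simp only: U2)
    have "\<beta> \<in> L 3" unfolding \<beta>_def using mem eL by (intro subfield_closed[OF L])
    have "algebraic_over (L 3) (U 3)"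
      unfolding U3 using mem u
      using \<open>\<beta> \<in> L 3\<close> by (intro algebraic_over_affine[OF L alg])
    then show ?thesis by (rule goal)
  qed
  then show ?thesis by (simp add: R_def)
qed

end

end

theorem theorem2p6:
  fixes k K :: "'c::{complete_nonarch_field, alg_closed_field, field_char_0} set"
    and q :: 'c and d :: real and D :: "'c \<Rightarrow> 'c" and a u :: "'c cstar_mero"
  assumes k: "is_subfield k"
    and d: "d > 1"
    and absv_kq: "\<And>p. p \<in> polys_over k \<Longrightarrow> p \<noteq> 0 \<Longrightarrow> absv (poly p q) = d ^ Polynomial.degree p"
    and K: "finite_extension (subfield_generated (insert q k)) K"
    and C_smallest: "\<And>F. K \<subseteq> F \<Longrightarrow> alg_closed_subfield F \<Longrightarrow> complete F \<Longrightarrow> F = UNIV"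
    and D_derivation: "derivation D"
    and D_continuous: "continuous_on UNIV D"
    and D_kq: "\<And>p. p \<in> polys_over k \<Longrightarrow> D (poly p q) = q * poly (pderiv p) q"
    and a: "a \<in> subfield_generated (const_mero ` insert q k \<union> {x_mero})" "a \<noteq> 0"
    and u: "u \<noteq> 0" "sigma_mero q u = a * u"
  shows
    "((\<exists>r::int. \<exists>g \<in> subfield_generated (const_mero ` insert q k \<union> {x_mero}).
        \<exists>\<mu> \<in> subfield_generated (insert q k).
          g \<noteq> 0 \<and> a = const_mero \<mu> * x_mero powi r * (sigma_mero q g / g))
      \<longleftrightarrow> satisfies_alg_relation delta_x
            (subfield_generated (elliptic_functions q \<union> {x_mero, ell q})) u)
     \<and> (satisfies_alg_relation delta_x
          (subfield_generated (elliptic_functions q \<union> {x_mero, ell q})) u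
      \<longleftrightarrow> satisfies_alg_relation (partial2 q D)
            (subfield_generated (elliptic_functions q \<union> {x_mero, ell q})) u)
     \<and> (satisfies_alg_relation delta_x
          (subfield_generated (elliptic_functions q \<union> {x_mero, ell q})) u
      \<longrightarrow> satisfies_alg_relation delta_x
            (subfield_generated (range const_mero \<union> {x_mero})) u)"
proof -
  have k01: "0 \<in> k" "1 \<in> k" by (rule subfield_zero[OF k] subfield_one[OF k])+
  have X: "[:0, 1:] \<in> polys_over k" using k01 by (rule polys_over_linear[OF k])
  interpret tate_dilation q D
  proof
    show "absv q > 1" using absv_kq[OF X] d by simp
    show "D q = q" using D_kq[OF X] by (simp add: pderiv_pCons)
  qed (rule D_derivation D_continuous)+
  define k0 where "k0 = subfield_generated (insert q k)"
  have k0: "is_subfield k0" "q \<in> k0"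
    using subfield_generated_superset[of "insert q k"] by (auto simp: k0_def subfield_generated_subfield)
  have kx: "subfield_generated (const_mero ` insert q k \<union> {x}) = subfield_generated (insert x (const_mero ` k0))"
    unfolding k0_def const_mero_image_generated subfield_generated_insert_generated by simp
  let ?standard = "\<exists>r::int. \<exists>g \<in> subfield_generated (const_mero ` insert q k \<union> {x}).
      \<exists>\<mu> \<in> k0. g \<noteq> 0 \<and> a = const_mero \<mu> * x powi r * (sg g / g)"
  interpret cx: rational_coefficients sg delta_x CEl x "const_mero q" 1 "const_mero ` k0" "range const_mero"
    by (rule criterion_delta_x[OF k0])
  interpret c2: rational_coefficients sg "partial2 q D" CEl x "const_mero q" l "const_mero ` k0" "range const_mero"
    by (rule criterion_partial2[OF k0])
  have delta_x_standard: ?standard if "satisfies_alg_relation delta_x F u"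
    using cx.differentially_algebraic_imp_standard_form[OF a(1)[unfolded kx] a(2) u(1,2) that[unfolded F_eq]]
    unfolding kx by blast
  have partial2_standard: ?standard if "satisfies_alg_relation (partial2 q D) F u"
    using c2.differentially_algebraic_imp_standard_form[OF a(1)[unfolded kx] a(2) u(1,2) that[unfolded F_eq]]
    unfolding kx by blast
  have standard_relations: "satisfies_alg_relation delta_x F u \<and> satisfies_alg_relation (partial2 q D) F u \<and>
      satisfies_alg_relation delta_x (subfield_generated (range const_mero \<union> {x})) u" if ?standard
  proof -
    obtain r g \<mu> where g: "g \<in> subfield_generated (const_mero ` insert q k \<union> {x})" "g \<noteq> 0"
      and form: "a = const_mero \<mu> * x powi r * (sg g / g)" using \<open>?standard\<close> by blast
    have "const_mero ` insert q k \<union> {x} \<subseteq> range const_mero \<union> {x}" by auto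
    then have gR: "g \<in> subfield_generated (range const_mero \<union> {x})"
      using g(1) subfield_generated_mono by blast
    show ?thesis
      using standard_form_imp_delta_x_relation[OF u a(2) gR g(2) form]
        standard_form_imp_partial2_relation[OF u a(2) gR g(2) form]
        standard_form_imp_relation_over_Cx[OF u a(2) gR g(2) form] by blast
  qed
  show ?thesis
    unfolding k0_def[symmetric]
    using delta_x_standard partial2_standard standard_relations by blast
qed

end
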